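(* Let $X$, $A$, $J$, $P$, $G$ and the evolution family $\mathbb V$ be as in the context. (i) There exists a unique evolution family $\mathbb T_r$ on $X$ with time interval $J$ such that $$\mathbb T_r(t,\tau)x_\tau=\mathbb V(t,\tau)x_\tau+\int_\tau^t\mathbb V(t,s)P(s)^{-1}\dot P(s)\mathbb T_r(s,\tau)x_\tau\,ds$$ for all $x_\tau\in X$ and $(t,\tau)\in\Delta_J$. (ii) This $\mathbb T_r$ is also the unique solution of $$\mathbb T_r(t,\tau)x_\tau=\mathbb V(t,\tau)x_\tau+\int_\tau^t\mathbb T_r(t,s)P(s)^{-1}\dot P(s)\mathbb V(s,\tau)x_\tau\,ds,$$ for all $x_\tau\in X$ and $(t,\tau)\in\Delta_J$. (iii) Uniqueness in (i) and (ii) holds even in the following sense. If $\{\mathbb S(t,\tau)\}_{(t,\tau)\in\Delta_J}\subset\mathcal L(X)$ is such that $\mathbb S(\cdot,\cdot)z$ is weakly continuous for every $z\in X$, and $\mathbb S$ satisfies the respective equation with $\mathbb S$ in place of $\mathbb T_r$ (weak integrals) for all $x_\tau\in X$ and $(t,\tau)\in\Delta_J$, then $\mathbb S=\mathbb T_r$. (iv) For every $\tau\in J$ with $\tau<\sup J$ and every $x_\tau\in X$, the function $x(t):=\mathbb T_r(t,\tau)x_\tau$, $t\in J_\tau$, belongs to $C^1(J_\tau;X_{-1})$. It solves, in $X_{-1}$, $$\dot x(t)=\big(A_{-1}P(t)+G(t)\big)x(t),\quad t\in J_\tau,\qquad x(\tau)=x_\tau .$$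
   Context: Setting. $X$ is a complex Hilbert space and $A:\operatorname{dom}A\subset X\to X$ generates a $C_0$-semigroup of contractions on $X$. $J\subset\mathbb R$ is a closed interval of positive length. Put $\Delta_J:=\{(t,\tau)\in J^2:t\ge\tau\}$ and $J_\tau:=\{t\in J:t\ge\tau\}$. Standing assumptions on $P,G:J\to\mathcal L(X)$: - for each $t$, $P(t)=P(t)^*\ge0$ and $P(t)$ is invertible in $\mathcal L(X)$; - for each $z$, $P(\cdot)z$ and $P(\cdot)^{-1}z$ lie in $C^1(J;X)$, and $G(\cdot)z$ lies in $C(J;X)$; - $\dot P$ is the strong derivative. Evolution families. An evolution family on $X$ with time interval $J$ is a family $\{\mathbb T(t,\tau)\}_{(t,\tau)\in\Delta_J}\subset\mathcal L(X)$ with: - $\mathbb T(t,s)\mathbb T(s,\tau)=\mathbb T(t,\tau)$ for $t\ge s\ge\tau$; - $\mathbb T(t,t)=I$; - $(t,\tau)\mapsto\mathbb T(t,\tau)z$ continuous for each $z$. A family of $C_0$-semigroup generators $\{A(t)\}$ generates $\mathbb T$ if: - $\mathbb T(t,\tau)\operatorname{dom}A(\tau)\subset\operatorname{dom}A(t)$; - $t\mapsto\mathbb T(t,\tau)x_\tau$ is a $C^1(J_\tau;X)$ solution of $\dot x=A(t)x$, $x(\tau)=x_\tau$, for $x_\tau\in\operatorname{dom}A(\tau)$, $\tau<\sup J$. Definition of $\mathbb V$. Let $G_n(t)z:=n\int_t^{t+1/n}G(s)z\,ds$, with $G(s):=G(b)$ for $s>b$ if $J$ has a finite right endpoint $b$.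 Let $\widetilde{\mathbb T}_n$ be the evolution family generated by $P(t)A+P(t)G_n(t)P(t)^{-1}$ with domain $\operatorname{dom}A$. Let $\widetilde{\mathbb T}_l(t,\tau)z:=\lim_n\widetilde{\mathbb T}_n(t,\tau)z$; this limit exists. Set $\mathbb V(t,\tau):=P(t)^{-1}\widetilde{\mathbb T}_l(t,\tau)P(\tau)$, a locally exponentially bounded evolution family. Extrapolation. $X_{-1}$ is the completion of $X$ under $\|(I-A)^{-1}x\|$. $A_{-1}\in\mathcal L(X;X_{-1})$ is the unique extension of $A$. *)

theory Defs
  imports "HOL-Analysis.Analysis"
begin

text \<open>
Conventions. The complex Hilbert space X is modelled as a real Hilbert space
(type class real_inner + complete_space, real inner product = real part of the
complex one) together with a complex structure ci (multiplication by the imaginary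
unit): a real-linear map with ci (ci x) = - x which preserves the real inner product.
Bounded complex-linear operators (the elements of L(X)) are the bounded real-linear
maps commuting with ci.
\<close>

definition complex_structure :: "('a::real_inner \<Rightarrow> 'a) \<Rightarrow> bool" where
  "complex_structure ci \<longleftrightarrow> bounded_linear ci \<and> (\<forall>x. ci (ci x) = - x)
     \<and> (\<forall>x y. inner (ci x) (ci y) = inner x y)"

definition cblin :: "('a::real_normed_vector \<Rightarrow> 'a) \<Rightarrow> ('a \<Rightarrow> 'a) \<Rightarrow> bool" where
  "cblin ci T \<longleftrightarrow> bounded_linear T \<and> (\<forall>x. T (ci x) = ci (T x))"

definition is_C1_on :: "real set \<Rightarrow> (real \<Rightarrow> 'a::real_normed_vector) \<Rightarrow> (real \<Rightarrow> 'a) \<Rightarrow> bool" where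
  "is_C1_on S f f' \<longleftrightarrow> (\<forall>t\<in>S. (f has_vector_derivative f' t) (at t within S)) \<and> continuous_on S f'"

definition c0_semigroup :: "('a::real_normed_vector \<Rightarrow> 'a) \<Rightarrow> (real \<Rightarrow> 'a \<Rightarrow> 'a) \<Rightarrow> bool" where
  "c0_semigroup ci S \<longleftrightarrow> (\<forall>t\<ge>0. cblin ci (S t)) \<and> S 0 = id
     \<and> (\<forall>t s. t \<ge> 0 \<longrightarrow> s \<ge> 0 \<longrightarrow> S (t + s) = S t \<circ> S s)
     \<and> (\<forall>x. continuous_on {0..} (\<lambda>t. S t x))"

definition sg_generator :: "(real \<Rightarrow> 'a::real_normed_vector \<Rightarrow> 'a) \<Rightarrow> 'a set \<Rightarrow> ('a \<Rightarrow> 'a) \<Rightarrow> bool" where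
  "sg_generator S D A \<longleftrightarrow>
     D = {x. \<exists>y. ((\<lambda>h. (S h x - x) /\<^sub>R h) \<longlongrightarrow> y) (at_right 0)}
     \<and> (\<forall>x\<in>D. ((\<lambda>h. (S h x - x) /\<^sub>R h) \<longlongrightarrow> A x) (at_right 0))"

definition generates_c0_contraction :: "('a::real_normed_vector \<Rightarrow> 'a) \<Rightarrow> 'a set \<Rightarrow> ('a \<Rightarrow> 'a) \<Rightarrow> bool" where
  "generates_c0_contraction ci D A \<longleftrightarrow>
     (\<exists>S. c0_semigroup ci S \<and> (\<forall>t\<ge>0. \<forall>x. norm (S t x) \<le> norm x) \<and> sg_generator S D A)"

definition time_interval :: "real set \<Rightarrow> bool" where
  "time_interval J \<longleftrightarrow> is_interval J \<and> closed J \<and> (\<exists>a\<in>J. \<exists>b\<in>J. a < b)"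

definition Delta :: "real set \<Rightarrow> (real \<times> real) set" where
  "Delta J = {(t, \<tau>). t \<in> J \<and> \<tau> \<in> J \<and> \<tau> \<le> t}"

definition Jge :: "real set \<Rightarrow> real \<Rightarrow> real set" where
  "Jge J \<tau> = {t \<in> J. \<tau> \<le> t}"

text \<open>Evolution families (families indexed by Delta_J; values off Delta_J are irrelevant).\<close>
definition evolution_family :: "('a::real_normed_vector \<Rightarrow> 'a) \<Rightarrow> real set \<Rightarrow> (real \<Rightarrow> real \<Rightarrow> 'a \<Rightarrow> 'a) \<Rightarrow> bool" where
  "evolution_family ci J U \<longleftrightarrow>
     (\<forall>t \<tau>. (t, \<tau>) \<in> Delta J \<longrightarrow> cblin ci (U t \<tau>))
     \<and> (\<forall>t s \<tau>. t \<in> J \<longrightarrow> s \<in> J \<longrightarrow> \<tau> \<in> J \<longrightarrow> \<tau> \<le> s \<longrightarrow> s \<le> t \<longrightarrow> U t s \<circ> U s \<tau> = U t \<tau>)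
     \<and> (\<forall>t\<in>J. U t t = id)
     \<and> (\<forall>z. continuous_on (Delta J) (\<lambda>p. U (fst p) (snd p) z))"

definition generates_evol :: "real set \<Rightarrow> (real \<Rightarrow> 'a set) \<Rightarrow> (real \<Rightarrow> 'a \<Rightarrow> 'a::real_normed_vector)
     \<Rightarrow> (real \<Rightarrow> real \<Rightarrow> 'a \<Rightarrow> 'a) \<Rightarrow> bool" where
  "generates_evol J Dom Af U \<longleftrightarrow>
     (\<forall>t \<tau>. (t, \<tau>) \<in> Delta J \<longrightarrow> U t \<tau> ` Dom \<tau> \<subseteq> Dom t)
     \<and> (\<forall>\<tau>\<in>J. (\<exists>t\<in>J. \<tau> < t) \<longrightarrow> (\<forall>x\<in>Dom \<tau>.
          is_C1_on (Jge J \<tau>) (\<lambda>t. U t \<tau> x) (\<lambda>t. Af t (U t \<tau> x))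
          \<and> U \<tau> \<tau> x = x))"

definition Gext :: "real set \<Rightarrow> (real \<Rightarrow> 'a \<Rightarrow> 'a) \<Rightarrow> real \<Rightarrow> 'a \<Rightarrow> 'a" where
  "Gext J G s = (if bdd_above J \<and> Sup J < s then G (Sup J) else G s)"

definition Gn :: "real set \<Rightarrow> (real \<Rightarrow> 'a \<Rightarrow> 'a::real_normed_vector) \<Rightarrow> nat \<Rightarrow> real \<Rightarrow> 'a \<Rightarrow> 'a" where
  "Gn J G n t z = real n *\<^sub>R integral {t..t + 1 / real n} (\<lambda>s. Gext J G s z)"

definition Tn :: "('a::real_normed_vector \<Rightarrow> 'a) \<Rightarrow> real set \<Rightarrow> 'a set \<Rightarrow> ('a \<Rightarrow> 'a)
     \<Rightarrow> (real \<Rightarrow> 'a \<Rightarrow> 'a) \<Rightarrow> (real \<Rightarrow> 'a \<Rightarrow> 'a) \<Rightarrow> (real \<Rightarrow> 'a \<Rightarrow> 'a) \<Rightarrow> nat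
     \<Rightarrow> real \<Rightarrow> real \<Rightarrow> 'a \<Rightarrow> 'a" where
  "Tn ci J D A P Pinv G n = (SOME U. evolution_family ci J U \<and>
      generates_evol J (\<lambda>_. D) (\<lambda>t x. P t (A x) + P t (Gn J G n t (Pinv t x))) U)"

definition Tl :: "('a::real_normed_vector \<Rightarrow> 'a) \<Rightarrow> real set \<Rightarrow> 'a set \<Rightarrow> ('a \<Rightarrow> 'a)
     \<Rightarrow> (real \<Rightarrow> 'a \<Rightarrow> 'a) \<Rightarrow> (real \<Rightarrow> 'a \<Rightarrow> 'a) \<Rightarrow> (real \<Rightarrow> 'a \<Rightarrow> 'a)
     \<Rightarrow> real \<Rightarrow> real \<Rightarrow> 'a \<Rightarrow> 'a" where
  "Tl ci J D A P Pinv G t \<tau> z = lim (\<lambda>n. Tn ci J D A P Pinv G n t \<tau> z)"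

definition Vfam :: "('a::real_normed_vector \<Rightarrow> 'a) \<Rightarrow> real set \<Rightarrow> 'a set \<Rightarrow> ('a \<Rightarrow> 'a)
     \<Rightarrow> (real \<Rightarrow> 'a \<Rightarrow> 'a) \<Rightarrow> (real \<Rightarrow> 'a \<Rightarrow> 'a) \<Rightarrow> (real \<Rightarrow> 'a \<Rightarrow> 'a)
     \<Rightarrow> real \<Rightarrow> real \<Rightarrow> 'a \<Rightarrow> 'a" where
  "Vfam ci J D A P Pinv G t \<tau> z = Pinv t (Tl ci J D A P Pinv G t \<tau> (P \<tau> z))"

text \<open>The integral equations (Bochner/strong integrals, here as vector-valued integrals)
  with K s = P(s)^{-1} Pdot(s).\<close>
definition var_const_right :: "real set \<Rightarrow> (real \<Rightarrow> real \<Rightarrow> 'a \<Rightarrow> 'a::real_normed_vector)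
     \<Rightarrow> (real \<Rightarrow> 'a \<Rightarrow> 'a) \<Rightarrow> (real \<Rightarrow> real \<Rightarrow> 'a \<Rightarrow> 'a) \<Rightarrow> bool" where
  "var_const_right J V K T \<longleftrightarrow> (\<forall>x t \<tau>. (t, \<tau>) \<in> Delta J \<longrightarrow>
     ((\<lambda>s. V t s (K s (T s \<tau> x))) has_integral (T t \<tau> x - V t \<tau> x)) {\<tau>..t})"

definition var_const_left :: "real set \<Rightarrow> (real \<Rightarrow> real \<Rightarrow> 'a \<Rightarrow> 'a::real_normed_vector)
     \<Rightarrow> (real \<Rightarrow> 'a \<Rightarrow> 'a) \<Rightarrow> (real \<Rightarrow> real \<Rightarrow> 'a \<Rightarrow> 'a) \<Rightarrow> bool" where
  "var_const_left J V K T \<longleftrightarrow> (\<forall>x t \<tau>. (t, \<tau>) \<in> Delta J \<longrightarrow>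
     ((\<lambda>s. T t s (K s (V s \<tau> x))) has_integral (T t \<tau> x - V t \<tau> x)) {\<tau>..t})"

text \<open>Weak versions (tested against all y via the real inner product, which is the real
  part of the complex inner product and therefore determines weak integrals).\<close>
definition weak_var_const_right :: "real set \<Rightarrow> (real \<Rightarrow> real \<Rightarrow> 'a \<Rightarrow> 'a::real_inner)
     \<Rightarrow> (real \<Rightarrow> 'a \<Rightarrow> 'a) \<Rightarrow> (real \<Rightarrow> real \<Rightarrow> 'a \<Rightarrow> 'a) \<Rightarrow> bool" where
  "weak_var_const_right J V K S \<longleftrightarrow> (\<forall>x y t \<tau>. (t, \<tau>) \<in> Delta J \<longrightarrow>
     ((\<lambda>s. inner (V t s (K s (S s \<tau> x))) y) has_integral inner (S t \<tau> x - V t \<tau> x) y) {\<tau>..t})"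

definition weak_var_const_left :: "real set \<Rightarrow> (real \<Rightarrow> real \<Rightarrow> 'a \<Rightarrow> 'a::real_inner)
     \<Rightarrow> (real \<Rightarrow> 'a \<Rightarrow> 'a) \<Rightarrow> (real \<Rightarrow> real \<Rightarrow> 'a \<Rightarrow> 'a) \<Rightarrow> bool" where
  "weak_var_const_left J V K S \<longleftrightarrow> (\<forall>x y t \<tau>. (t, \<tau>) \<in> Delta J \<longrightarrow>
     ((\<lambda>s. inner (S t s (K s (V s \<tau> x))) y) has_integral inner (S t \<tau> x - V t \<tau> x) y) {\<tau>..t})"

definition weakly_continuous_family :: "real set \<Rightarrow> (real \<Rightarrow> real \<Rightarrow> 'a \<Rightarrow> 'a::real_inner) \<Rightarrow> bool" where
  "weakly_continuous_family J S \<longleftrightarrow>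
     (\<forall>z y. continuous_on (Delta J) (\<lambda>p. inner (S (fst p) (snd p) z) y))"

text \<open>Extrapolation space X_{-1}. X_{-1} is realised concretely (up to the canonical
  isometric isomorphism (I - A_{-1})^{-1} : X_{-1} -> X) as the space X itself:
  the inclusion X -> X_{-1} becomes the resolvent R = (I - A)^{-1}, which is isometric
  for the norm norm((I-A)^{-1} x) and has dense range dom A, and A_{-1} becomes the
  bounded operator x |-> R x - x (which equals R (A x) for x in dom A).\<close>
definition resolvent1 :: "'a set \<Rightarrow> ('a \<Rightarrow> 'a::real_normed_vector) \<Rightarrow> 'a \<Rightarrow> 'a" where
  "resolvent1 D A y = (THE x. x \<in> D \<and> x - A x = y)"

definition emb_m1 :: "'a set \<Rightarrow> ('a \<Rightarrow> 'a::real_normed_vector) \<Rightarrow> 'a \<Rightarrow> 'a" where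
  "emb_m1 D A x = resolvent1 D A x"

definition A_m1 :: "'a set \<Rightarrow> ('a \<Rightarrow> 'a::real_normed_vector) \<Rightarrow> 'a \<Rightarrow> 'a" where
  "A_m1 D A x = resolvent1 D A x - x"

end

theory Submission
  imports Defs
begin

text \<open>
Put \<open>K = P\<^sup>-\<^sup>1 P'\<close>. The substitution \<open>x = P y\<close> turns \<open>x' = P A x + P Q P\<^sup>-\<^sup>1 x\<close> into
\<open>y' = (A P + Q - K) y\<close>. So everything follows from the limits \<open>Y\<^sup>Q\<close> of the evolution families of
the bounded operators \<open>A\<^sub>n P + Q\<close>, where \<open>A\<^sub>n\<close> are the Yosida approximations of \<open>A\<close>: one gets
\<open>V = Y\<^sup>G\<^sup>-\<^sup>K\<close> and \<open>T\<^sub>r = Y\<^sup>G\<close>, and the two integral equations are the limits of Duhamel's formula.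
Since \<open>A\<^sub>n\<close> is dissipative, the energy \<open>\<langle>P y, y\<rangle>\<close> gives bounds that are uniform in \<open>n\<close>. For
\<open>Q = -K\<close> the Yosida estimate gives convergence on smooth data, because \<open>w = A\<^sub>n P y\<close> satisfies
\<open>w' = A\<^sub>n P w\<close>; a general \<open>Q\<close> is a bounded perturbation of this case. Uniqueness among weakly continuous
families is a Volterra iteration, and the equation in \<open>X\<^sub>-\<^sub>1\<close> is the image of the integrated equation
under the resolvent \<open>R = (I - A)\<^sup>-\<^sup>1\<close>.
\<close>

section \<open>Uniform boundedness\<close>

text \<open>The domain of \<open>A P(t)\<close> moves with \<open>t\<close>, and with
  \<open>G\<close> only strongly continuous no orbit of the limit families is known to be
  differentiable in X. Hence the detour through bounded generators, for which Duhamel's formula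
  holds on every vector. The energy fits this order of factors: differentiating <P y, y> along y' =
  A P y + ... produces 2 <A P y, P y>, which has a sign by dissipativity once \<open>P\<close> is
  self-adjoint. A priori \<open>V\<close> is only a limit of arbitrarily chosen families generated
  with the averages \<open>Gn\<close>. Identifying it takes three facts: the averages are strongly
  C^1, so classical solutions exist; these are unique for data in the dense set \<open>D\<close>, so
  the choice is harmless; and the limit families depend continuously on Q. For the uniqueness claim
  the difference of two families is only weakly continuous, so its norm may fail to be continuous in
  time. The iteration therefore runs through continuous majorants of the norm. \<open>J\<close> may
  be unbounded, so all constants belong to the compact windows
  \<open>J \<inter> {-m..m}\<close>.\<close>

lemma gliding_hump:
  fixes F :: "nat \<Rightarrow> 'a::banach \<Rightarrow> 'b::real_normed_vector"
  assumes lin: "\<And>i. bounded_linear (F i)"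
    and big: "\<And>i. onorm (F i) \<ge> 4 ^ i"
  shows "\<exists>z. \<forall>C. \<exists>i. norm (F i z) > C"
proof -
  have pos: "onorm (F i) > 0" for i
    by (rule less_le_trans[OF _ big[of i]]) simp
  \<comment> \<open>The constants are balanced: a share 2/3 of the operator norm is attained, the
    later terms of the series can destroy at most a share 1/2, and the remaining 1/6 is multiplied
    by (4/3)^i, which is unbounded.\<close>
  have "\<exists>w. norm (F i w) > (2/3 * onorm (F i)) * norm w" for i
  proof (rule ccontr)
    assume "\<nexists>w. norm (F i w) > (2/3 * onorm (F i)) * norm w"
    then have "onorm (F i) \<le> 2/3 * onorm (F i)"
      using pos[of i] by (intro onorm_bound) (auto simp: not_less)
    then show False using pos[of i] by simp
  qed
  then obtain w where w: "\<And>i. norm (F i (w i)) > (2/3 * onorm (F i)) * norm (w i)"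
    by metis
  have w0: "w i \<noteq> 0" for i
    using w[of i] bounded_linear.linear[OF lin[of i]] by (auto simp: linear_0)
  define e where "e i = (1 / (3 ^ i * norm (w i))) *\<^sub>R w i" for i
  have ne: "norm (e i) = 1 / 3 ^ i" for i
    using w0 by (simp add: e_def)
  have Fe: "norm (F i (e i)) > 2/3 * onorm (F i) / 3 ^ i" for i
  proof -
    have "F i (e i) = (1 / (3 ^ i * norm (w i))) *\<^sub>R F i (w i)"
      using lin[of i] by (simp add: e_def linear_simps)
    then have "norm (F i (e i)) = norm (F i (w i)) / (3 ^ i * norm (w i))" by simp
    also have "\<dots> > (2/3 * onorm (F i)) * norm (w i) / (3 ^ i * norm (w i))"
      using w[of i] w0[of i] by (intro divide_strict_right_mono) auto
    finally show ?thesis using w0[of i] by simp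
  qed
  \<comment> \<open>Gliding hump: the sign of each new term is chosen so that the image does not shrink.\<close>
  define x where "x = rec_nat (0::'a) (\<lambda>i y. if norm (F i (y + e i)) \<ge> norm (F i (e i)) then y + e i else y - e i)"
  have xS: "x (Suc i) = (if norm (F i (x i + e i)) \<ge> norm (F i (e i)) then x i + e i else x i - e i)" for i
    by (simp add: x_def)
  have Fx: "norm (F i (x (Suc i))) \<ge> norm (F i (e i))" for i
  proof -
    have "F i (e i) + F i (e i) = F i (x i + e i) - F i (x i - e i)"
      using lin[of i] by (simp add: linear_simps)
    then have "norm (F i (e i) + F i (e i)) \<le> norm (F i (x i + e i)) + norm (F i (x i - e i))"
      by (metis norm_triangle_ineq4)
    moreover have "norm (F i (e i) + F i (e i)) = 2 * norm (F i (e i))"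
      by (metis norm_scaleR scaleR_2 abs_numeral)
    ultimately show ?thesis unfolding xS by auto
  qed
  have dx: "norm (x (Suc i) - x i) = 1 / 3 ^ i" for i
    unfolding xS using ne by (auto simp: norm_minus_commute)
  have sm: "summable (\<lambda>i. x (Suc i) - x i)"
    by (rule summable_norm_cancel) (use summable_geometric[of "1/3::real"] in \<open>simp add: dx power_divide\<close>)
  define z where "z = (\<Sum>i. x (Suc i) - x i)"
  have x0: "x 0 = 0" by (simp add: x_def)
  \<comment> \<open>Geometric tail: the sum of 3^(-i) over i > n is half of 3^(-n).\<close>
  have tail: "norm (z - x (Suc n)) \<le> (1/2) * (1 / 3 ^ n)" for n
  proof -
    have "z - x (Suc n) = (\<Sum>i. x (Suc (i + Suc n)) - x (i + Suc n))"
      using suminf_minus_initial_segment[OF sm, of "Suc n"] sum_lessThan_telescope[of x "Suc n"]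
      unfolding z_def by (simp add: x0)
    also have "norm \<dots> \<le> (\<Sum>i. (1/3)^Suc n * (1/3::real)^i)"
    proof (rule norm_suminf_le)
      show "norm (x (Suc (i + Suc n)) - x (i + Suc n)) \<le> (1/3)^Suc n * (1/3::real)^i" for i
        unfolding dx by (simp add: power_add power_divide mult.commute)
      show "summable (\<lambda>i. (1/3)^Suc n * (1/3::real)^i)" by (intro summable_mult summable_geometric) simp
    qed
    also have "\<dots> = (1/3)^Suc n * (1 / (1 - 1/3::real))"
      by (subst suminf_mult) (auto intro: summable_geometric simp: suminf_geometric)
    finally show ?thesis by (simp add: power_divide)
  qed
  show ?thesis
  proof (intro exI[of _ z] allI)
    fix C :: real
    obtain i where i: "(4/3::real)^i > 6 * C"
      using real_arch_pow[of "4/3::real" "6 * C"] by auto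
    have "norm (F i (x (Suc i))) \<le> norm (F i z) + norm (F i (z - x (Suc i)))"
      using lin[of i] by (simp add: linear_simps norm_minus_commute) (metis add.commute norm_minus_commute norm_triangle_sub)
    moreover have "norm (F i (z - x (Suc i))) \<le> onorm (F i) * ((1/2) * (1 / 3 ^ i))"
      using onorm[OF lin[of i], of "z - x (Suc i)"] mult_left_mono[OF tail[of i], of "onorm (F i)"] pos[of i] by linarith
    ultimately have "norm (F i z) \<ge> 2/3 * onorm (F i) / 3 ^ i - onorm (F i) * ((1/2) * (1 / 3 ^ i))"
      using Fe[of i] Fx[of i] by linarith
    also have "2/3 * onorm (F i) / 3 ^ i - onorm (F i) * ((1/2) * (1 / 3 ^ i)) = (1/6) * (onorm (F i) / 3 ^ i)"
      by (simp add: field_simps)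
    finally have "norm (F i z) \<ge> (1/6) * (onorm (F i) / 3 ^ i)" .
    moreover have "onorm (F i) / 3 ^ i \<ge> (4/3)^i"
      using big[of i] by (simp add: power_divide divide_right_mono)
    ultimately show "\<exists>i. C < norm (F i z)" using i by (intro exI[of _ i]) linarith
  qed
qed

text \<open>Without a common bound, every threshold 4^n is exceeded by the norm of some member;
  these members form the sequence for the gliding hump. The index set is arbitrary, so that it can
  be a compact set of times.\<close>

lemma banach_steinhaus:
  fixes F :: "'i \<Rightarrow> 'a::banach \<Rightarrow> 'b::real_normed_vector"
  assumes lin: "\<And>i. i \<in> I \<Longrightarrow> bounded_linear (F i)"
    and ptw: "\<And>z. \<exists>C. \<forall>i\<in>I. norm (F i z) \<le> C"
  shows "\<exists>C\<ge>0. \<forall>i\<in>I. \<forall>z. norm (F i z) \<le> C * norm z"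
proof (rule ccontr)
  assume *: "\<not> ?thesis"
  have "\<exists>i\<in>I. onorm (F i) \<ge> 4 ^ n" for n :: nat
  proof (rule ccontr)
    assume "\<not> ?thesis"
    then have "onorm (F i) \<le> 4 ^ n" if "i \<in> I" for i using that by force
    then have "norm (F i z) \<le> 4 ^ n * norm z" if "i \<in> I" for i z
      using onorm[OF lin[OF that], of z] that by (meson mult_right_mono norm_ge_zero order_trans)
    then show False using * by (metis zero_le_numeral zero_le_power)
  qed
  then obtain j where j: "\<And>n. j n \<in> I" "\<And>n::nat. onorm (F (j n)) \<ge> 4 ^ n" by metis
  obtain z where "\<forall>C. \<exists>n. norm (F (j n) z) > C"
    using gliding_hump[of "\<lambda>n. F (j n)"] j lin by blast
  then show False using ptw[of z] j(1) by (meson not_le)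
qed

section \<open>Strongly continuous operator families\<close>

text \<open>The parameter space is left general, so that one notion covers \<open>P\<close> and
  \<open>G\<close> on \<open>J\<close> as well as two-parameter families on
  \<open>Delta J\<close>.\<close>

definition strongly_cont :: "'t::topological_space set \<Rightarrow> ('t \<Rightarrow> 'a::real_normed_vector \<Rightarrow> 'b::real_normed_vector) \<Rightarrow> bool" where
  "strongly_cont T F \<longleftrightarrow> (\<forall>t\<in>T. bounded_linear (F t)) \<and> (\<forall>z. continuous_on T (\<lambda>t. F t z))"

lemma strongly_contD:
  assumes "strongly_cont T F"
  shows "t \<in> T \<Longrightarrow> bounded_linear (F t)" "continuous_on T (\<lambda>t. F t z)"
  using assms by (auto simp: strongly_cont_def)

text \<open>Pointwise convergence bounds the operators uniformly, which allows the vector to move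
  along with the operator. This is the substitute for norm continuity throughout.\<close>

lemma strong_tendsto_seq:
  fixes F :: "nat \<Rightarrow> 'a::banach \<Rightarrow> 'b::real_normed_vector"
  assumes lin: "\<And>n. bounded_linear (F n)" "bounded_linear F0"
    and lim: "\<And>z. (\<lambda>n. F n z) \<longlonglongrightarrow> F0 z" and v: "v \<longlonglongrightarrow> v0"
  shows "(\<lambda>n. F n (v n)) \<longlonglongrightarrow> F0 v0"
proof -
  have "\<exists>C. \<forall>i\<in>UNIV. norm (F i z) \<le> C" for z
    using convergent_imp_Bseq[of "\<lambda>n. F n z"] lim by (auto simp: convergent_def Bseq_def)
  then obtain C where C: "\<And>n z. norm (F n z) \<le> C * norm z"
    using banach_steinhaus[of UNIV F] lin by auto
  have "(\<lambda>n. C * norm (v n - v0) + norm (F n v0 - F0 v0)) \<longlonglongrightarrow> C * 0 + 0"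
    by (intro tendsto_intros tendsto_norm_zero LIM_zero lim v)
  then have lim0: "(\<lambda>n. C * norm (v n - v0) + norm (F n v0 - F0 v0)) \<longlonglongrightarrow> 0" by simp
  have le: "norm (F n (v n) - F0 v0) \<le> C * norm (v n - v0) + norm (F n v0 - F0 v0)" for n
  proof -
    have "F n (v n) - F0 v0 = F n (v n - v0) + (F n v0 - F0 v0)"
      using lin(1)[of n] by (simp add: linear_simps)
    then show ?thesis
      using order_trans[OF norm_triangle_ineq add_right_mono[OF C]] by metis
  qed
  show ?thesis
    by (rule LIM_zero_cancel, rule Lim_null_comparison[OF always_eventually lim0]) (use le in blast)
qed

lemma strong_tendsto_within:
  fixes F :: "'t::first_countable_topology \<Rightarrow> 'a::banach \<Rightarrow> 'b::real_normed_vector"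
  assumes "\<And>t. t \<in> S \<Longrightarrow> t \<noteq> x \<Longrightarrow> bounded_linear (F t)" "bounded_linear F0"
    and "\<And>z. ((\<lambda>t. F t z) \<longlongrightarrow> F0 z) (at x within S)" and "(v \<longlongrightarrow> v0) (at x within S)"
  shows "((\<lambda>t. F t (v t)) \<longlongrightarrow> F0 v0) (at x within S)"
  unfolding tendsto_at_iff_sequentially comp_def
proof (intro allI impI)
  fix X assume X: "\<forall>i. X i \<in> S - {x}" "X \<longlonglongrightarrow> x"
  show "(\<lambda>i. F (X i) (v (X i))) \<longlonglongrightarrow> F0 v0"
  proof (rule strong_tendsto_seq)
    show "bounded_linear (F (X n))" for n using X assms(1) by auto
    show "(\<lambda>n. F (X n) z) \<longlonglongrightarrow> F0 z" for z
      using assms(3)[of z] X unfolding tendsto_at_iff_sequentially comp_def by blast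
    show "(\<lambda>n. v (X n)) \<longlonglongrightarrow> v0"
      using assms(4) X unfolding tendsto_at_iff_sequentially comp_def by blast
  qed (rule assms(2))
qed

lemma strongly_cont_apply:
  fixes F :: "'t::topological_space \<Rightarrow> 'a::banach \<Rightarrow> 'b::real_normed_vector"
    and g :: "'s::{first_countable_topology, t2_space} \<Rightarrow> 't"
  assumes F: "strongly_cont T F" and g: "continuous_on S g" "\<And>p. p \<in> S \<Longrightarrow> g p \<in> T"
    and v: "continuous_on S v"
  shows "continuous_on S (\<lambda>p. F (g p) (v p))"
proof (rule continuous_on_sequentiallyI)
  fix u a assume u: "\<forall>n. u n \<in> S" "a \<in> S" "u \<longlonglongrightarrow> a"
  have "continuous_on S (\<lambda>p. F (g p) z)" for z
    using continuous_on_compose2[OF strongly_contD(2)[OF F] g(1), of z] g(2) by blast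
  then have "(\<lambda>n. F (g (u n)) z) \<longlonglongrightarrow> F (g a) z" for z
    using u unfolding continuous_on_sequentially comp_def by blast
  moreover have "(\<lambda>n. v (u n)) \<longlonglongrightarrow> v a"
    using u v unfolding continuous_on_sequentially comp_def by blast
  ultimately show "(\<lambda>n. F (g (u n)) (v (u n))) \<longlonglongrightarrow> F (g a) (v a)"
    using u g(2) strongly_contD(1)[OF F] by (rule_tac strong_tendsto_seq) blast+
qed

lemma strongly_cont_apply':
  fixes F :: "'t::{first_countable_topology, t2_space} \<Rightarrow> 'a::banach \<Rightarrow> 'b::real_normed_vector"
  assumes "strongly_cont T F" "continuous_on S v" "S \<subseteq> T"
  shows "continuous_on S (\<lambda>p. F p (v p))"
  using strongly_cont_apply[OF assms(1) continuous_on_id _ assms(2)] assms(3) by auto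

lemma strongly_cont_apply2:
  fixes U :: "real \<Rightarrow> real \<Rightarrow> 'a::banach \<Rightarrow> 'b::real_normed_vector"
    and f g :: "'s::{first_countable_topology, t2_space} \<Rightarrow> real"
  assumes U: "strongly_cont (Delta J) (\<lambda>p. U (fst p) (snd p))"
    and "continuous_on S f" "continuous_on S g" "\<And>p. p \<in> S \<Longrightarrow> (f p, g p) \<in> Delta J"
    and "continuous_on S v"
  shows "continuous_on S (\<lambda>p. U (f p) (g p) (v p))"
proof -
  have "continuous_on S (\<lambda>p. (\<lambda>p. U (fst p) (snd p)) (f p, g p) (v p))"
    by (rule strongly_cont_apply[OF U continuous_on_Pair]) (use assms(2-) in auto)
  then show ?thesis by simp
qed

lemma strongly_cont_bound:
  fixes F :: "'t::topological_space \<Rightarrow> 'a::banach \<Rightarrow> 'b::real_normed_vector"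
  assumes F: "strongly_cont T F" and "compact C" "C \<subseteq> T"
  shows "\<exists>K\<ge>0. \<forall>t\<in>C. \<forall>z. norm (F t z) \<le> K * norm z"
proof (rule banach_steinhaus)
  show "bounded_linear (F i)" if "i \<in> C" for i using that assms strongly_contD(1)[OF F] by auto
  fix z
  have "continuous_on C (\<lambda>t. F t z)" using strongly_contD(2)[OF F] \<open>C \<subseteq> T\<close> continuous_on_subset by blast
  then have "bounded ((\<lambda>t. F t z) ` C)"
    using \<open>compact C\<close> compact_continuous_image compact_imp_bounded by blast
  then show "\<exists>K. \<forall>i\<in>C. norm (F i z) \<le> K" by (auto simp: bounded_iff)
qed

lemma strongly_cont_compose:
  fixes F :: "'t::{first_countable_topology, t2_space} \<Rightarrow> 'b::banach \<Rightarrow> 'c::real_normed_vector"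
    and H :: "'t \<Rightarrow> 'a::real_normed_vector \<Rightarrow> 'b"
  assumes "strongly_cont T F" "strongly_cont T H"
  shows "strongly_cont T (\<lambda>t z. F t (H t z))"
proof -
  have "bounded_linear (\<lambda>z. F t (H t z))" if "t \<in> T" for t
    by (rule bounded_linear_compose[OF strongly_contD(1)[OF assms(1) that] strongly_contD(1)[OF assms(2) that]])
  moreover have "continuous_on T (\<lambda>t. F t (H t z))" for z
    by (rule strongly_cont_apply'[OF assms(1) strongly_contD(2)[OF assms(2)] order_refl])
  ultimately show ?thesis by (simp add: strongly_cont_def)
qed

lemma strongly_cont_add:
  assumes "strongly_cont T F" "strongly_cont T H"
  shows "strongly_cont T (\<lambda>t z. F t z + H t z)" "strongly_cont T (\<lambda>t z. F t z - H t z)"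
    "strongly_cont T (\<lambda>t z. - F t z)"
  using assms unfolding strongly_cont_def
  by (simp_all add: bounded_linear_add bounded_linear_sub bounded_linear_minus
      continuous_on_add continuous_on_diff continuous_on_minus)

lemma strongly_cont_const: "bounded_linear L \<Longrightarrow> strongly_cont T (\<lambda>t. L)"
  by (auto simp: strongly_cont_def)

lemma strongly_cont_subset: "strongly_cont T F \<Longrightarrow> S \<subseteq> T \<Longrightarrow> strongly_cont S F"
  by (auto simp: strongly_cont_def intro: continuous_on_subset)

section \<open>Integrals: norm bounds, dominated convergence, variable limits\<close>

lemma has_integral_norm_le:
  fixes f :: "real \<Rightarrow> 'a::banach"
  assumes "(f has_integral I) {a..b}" "continuous_on {a..b} g" "\<And>s. s \<in> {a..b} \<Longrightarrow> norm (f s) \<le> g s"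
  shows "norm I \<le> integral {a..b} g"
  using integral_norm_bound_integral[of f "{a..b}" g] assms
  by (simp add: has_integral_iff integrable_continuous_interval)

text \<open>Dominated convergence is applied to the real functions
  \<open>norm (f n s - g s)\<close>; continuity provides integrability of the vector-valued
  functions.\<close>

lemma integral_dominated_continuous:
  fixes f :: "nat \<Rightarrow> real \<Rightarrow> 'a::banach"
  assumes f: "\<And>n. continuous_on {a..b} (f n)" "continuous_on {a..b} g"
    and bd: "\<And>n s. s \<in> {a..b} \<Longrightarrow> norm (f n s) \<le> M"
    and lim: "\<And>s. s \<in> {a..b} \<Longrightarrow> (\<lambda>n. f n s) \<longlonglongrightarrow> g s"
  shows "(\<lambda>n. integral {a..b} (f n)) \<longlonglongrightarrow> integral {a..b} g"
proof -
  have int: "f n integrable_on {a..b}" "g integrable_on {a..b}" for n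
    using f by (auto intro: integrable_continuous_interval)
  have bg: "norm (g s) \<le> M" if "s \<in> {a..b}" for s
    using LIMSEQ_le_const2[OF tendsto_norm[OF lim[OF that]]] bd[OF that] by blast
  have "(\<lambda>n. integral {a..b} (\<lambda>s. norm (f n s - g s))) \<longlonglongrightarrow> integral {a..b} (\<lambda>s. 0::real)"
  proof (rule dominated_convergence(2)[where h = "\<lambda>s. 2 * M"])
    show "(\<lambda>s. norm (f n s - g s)) integrable_on {a..b}" for n
      using f by (intro integrable_continuous_interval continuous_intros)
    show "norm (norm (f n s - g s)) \<le> 2 * M" if "s \<in> {a..b}" for n s
      using bd[OF that, of n] bg[OF that] norm_triangle_ineq4[of "f n s" "g s"] by simp
    show "(\<lambda>n. norm (f n s - g s)) \<longlonglongrightarrow> 0" if "s \<in> {a..b}" for s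
      using lim[OF that] by (simp add: LIM_zero_iff tendsto_norm_zero_iff)
  qed auto
  then have lim0: "(\<lambda>n. integral {a..b} (\<lambda>s. norm (f n s - g s))) \<longlonglongrightarrow> 0" by simp
  have le: "norm (integral {a..b} (f n) - integral {a..b} g) \<le> integral {a..b} (\<lambda>s. norm (f n s - g s))" for n
  proof -
    have "norm (integral {a..b} (\<lambda>s. f n s - g s)) \<le> integral {a..b} (\<lambda>s. norm (f n s - g s))"
      using f by (intro integral_norm_bound_integral integrable_continuous_interval continuous_intros) auto
    then show ?thesis by (simp add: integral_diff int)
  qed
  show ?thesis
    by (rule LIM_zero_cancel, rule Lim_null_comparison[OF always_eventually lim0]) (use le in blast)
qed

lemma has_integral_dominated_continuous:
  fixes f :: "nat \<Rightarrow> real \<Rightarrow> 'a::banach"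
  assumes int: "\<And>n. (f n has_integral I n) {a..b}" "I \<longlonglongrightarrow> I0"
    and f: "\<And>n. continuous_on {a..b} (f n)" "continuous_on {a..b} g"
    and bd: "\<And>n s. s \<in> {a..b} \<Longrightarrow> norm (f n s) \<le> M"
    and lim: "\<And>s. s \<in> {a..b} \<Longrightarrow> (\<lambda>n. f n s) \<longlonglongrightarrow> g s"
  shows "(g has_integral I0) {a..b}"
proof -
  have "(\<lambda>n. integral {a..b} (f n)) \<longlonglongrightarrow> integral {a..b} g"
    by (rule integral_dominated_continuous[OF f bd lim])
  moreover have "integral {a..b} (f n) = I n" for n using int(1) by blast
  ultimately have "integral {a..b} g = I0" using int(2) LIMSEQ_unique by auto
  then show ?thesis using f(2) by (auto simp: has_integral_iff integrable_continuous_interval)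
qed

text \<open>Moves the variable limits into the integrand, so that dependence on the limits becomes
  dependence on a parameter over the fixed interval \<open>{0..1}\<close>.\<close>

lemma integral_unit_reparam:
  fixes f :: "real \<Rightarrow> 'a::banach"
  assumes "s \<le> t" "continuous_on {s..t} f"
  shows "integral {s..t} f = (t - s) *\<^sub>R integral {0..1} (\<lambda>r. f (s + r * (t - s)))"
proof (cases "s = t")
  case False
  then have st: "s < t" using assms by simp
  have "(f has_integral integral {s..t} f) (cbox s t)"
    using assms by (simp add: integrable_continuous_interval integrable_integral)
  from has_integral_affinity'[OF this, of "t - s" s]
  moreover have "(t - s) /\<^sub>R (t - s) = 1" using st by simp
  ultimately have "((\<lambda>r. f (s + r * (t - s))) has_integral (integral {s..t} f /\<^sub>R (t - s))) {0..1}"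
    using st by (simp add: add.commute mult.commute)
  then have "integral {0..1} (\<lambda>r. f (s + r * (t - s))) = integral {s..t} f /\<^sub>R (t - s)" by blast
  then show ?thesis using st by simp
qed simp

lemma Delta_segment:
  assumes "is_interval J" "(t, s) \<in> Delta J" "r \<in> {0..1}"
  shows "s + r * (t - s) \<in> J" "s \<le> s + r * (t - s)" "s + r * (t - s) \<le> t"
proof -
  have st: "s \<in> J" "t \<in> J" "s \<le> t" using assms by (auto simp: Delta_def)
  have "r * (t - s) \<le> 1 * (t - s)" using assms st by (intro mult_right_mono) auto
  then show 2: "s + r * (t - s) \<le> t" by simp
  show 1: "s \<le> s + r * (t - s)" using assms st by simp
  show "s + r * (t - s) \<in> J" using assms(1) 1 2 st unfolding is_interval_1 by blast
qed

lemma Delta_subinterval: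
  assumes "is_interval J" "(t, s) \<in> Delta J" "r \<in> {s..t}"
  shows "r \<in> J" "(t, r) \<in> Delta J" "(r, s) \<in> Delta J"
  using assms unfolding is_interval_1 Delta_def by auto

text \<open>The triples are ordered as \<open>t\<close>, \<open>\<tau>\<close>, integration
  variable, with the last one between the other two.\<close>

lemma continuous_on_unit_average:
  fixes f :: "real \<Rightarrow> real \<Rightarrow> real \<Rightarrow> 'a::banach"
  assumes J: "is_interval J"
    and f: "continuous_on {q. (fst q, fst (snd q)) \<in> Delta J \<and> snd (snd q) \<in> {fst (snd q)..fst q}}
              (\<lambda>q. f (fst q) (fst (snd q)) (snd (snd q)))"
  shows "continuous_on (Delta J) (\<lambda>p. integral {0..1} (\<lambda>r. f (fst p) (snd p) (snd p + r * (fst p - snd p))))"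
proof -
  have "continuous_on (Delta J \<times> cbox 0 1)
          (\<lambda>(p, r). f (fst p) (snd p) (snd p + r * (fst p - snd p)))"
  proof -
    let ?h = "\<lambda>pr::(real \<times> real) \<times> real.
      (fst (fst pr), snd (fst pr), snd (fst pr) + snd pr * (fst (fst pr) - snd (fst pr)))"
    have "continuous_on (Delta J \<times> cbox 0 1) ?h" by (intro continuous_intros)
    moreover have "?h ` (Delta J \<times> cbox 0 1) \<subseteq>
      {q. (fst q, fst (snd q)) \<in> Delta J \<and> snd (snd q) \<in> {fst (snd q)..fst q}}"
      using Delta_segment[OF J] by auto
    ultimately have "continuous_on (Delta J \<times> cbox 0 1)
      (\<lambda>x. (\<lambda>q. f (fst q) (fst (snd q)) (snd (snd q))) (?h x))"
      using continuous_on_compose2[OF f] by blast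
    then show ?thesis by (simp add: case_prod_unfold)
  qed
  from integral_continuous_on_param[OF this] show ?thesis by simp
qed

lemma continuous_on_triangle_integral:
  fixes f :: "real \<Rightarrow> real \<Rightarrow> real \<Rightarrow> 'a::banach"
  assumes J: "is_interval J"
    and f: "continuous_on {q. (fst q, fst (snd q)) \<in> Delta J \<and> snd (snd q) \<in> {fst (snd q)..fst q}}
              (\<lambda>q. f (fst q) (fst (snd q)) (snd (snd q)))"
  shows "continuous_on (Delta J) (\<lambda>p. integral {snd p..fst p} (f (fst p) (snd p)))"
proof -
  have "continuous_on (Delta J) (\<lambda>p. (fst p - snd p) *\<^sub>R
    integral {0..1} (\<lambda>r. f (fst p) (snd p) (snd p + r * (fst p - snd p))))"
    using continuous_on_unit_average[OF J f]
    by (rule continuous_on_scaleR[rotated]) (intro continuous_intros)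
  moreover have "integral {snd p..fst p} (f (fst p) (snd p)) = (fst p - snd p) *\<^sub>R
    integral {0..1} (\<lambda>r. f (fst p) (snd p) (snd p + r * (fst p - snd p)))" if "p \<in> Delta J" for p
  proof (rule integral_unit_reparam)
    show "snd p \<le> fst p" using that by (auto simp: Delta_def)
    have "continuous_on {snd p..fst p} (\<lambda>r. (\<lambda>q. f (fst q) (fst (snd q)) (snd (snd q))) (fst p, snd p, r))"
      by (rule continuous_on_compose2[OF f]) (use that in \<open>auto intro!: continuous_intros\<close>)
    then show "continuous_on {snd p..fst p} (f (fst p) (snd p))" by simp
  qed
  ultimately show ?thesis by (simp cong: continuous_on_cong)
qed

section \<open>Volterra integral equations\<close>

lemma DERIV_power_fact:
  "((\<lambda>r. (C * (r - a)) ^ Suc j / fact (Suc j)) has_real_derivative C * ((C * (r - a)) ^ j / fact j)) (at r within S)"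
proof -
  have "((\<lambda>r. (C * (r - a)) ^ Suc j / fact (Suc j)) has_real_derivative
      (1 + real j) * ((C * (1 - 0)) * (C * (r - a)) ^ j) / fact (Suc j)) (at r within S)"
    by (intro DERIV_cdivide DERIV_power_Suc DERIV_cmult DERIV_diff DERIV_ident DERIV_const)
  moreover have "(1 + real j) * ((C * (1 - 0)) * (C * (r - a)) ^ j) / fact (Suc j) = C * ((C * (r - a)) ^ j / fact j)"
  proof -
    have "(fact (Suc j) :: real) = (1 + real j) * fact j" by simp
    then show ?thesis by simp
  qed
  ultimately show ?thesis by simp
qed

text \<open>A Gronwall inequality for a function \<open>d\<close> that may fail to be measurable:
  \<open>step\<close> only integrates continuous majorants of \<open>d\<close>. Starting from the
  constant \<open>M\<close>, repeated use of \<open>step\<close> improves the majorant towards the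
  exponential.\<close>

lemma volterra_bound:
  fixes d :: "real \<Rightarrow> real"
  assumes C: "C \<ge> 0"
    and bd: "\<And>t. t \<in> {a..b} \<Longrightarrow> d t \<le> M"
    and step: "\<And>t g. t \<in> {a..b} \<Longrightarrow> continuous_on {a..t} g \<Longrightarrow> (\<And>s. s \<in> {a..t} \<Longrightarrow> d s \<le> g s)
        \<Longrightarrow> d t \<le> e + integral {a..t} (\<lambda>s. C * g s)"
    and t: "t \<in> {a..b}"
  shows "d t \<le> e * exp (C * (t - a))"
proof -
  define h where "h k s = (C * (s - a)) ^ k / fact k" for k s
  \<comment> \<open>Majorant after \<open>k\<close> steps: a partial sum of the exponential series,
    plus what is left of the crude bound \<open>M\<close>.\<close>
  define g where "g k s = e * (\<Sum>j<k. h j s) + M * h k s" for k s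
  have h0: "h 0 s = 1" "h (Suc k) a = 0" for k s by (simp_all add: h_def)
  have hc: "continuous_on S (h k)" for k S unfolding h_def by (intro continuous_intros) auto
  have der: "(h (Suc j) has_real_derivative C * h j r) (at r within S)" for j r S
    unfolding h_def by (rule DERIV_power_fact)
  have *: "d s \<le> g k s" if "s \<in> {a..b}" for k s
    using that
  proof (induction k arbitrary: s)
    case 0
    then show ?case using bd by (simp add: g_def h0)
  next
    case (Suc k)
    have c: "continuous_on {a..s} (g k)" unfolding g_def by (intro continuous_intros hc)
    have "d s \<le> e + integral {a..s} (\<lambda>r. C * g k r)"
      by (rule step[OF Suc.prems c]) (use Suc in auto)
    moreover have "((\<lambda>r. C * g k r) has_integral (g (Suc k) s - e) - (g (Suc k) a - e)) {a..s}"
    proof (rule fundamental_theorem_of_calculus)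
      show "a \<le> s" using Suc.prems by simp
      fix r
      have "((\<lambda>r. e * (\<Sum>j<k. h (Suc j) r) + M * h (Suc k) r)
        has_real_derivative e * (\<Sum>j<k. C * h j r) + M * (C * h k r)) (at r within {a..s})"
        by (intro DERIV_add DERIV_cmult DERIV_sum der)
      moreover have "g (Suc k) r - e = e * (\<Sum>j<k. h (Suc j) r) + M * h (Suc k) r" for r
        unfolding g_def sum.lessThan_Suc_shift h0 by (simp add: algebra_simps)
      moreover have "C * g k r = e * (\<Sum>j<k. C * h j r) + M * (C * h k r)"
        unfolding g_def by (simp add: sum_distrib_left algebra_simps)
      ultimately show "((\<lambda>s. g (Suc k) s - e) has_vector_derivative C * g k r) (at r within {a..s})"
        by (simp add: has_real_derivative_iff_has_vector_derivative)
    qed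
    then have "integral {a..s} (\<lambda>r. C * g k r) = (g (Suc k) s - e) - (g (Suc k) a - e)" by blast
    moreover have "g (Suc k) a = e" unfolding g_def sum.lessThan_Suc_shift h0 by simp
    ultimately show ?case by simp
  qed
  have "(\<lambda>k. h k t) sums exp (C * (t - a))"
    using exp_converges[of "C * (t - a)"] by (simp add: h_def divide_inverse mult.commute)
  then have "(\<lambda>k. \<Sum>j<k. h j t) \<longlonglongrightarrow> exp (C * (t - a))" "(\<lambda>k. h k t) \<longlonglongrightarrow> 0"
    using summable_LIMSEQ_zero sums_summable by (auto simp: sums_def)
  then have "(\<lambda>k. g k t) \<longlonglongrightarrow> e * exp (C * (t - a)) + M * 0"
    unfolding g_def by (intro tendsto_intros)
  then show ?thesis using LIMSEQ_le_const[of "\<lambda>k. g k t"] * t by simp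
qed

text \<open>The bound \<open>M\<close> only starts the iteration and drops out of the estimate; the
  size of \<open>e\<close> is governed by the source \<open>f\<close> alone.\<close>

lemma volterra_gronwall:
  fixes e f :: "real \<Rightarrow> 'a::banach" and F :: "real \<Rightarrow> real \<Rightarrow> 'a"
  assumes "C \<ge> 0"
    and eq: "\<And>t. t \<in> {a..b} \<Longrightarrow> (F t has_integral (e t - f t)) {a..t}"
    and F: "\<And>t s. t \<in> {a..b} \<Longrightarrow> s \<in> {a..t} \<Longrightarrow> norm (F t s) \<le> C * norm (e s)"
    and f: "\<And>t. t \<in> {a..b} \<Longrightarrow> norm (f t) \<le> \<delta>"
    and M: "\<And>t. t \<in> {a..b} \<Longrightarrow> norm (e t) \<le> M"
    and t: "t \<in> {a..b}"
  shows "norm (e t) \<le> \<delta> * exp (C * (t - a))"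
proof (rule volterra_bound[where d = "\<lambda>t. norm (e t)" and b = b and M = M, OF \<open>C \<ge> 0\<close> M _ t])
  fix t g assume tg: "t \<in> {a..b}" "continuous_on {a..t} g" "\<And>s. s \<in> {a..t} \<Longrightarrow> norm (e s) \<le> g s"
  have "norm (e t - f t) \<le> integral {a..t} (\<lambda>s. C * g s)"
  proof (rule has_integral_norm_le[OF eq[OF tg(1)]])
    show "continuous_on {a..t} (\<lambda>s. C * g s)" by (intro continuous_intros tg)
    show "norm (F t s) \<le> C * g s" if "s \<in> {a..t}" for s
      using F[OF tg(1) that] mult_left_mono[OF tg(3)[OF that] \<open>C \<ge> 0\<close>] by linarith
  qed
  then show "norm (e t) \<le> \<delta> + integral {a..t} (\<lambda>s. C * g s)"
    using f[OF tg(1)] norm_triangle_sub[of "e t" "f t"] by linarith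
qed

lemma has_vector_derivative_quotient:
  fixes f :: "real \<Rightarrow> 'a::real_normed_vector"
  shows "(f has_vector_derivative D) (at s within S) \<longleftrightarrow> ((\<lambda>r. (f r - f s) /\<^sub>R (r - s)) \<longlongrightarrow> D) (at s within S)"
proof -
  have eq: "norm ((f r - f s) - (r - s) *\<^sub>R D) / norm (r - s) = norm ((f r - f s) /\<^sub>R (r - s) - D)" if "r \<noteq> s" for r
  proof -
    have "(f r - f s) /\<^sub>R (r - s) - D = ((f r - f s) - (r - s) *\<^sub>R D) /\<^sub>R (r - s)"
      using that by (simp add: scaleR_diff_right)
    then show ?thesis by (simp add: divide_inverse mult.commute)
  qed
  have "(f has_vector_derivative D) (at s within S) \<longleftrightarrow>
      ((\<lambda>r. norm ((f r - f s) - (r - s) *\<^sub>R D) / norm (r - s)) \<longlongrightarrow> 0) (at s within S)"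
    by (simp add: has_vector_derivative_def has_derivative_iff_norm bounded_linear_scaleR_left)
  also have "\<dots> \<longleftrightarrow> ((\<lambda>r. norm ((f r - f s) /\<^sub>R (r - s) - D)) \<longlongrightarrow> 0) (at s within S)"
    by (rule Lim_cong_within) (use eq in auto)
  also have "\<dots> \<longleftrightarrow> ((\<lambda>r. (f r - f s) /\<^sub>R (r - s)) \<longlongrightarrow> D) (at s within S)"
    by (simp only: tendsto_norm_zero_iff LIM_zero_iff)
  finally show ?thesis .
qed

lemma compact_Delta: "compact J \<Longrightarrow> compact (Delta J)"
proof -
  assume J: "compact J"
  have "Delta J = (J \<times> J) \<inter> {p. snd p \<le> fst p}" by (auto simp: Delta_def)
  moreover have "closed {p::real\<times>real. snd p \<le> fst p}" by (intro closed_Collect_le continuous_intros)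
  ultimately show ?thesis using J by (metis compact_Int_closed compact_Times)
qed

lemma Delta_mono: "I \<subseteq> J \<Longrightarrow> Delta I \<subseteq> Delta J"
  by (auto simp: Delta_def)

lemma compact_exhaustion:
  fixes J :: "real set"
  assumes "is_interval J" "closed J"
  shows "compact (J \<inter> {-m..m})" "is_interval (J \<inter> {-m..m})"
  using assms by (auto simp: is_interval_Int is_interval_cc intro!: closed_Int_compact)

text \<open>Each point lies in the interior of a large enough square; the summand 1 in
  \<open>m\<close> provides that margin. Thus locally uniform limits on windows yield continuity for
  unbounded \<open>J\<close>.\<close>

lemma continuous_on_Delta_local:
  fixes f :: "real \<times> real \<Rightarrow> 'a::topological_space"
  assumes "\<And>m. continuous_on (Delta (J \<inter> {-m..m})) f"
  shows "continuous_on (Delta J) f"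
  unfolding continuous_on_eq_continuous_within
proof
  fix p assume p: "p \<in> Delta J"
  define m where "m = max \<bar>fst p\<bar> \<bar>snd p\<bar> + 1"
  let ?U = "{-m<..<m} \<times> {-m<..<m}"
  have pU: "p \<in> ?U" unfolding m_def by (cases p) auto
  have U: "open ?U" by (intro open_Times) auto
  have pm: "p \<in> Delta (J \<inter> {-m..m})" using p pU by (auto simp: Delta_def)
  have "at p within Delta J = at p within (Delta (J \<inter> {-m..m}))"
  proof (rule at_within_nhd[OF pU U])
    show "Delta J \<inter> ?U - {p} = Delta (J \<inter> {-m..m}) \<inter> ?U - {p}" by (auto simp: Delta_def)
  qed
  then show "continuous (at p within Delta J) f"
    using assms[of m] pm by (simp add: continuous_on_eq_continuous_within)
qed

text \<open>Terms of the Dyson-Phillips series for the perturbation of the family \<open>W\<close>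
  by the bounded operators \<open>B\<close>, applied to \<open>z\<close>.\<close>

primrec volterra_iter :: "(real \<Rightarrow> real \<Rightarrow> 'a \<Rightarrow> 'a::banach) \<Rightarrow> (real \<Rightarrow> 'a \<Rightarrow> 'a) \<Rightarrow> 'a \<Rightarrow> nat \<Rightarrow> real \<Rightarrow> real \<Rightarrow> 'a" where
  "volterra_iter W B z 0 t \<tau> = W t \<tau> z"
| "volterra_iter W B z (Suc k) t \<tau> = integral {\<tau>..t} (\<lambda>s. W t s (B s (volterra_iter W B z k s \<tau>)))"

definition volterra_sol :: "(real \<Rightarrow> real \<Rightarrow> 'a \<Rightarrow> 'a::banach) \<Rightarrow> (real \<Rightarrow> 'a \<Rightarrow> 'a) \<Rightarrow> real \<Rightarrow> real \<Rightarrow> 'a \<Rightarrow> 'a" where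
  "volterra_sol W B t \<tau> z = (\<Sum>k. volterra_iter W B z k t \<tau>)"

lemma volterra_kernel_continuous:
  fixes W :: "real \<Rightarrow> real \<Rightarrow> 'a::banach \<Rightarrow> 'a" and B :: "real \<Rightarrow> 'a \<Rightarrow> 'a"
  assumes J: "is_interval J"
    and W: "strongly_cont (Delta J) (\<lambda>p. W (fst p) (snd p))" and B: "strongly_cont J B"
    and u: "continuous_on (Delta J) (\<lambda>p. u (fst p) (snd p))"
  shows "continuous_on {q. (fst q, fst (snd q)) \<in> Delta J \<and> snd (snd q) \<in> {fst (snd q)..fst q}}
     (\<lambda>q. W (fst q) (snd (snd q)) (B (snd (snd q)) (u (snd (snd q)) (fst (snd q)))))"
    (is "continuous_on ?S _")
proof -
  have S: "(snd (snd q), fst (snd q)) \<in> Delta J" "(fst q, snd (snd q)) \<in> Delta J" "snd (snd q) \<in> J"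
    if "q \<in> ?S" for q
    using Delta_subinterval[OF J, of "fst q" "fst (snd q)" "snd (snd q)"] that by auto
  have "continuous_on ?S (\<lambda>q. (\<lambda>p. u (fst p) (snd p)) (snd (snd q), fst (snd q)))"
    by (rule continuous_on_compose2[OF u]) (use S in \<open>auto intro!: continuous_intros\<close>)
  then have "continuous_on ?S (\<lambda>q. u (snd (snd q)) (fst (snd q)))" by simp
  then have "continuous_on ?S (\<lambda>q. B (snd (snd q)) (u (snd (snd q)) (fst (snd q))))"
    by (rule strongly_cont_apply[OF B, rotated 2]) (use S in \<open>auto intro!: continuous_intros\<close>)
  then show ?thesis
    by (rule strongly_cont_apply2[OF W, rotated 3]) (use S in \<open>auto intro!: continuous_intros\<close>)
qed

lemma volterra_integrand_continuous:
  fixes W :: "real \<Rightarrow> real \<Rightarrow> 'a::banach \<Rightarrow> 'a" and B :: "real \<Rightarrow> 'a \<Rightarrow> 'a"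
  assumes J: "is_interval J"
    and W: "strongly_cont (Delta J) (\<lambda>p. W (fst p) (snd p))" and B: "strongly_cont J B"
    and u: "continuous_on {\<tau>..t} u" and t: "(t, \<tau>) \<in> Delta J"
  shows "continuous_on {\<tau>..t} (\<lambda>s. W t s (B s (u s)))"
proof -
  note S = Delta_subinterval[OF J t]
  have "continuous_on {\<tau>..t} (\<lambda>s. B s (u s))"
    by (rule strongly_cont_apply'[OF B u]) (use S in auto)
  then show ?thesis
    by (rule strongly_cont_apply2[OF W, rotated 3]) (use S in \<open>auto intro!: continuous_intros\<close>)
qed

context
  fixes J :: "real set" and W :: "real \<Rightarrow> real \<Rightarrow> 'a::banach \<Rightarrow> 'a" and B :: "real \<Rightarrow> 'a \<Rightarrow> 'a"
  assumes J: "is_interval J" "closed J"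
    and W: "strongly_cont (Delta J) (\<lambda>p. W (fst p) (snd p))" and B: "strongly_cont J B"
begin

lemma volterra_iter_continuous: "continuous_on (Delta J) (\<lambda>p. volterra_iter W B z k (fst p) (snd p))"
proof (induction k)
  case 0
  then show ?case using strongly_contD(2)[OF W] by simp
next
  case (Suc k)
  from continuous_on_triangle_integral[OF J(1) volterra_kernel_continuous[OF J(1) W B Suc], unfolded fst_conv snd_conv]
  show ?case by simp
qed

lemma section_continuous:
  assumes "continuous_on (Delta J) (\<lambda>p. u (fst p) (snd p))" "(t, \<tau>) \<in> Delta J"
  shows "continuous_on {\<tau>..t} (\<lambda>s. u s \<tau>)"
proof -
  have "continuous_on {\<tau>..t} (\<lambda>s. (\<lambda>p. u (fst p) (snd p)) (s, \<tau>))"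
    by (rule continuous_on_compose2[OF assms(1)])
      (use Delta_subinterval[OF J(1) assms(2)] in \<open>auto intro!: continuous_intros\<close>)
  then show ?thesis by simp
qed

lemma volterra_local_bounds:
  obtains K1 K2 where "K1 \<ge> 0" "K2 \<ge> 0"
    "\<And>t \<tau> z. (t, \<tau>) \<in> Delta (J \<inter> {-m..m}) \<Longrightarrow> norm (W t \<tau> z) \<le> K1 * norm z"
    "\<And>s z. s \<in> J \<inter> {-m..m} \<Longrightarrow> norm (B s z) \<le> K2 * norm z"
proof -
  obtain K1 where "K1 \<ge> 0" "\<forall>p\<in>Delta (J \<inter> {-m..m}). \<forall>z. norm (W (fst p) (snd p) z) \<le> K1 * norm z"
    using strongly_cont_bound[OF W compact_Delta[OF compact_exhaustion(1)[OF J]] Delta_mono] by blast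
  moreover obtain K2 where "K2 \<ge> 0" "\<forall>s\<in>J \<inter> {-m..m}. \<forall>z. norm (B s z) \<le> K2 * norm z"
    using strongly_cont_bound[OF B compact_exhaustion(1)[OF J]] by blast
  ultimately show ?thesis using that[of K1 K2] by force
qed

text \<open>Each iterated integral contributes one factor \<open>K1 * K2\<close> and integrates one
  more power of \<open>t - \<tau>\<close>, which produces the factorial and makes the series
  converge for every length of interval.\<close>

lemma volterra_iter_bound:
  assumes K: "K1 \<ge> 0" "K2 \<ge> 0"
    and K1: "\<And>t \<tau> z. (t, \<tau>) \<in> Delta (J \<inter> {-m..m}) \<Longrightarrow> norm (W t \<tau> z) \<le> K1 * norm z"
    and K2: "\<And>s z. s \<in> J \<inter> {-m..m} \<Longrightarrow> norm (B s z) \<le> K2 * norm z"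
    and p: "(t, \<tau>) \<in> Delta (J \<inter> {-m..m})"
  shows "norm (volterra_iter W B z k t \<tau>) \<le> K1 * norm z * ((K1 * K2 * (t - \<tau>)) ^ k / fact k)"
  using p
proof (induction k arbitrary: t)
  case 0
  then show ?case using K1[OF 0] by simp
next
  case (Suc k)
  note S = Delta_subinterval[OF compact_exhaustion(2)[OF J] Suc.prems]
  have tJ: "(t, \<tau>) \<in> Delta J" using Suc.prems by (auto simp: Delta_def)
  have tau: "\<tau> \<le> t" using Suc.prems by (auto simp: Delta_def)
  let ?C = "K1 * K2" and ?f = "\<lambda>s. W t s (B s (volterra_iter W B z k s \<tau>))"
  have "continuous_on {\<tau>..t} ?f"
    by (rule volterra_integrand_continuous[OF J(1) W B section_continuous[OF volterra_iter_continuous tJ] tJ])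
  then have "(?f has_integral volterra_iter W B z (Suc k) t \<tau>) {\<tau>..t}"
    by (simp add: integrable_continuous_interval integrable_integral)
  then have "norm (volterra_iter W B z (Suc k) t \<tau>)
    \<le> integral {\<tau>..t} (\<lambda>s. K1 * norm z * (?C * ((?C * (s - \<tau>)) ^ k / fact k)))"
  proof (rule has_integral_norm_le)
    show "continuous_on {\<tau>..t} (\<lambda>s. K1 * norm z * (?C * ((?C * (s - \<tau>)) ^ k / fact k)))"
      by (intro continuous_intros) auto
    fix s assume s: "s \<in> {\<tau>..t}"
    have "norm (?f s) \<le> K1 * (K2 * norm (volterra_iter W B z k s \<tau>))"
      using order_trans[OF K1[OF S(2)[OF s]] mult_left_mono[OF K2[OF S(1)[OF s]] K(1)]] .
    also have "\<dots> \<le> K1 * (K2 * (K1 * norm z * ((?C * (s - \<tau>)) ^ k / fact k)))"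
      using K by (intro mult_left_mono Suc.IH S s) auto
    finally show "norm (?f s) \<le> K1 * norm z * (?C * ((?C * (s - \<tau>)) ^ k / fact k))"
      by (simp only: mult_ac)
  qed
  also have "integral {\<tau>..t} (\<lambda>s. K1 * norm z * (?C * ((?C * (s - \<tau>)) ^ k / fact k)))
     = K1 * norm z * ((?C * (t - \<tau>)) ^ Suc k / fact (Suc k))"
  proof -
    have "((\<lambda>s. ?C * ((?C * (s - \<tau>)) ^ k / fact k)) has_integral
       (?C * (t - \<tau>)) ^ Suc k / fact (Suc k) - (?C * (\<tau> - \<tau>)) ^ Suc k / fact (Suc k)) {\<tau>..t}"
      by (rule fundamental_theorem_of_calculus[OF tau])
        (simp only: has_real_derivative_iff_has_vector_derivative[symmetric] DERIV_power_fact)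
    then have "((\<lambda>s. ?C * ((?C * (s - \<tau>)) ^ k / fact k)) has_integral
       (?C * (t - \<tau>)) ^ Suc k / fact (Suc k)) {\<tau>..t}" by simp
    from has_integral_mult_right[OF this, of "K1 * norm z"] show ?thesis by blast
  qed
  finally show ?case .
qed

lemma volterra_sol_uniform:
  shows "uniform_limit (Delta (J \<inter> {-m..m})) (\<lambda>n p. \<Sum>k<n. volterra_iter W B z k (fst p) (snd p))
    (\<lambda>p. volterra_sol W B (fst p) (snd p) z) sequentially"
proof -
  obtain K1 K2 where K: "K1 \<ge> 0" "K2 \<ge> 0"
    "\<And>t \<tau> z. (t, \<tau>) \<in> Delta (J \<inter> {-m..m}) \<Longrightarrow> norm (W t \<tau> z) \<le> K1 * norm z"
    "\<And>s z. s \<in> J \<inter> {-m..m} \<Longrightarrow> norm (B s z) \<le> K2 * norm z"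
    by (rule volterra_local_bounds[of m]) (rule that)
  show ?thesis
    unfolding volterra_sol_def
  proof (rule Weierstrass_m_test)
    \<comment> \<open>On the window, \<open>t - \<tau>\<close> is at most
      \<open>2 * m\<close>.\<close>
    show "summable (\<lambda>k. K1 * norm z * ((K1 * K2 * (2 * m)) ^ k / fact k))"
      using summable_exp[of "K1 * K2 * (2 * m)"] by (intro summable_mult) (simp add: divide_inverse mult.commute)
    fix k p assume p: "p \<in> Delta (J \<inter> {-m..m})"
    have "norm (volterra_iter W B z k (fst p) (snd p)) \<le> K1 * norm z * ((K1 * K2 * (fst p - snd p)) ^ k / fact k)"
      by (rule volterra_iter_bound[OF K]) (use p in auto)
    also have "\<dots> \<le> K1 * norm z * ((K1 * K2 * (2 * m)) ^ k / fact k)"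
      using K p by (intro mult_left_mono divide_right_mono power_mono) (auto simp: Delta_def)
    finally show "norm (volterra_iter W B z k (fst p) (snd p)) \<le> K1 * norm z * ((K1 * K2 * (2 * m)) ^ k / fact k)" .
  qed
qed

lemma volterra_sol_continuous: "continuous_on (Delta J) (\<lambda>p. volterra_sol W B (fst p) (snd p) z)"
proof (rule continuous_on_Delta_local)
  fix m
  have "continuous_on (Delta (J \<inter> {-m..m})) (\<lambda>p. volterra_iter W B z k (fst p) (snd p))" for k
    by (rule continuous_on_subset[OF volterra_iter_continuous Delta_mono[OF Int_lower1]])
  then show "continuous_on (Delta (J \<inter> {-m..m})) (\<lambda>p. volterra_sol W B (fst p) (snd p) z)"
    by (intro uniform_limit_theorem[OF _ volterra_sol_uniform] always_eventually allI continuous_on_sum) auto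
qed

text \<open>Partial sums satisfy the equation up to an index shift: the integral over the first
  \<open>n\<close> terms is the sum of the first \<open>Suc n\<close> terms without the initial one.
  Dominated convergence removes the shift.\<close>

lemma volterra_sol_eq:
  assumes t: "(t, \<tau>) \<in> Delta J"
  shows "((\<lambda>s. W t s (B s (volterra_sol W B s \<tau> z))) has_integral (volterra_sol W B t \<tau> z - W t \<tau> z)) {\<tau>..t}"
proof -
  define m where "m = max \<bar>t\<bar> \<bar>\<tau>\<bar>"
  have tm: "(t, \<tau>) \<in> Delta (J \<inter> {-m..m})" using t by (auto simp: Delta_def m_def)
  note S = Delta_subinterval[OF compact_exhaustion(2)[OF J] tm]
  obtain K1 K2 where K: "K1 \<ge> 0" "K2 \<ge> 0"
    "\<And>t \<tau> z. (t, \<tau>) \<in> Delta (J \<inter> {-m..m}) \<Longrightarrow> norm (W t \<tau> z) \<le> K1 * norm z"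
    "\<And>s z. s \<in> J \<inter> {-m..m} \<Longrightarrow> norm (B s z) \<le> K2 * norm z"
    by (rule volterra_local_bounds[of m]) (rule that)
  define P where "P n s = (\<Sum>k<n. volterra_iter W B z k s \<tau>)" for n s
  let ?U = "\<lambda>s. volterra_sol W B s \<tau> z"
  have Pc: "continuous_on {\<tau>..t} (P n)" for n
    unfolding P_def by (intro continuous_on_sum section_continuous[OF volterra_iter_continuous t])
  have Uc: "continuous_on {\<tau>..t} ?U"
    using section_continuous[OF volterra_sol_continuous t] .
  have ul: "uniform_limit {\<tau>..t} P ?U sequentially"
  proof -
    have "uniform_limit ((\<lambda>s. (s, \<tau>)) ` {\<tau>..t}) (\<lambda>n p. \<Sum>k<n. volterra_iter W B z k (fst p) (snd p))
      (\<lambda>p. volterra_sol W B (fst p) (snd p) z) sequentially"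
      using S by (intro uniform_limit_on_subset[OF volterra_sol_uniform[where m = m]]) auto
    then show ?thesis unfolding uniform_limit_iff P_def by simp
  qed
  have lim: "(\<lambda>n. P n s) \<longlonglongrightarrow> ?U s" if "s \<in> {\<tau>..t}" for s
    by (rule tendsto_uniform_limitI[OF ul that])
  obtain M where M: "\<And>n s. s \<in> {\<tau>..t} \<Longrightarrow> norm (P n s) \<le> M"
  proof -
    have "summable (\<lambda>k. K1 * norm z * ((K1 * K2 * (2 * m)) ^ k / fact k))" (is "summable ?a")
      using summable_exp[of "K1 * K2 * (2 * m)"] by (intro summable_mult) (simp add: divide_inverse mult.commute)
    have m0: "m \<ge> 0" by (simp add: m_def)
    have "norm (P n s) \<le> suminf ?a" if s: "s \<in> {\<tau>..t}" for n s
    proof -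
      have "norm (P n s) \<le> (\<Sum>k<n. ?a k)" unfolding P_def
      proof (rule sum_norm_le)
        fix k
        have "norm (volterra_iter W B z k s \<tau>) \<le> K1 * norm z * ((K1 * K2 * (s - \<tau>)) ^ k / fact k)"
          by (rule volterra_iter_bound[OF K S(3)[OF s]])
        also have "\<dots> \<le> ?a k"
          using K s tm by (intro mult_left_mono divide_right_mono power_mono) (auto simp: Delta_def)
        finally show "norm (volterra_iter W B z k s \<tau>) \<le> ?a k" .
      qed
      also have "\<dots> \<le> suminf ?a"
        using K m0 \<open>summable ?a\<close> by (intro sum_le_suminf) auto
      finally show ?thesis .
    qed
    then show ?thesis using that by blast
  qed
  show ?thesis
  proof (rule has_integral_dominated_continuous[where f = "\<lambda>n s. W t s (B s (P n s))"
        and I = "\<lambda>n. P (Suc n) t - W t \<tau> z" and M = "K1 * (K2 * M)"])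
    have lin: "bounded_linear (W t s)" "bounded_linear (B s)" if "s \<in> {\<tau>..t}" for s
      using S[OF that] strongly_contD(1)[OF W, of "(t, s)"] strongly_contD(1)[OF B, of s]
      by (auto simp: Delta_def)
    show "((\<lambda>s. W t s (B s (P n s))) has_integral (P (Suc n) t - W t \<tau> z)) {\<tau>..t}" for n
    proof -
      have "((\<lambda>s. \<Sum>k<n. W t s (B s (volterra_iter W B z k s \<tau>))) has_integral
         (\<Sum>k<n. volterra_iter W B z (Suc k) t \<tau>)) {\<tau>..t}"
        by (intro has_integral_sum finite_lessThan)
          (simp add: integrable_integral integrable_continuous_interval
            volterra_integrand_continuous[OF J(1) W B section_continuous[OF volterra_iter_continuous t] t])
      then have "((\<lambda>s. W t s (B s (P n s))) has_integral (\<Sum>k<n. volterra_iter W B z (Suc k) t \<tau>)) {\<tau>..t}"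
        by (rule has_integral_eq[rotated])
          (simp add: P_def linear_sum[OF bounded_linear.linear[OF lin(1)]] linear_sum[OF bounded_linear.linear[OF lin(2)]])
      moreover have "P (Suc n) t - W t \<tau> z = (\<Sum>k<n. volterra_iter W B z (Suc k) t \<tau>)"
        unfolding P_def by (subst sum.lessThan_Suc_shift) simp
      ultimately show ?thesis by (simp only:)
    qed
    show "(\<lambda>n. P (Suc n) t - W t \<tau> z) \<longlonglongrightarrow> ?U t - W t \<tau> z"
      using tm by (intro tendsto_diff tendsto_const LIMSEQ_Suc[OF lim]) (auto simp: Delta_def)
    show "continuous_on {\<tau>..t} (\<lambda>s. W t s (B s (P n s)))" for n
      by (rule volterra_integrand_continuous[OF J(1) W B Pc t])
    show "continuous_on {\<tau>..t} (\<lambda>s. W t s (B s (?U s)))"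
      by (rule volterra_integrand_continuous[OF J(1) W B Uc t])
    show "norm (W t s (B s (P n s))) \<le> K1 * (K2 * M)" if s: "s \<in> {\<tau>..t}" for n s
      by (rule order_trans[OF K(3)[OF S(2)[OF s]]], rule mult_left_mono[OF _ K(1)],
          rule order_trans[OF K(4)[OF S(1)[OF s]]], rule mult_left_mono[OF M[OF s] K(2)])
    show "(\<lambda>n. W t s (B s (P n s))) \<longlonglongrightarrow> W t s (B s (?U s))" if s: "s \<in> {\<tau>..t}" for s
      by (intro bounded_linear.tendsto[OF lin(1)[OF s]] bounded_linear.tendsto[OF lin(2)[OF s]] lim s)
  qed
qed

text \<open>The factor \<open>C\<close> is fixed before \<open>f\<close> and
  \<open>\<delta>\<close>, so \<open>\<delta> = 0\<close> forces \<open>e\<close> to vanish.\<close>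

lemma volterra_growth:
  assumes e: "continuous_on {\<tau>..b} e" and b: "(b, \<tau>) \<in> Delta J"
  shows "\<exists>C\<ge>0. \<forall>f \<delta>. (\<forall>t\<in>{\<tau>..b}. ((\<lambda>s. W t s (B s (e s))) has_integral (e t - f t)) {\<tau>..t} \<and> norm (f t) \<le> \<delta>)
    \<longrightarrow> norm (e b) \<le> \<delta> * C"
proof -
  define m where "m = max \<bar>b\<bar> \<bar>\<tau>\<bar>"
  have tm: "(b, \<tau>) \<in> Delta (J \<inter> {-m..m})" using b by (auto simp: Delta_def m_def)
  note S = Delta_subinterval[OF compact_exhaustion(2)[OF J]]
  obtain K1 K2 where K: "K1 \<ge> 0" "K2 \<ge> 0"
    "\<And>t \<tau> z. (t, \<tau>) \<in> Delta (J \<inter> {-m..m}) \<Longrightarrow> norm (W t \<tau> z) \<le> K1 * norm z"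
    "\<And>s z. s \<in> J \<inter> {-m..m} \<Longrightarrow> norm (B s z) \<le> K2 * norm z"
    by (rule volterra_local_bounds[of m]) (rule that)
  have "bounded (e ` {\<tau>..b})" using e compact_continuous_image compact_imp_bounded compact_Icc by blast
  then obtain M where M: "\<And>t. t \<in> {\<tau>..b} \<Longrightarrow> norm (e t) \<le> M" unfolding bounded_iff by blast
  have "norm (e b) \<le> \<delta> * exp (K1 * K2 * (b - \<tau>))"
    if f: "\<forall>t\<in>{\<tau>..b}. ((\<lambda>s. W t s (B s (e s))) has_integral (e t - f t)) {\<tau>..t} \<and> norm (f t) \<le> \<delta>" for f \<delta>
  proof (rule volterra_gronwall[where F = "\<lambda>t s. W t s (B s (e s))" and f = f and b = b and M = M])
    show "norm (W t s (B s (e s))) \<le> K1 * K2 * norm (e s)" if "t \<in> {\<tau>..b}" "s \<in> {\<tau>..t}" for t s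
    proof -
      have t: "(t, \<tau>) \<in> Delta (J \<inter> {-m..m})" using S(3)[OF tm that(1)] .
      show ?thesis
        using order_trans[OF K(3)[OF S(2)[OF t that(2)]] mult_left_mono[OF K(4)[OF S(1)[OF t that(2)]] K(1)]]
        by (simp add: mult.assoc)
    qed
  qed (use f K M tm in \<open>auto simp: Delta_def\<close>)
  then show ?thesis by (intro exI[of _ "exp (K1 * K2 * (b - \<tau>))"]) auto
qed

lemma volterra_unique:
  assumes "continuous_on {\<tau>..b} e" "(b, \<tau>) \<in> Delta J"
    and "\<And>t. t \<in> {\<tau>..b} \<Longrightarrow> ((\<lambda>s. W t s (B s (e s))) has_integral e t) {\<tau>..t}"
  shows "e b = 0"
proof -
  obtain C where "\<forall>f \<delta>. (\<forall>t\<in>{\<tau>..b}. ((\<lambda>s. W t s (B s (e s))) has_integral (e t - f t)) {\<tau>..t} \<and> norm (f t) \<le> \<delta>)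
    \<longrightarrow> norm (e b) \<le> \<delta> * C" using volterra_growth[OF assms(1,2)] by blast
  from this[rule_format, of "\<lambda>_. 0" 0] show ?thesis using assms(3) by simp
qed

text \<open>Linearity comes from uniqueness: the defect of additivity or homogeneity solves the
  homogeneous Volterra equation. The operator bound comes from summing the series termwise.\<close>

lemma volterra_sol_strongly_cont: "strongly_cont (Delta J) (\<lambda>p. volterra_sol W B (fst p) (snd p))"
  unfolding strongly_cont_def
proof (intro conjI ballI allI)
  fix z show "continuous_on (Delta J) (\<lambda>p. volterra_sol W B (fst p) (snd p) z)"
    by (rule volterra_sol_continuous)
next
  fix p assume p: "p \<in> Delta J"
  obtain t \<tau> where pt: "p = (t, \<tau>)" by fastforce
  with p have b: "(t, \<tau>) \<in> Delta J" by simp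
  let ?U = "\<lambda>s. volterra_sol W B s \<tau>"
  note S = Delta_subinterval[OF J(1) b]
  note sc = section_continuous[OF volterra_sol_continuous b]
  have lin: "linear (W s r)" "linear (B r)" if "s \<in> {\<tau>..t}" "r \<in> {\<tau>..s}" for s r
    using Delta_subinterval[OF J(1) S(3)[OF that(1)] that(2)] strongly_contD(1)[OF W, of "(s, r)"] strongly_contD(1)[OF B, of r]
    by (auto simp: Delta_def intro: bounded_linear.linear)
  have linW: "linear (W s \<tau>)" if "s \<in> {\<tau>..t}" for s
    using that lin(1)[OF that, of \<tau>] by simp
  have add: "?U t (x + y) = ?U t x + ?U t y" for x y
  proof -
    let ?e = "\<lambda>s. ?U s (x + y) - ?U s x - ?U s y"
    have "?e t = 0"
    proof (rule volterra_unique[OF _ b])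
      show "continuous_on {\<tau>..t} ?e" by (intro continuous_intros sc)
      fix s assume s: "s \<in> {\<tau>..t}"
      have "((\<lambda>r. W s r (B r (?U r (x + y))) - W s r (B r (?U r x)) - W s r (B r (?U r y))) has_integral
         (?U s (x + y) - W s \<tau> (x + y)) - (?U s x - W s \<tau> x) - (?U s y - W s \<tau> y)) {\<tau>..s}"
        by (intro has_integral_diff volterra_sol_eq S s)
      moreover have "(?U s (x + y) - W s \<tau> (x + y)) - (?U s x - W s \<tau> x) - (?U s y - W s \<tau> y) = ?e s"
        using linear_add[OF linW[OF s], of x y] by (simp add: algebra_simps)
      ultimately have "((\<lambda>r. W s r (B r (?U r (x + y))) - W s r (B r (?U r x)) - W s r (B r (?U r y))) has_integral ?e s) {\<tau>..s}"
        by metis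
      then show "((\<lambda>r. W s r (B r (?e r))) has_integral ?e s) {\<tau>..s}"
        by (rule has_integral_eq[rotated]) (simp add: linear_diff[OF lin(1)[OF s]] linear_diff[OF lin(2)[OF s]])
    qed
    then show ?thesis by (simp add: algebra_simps)
  qed
  have scale: "?U t (c *\<^sub>R x) = c *\<^sub>R ?U t x" for c x
  proof -
    let ?e = "\<lambda>s. ?U s (c *\<^sub>R x) - c *\<^sub>R ?U s x"
    have "?e t = 0"
    proof (rule volterra_unique[OF _ b])
      show "continuous_on {\<tau>..t} ?e" by (intro continuous_intros sc)
      fix s assume s: "s \<in> {\<tau>..t}"
      have "((\<lambda>r. W s r (B r (?U r (c *\<^sub>R x))) - c *\<^sub>R W s r (B r (?U r x))) has_integral
         (?U s (c *\<^sub>R x) - W s \<tau> (c *\<^sub>R x)) - c *\<^sub>R (?U s x - W s \<tau> x)) {\<tau>..s}"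
        by (intro has_integral_diff has_integral_cmul volterra_sol_eq S s)
      moreover have "(?U s (c *\<^sub>R x) - W s \<tau> (c *\<^sub>R x)) - c *\<^sub>R (?U s x - W s \<tau> x) = ?e s"
        by (simp add: linear_scale[OF linW[OF s]] algebra_simps)
      ultimately have "((\<lambda>r. W s r (B r (?U r (c *\<^sub>R x))) - c *\<^sub>R W s r (B r (?U r x))) has_integral ?e s) {\<tau>..s}"
        by metis
      then show "((\<lambda>r. W s r (B r (?e r))) has_integral ?e s) {\<tau>..s}"
        by (rule has_integral_eq[rotated])
          (simp add: linear_diff[OF lin(1)[OF s]] linear_diff[OF lin(2)[OF s]]
            linear_scale[OF lin(1)[OF s]] linear_scale[OF lin(2)[OF s]])
    qed
    then show ?thesis by simp
  qed
  define m where "m = max \<bar>t\<bar> \<bar>\<tau>\<bar>"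
  have tm: "(t, \<tau>) \<in> Delta (J \<inter> {-m..m})" using b by (auto simp: Delta_def m_def)
  obtain K1 K2 where K: "K1 \<ge> 0" "K2 \<ge> 0"
    "\<And>t \<tau> z. (t, \<tau>) \<in> Delta (J \<inter> {-m..m}) \<Longrightarrow> norm (W t \<tau> z) \<le> K1 * norm z"
    "\<And>s z. s \<in> J \<inter> {-m..m} \<Longrightarrow> norm (B s z) \<le> K2 * norm z"
    by (rule volterra_local_bounds[of m]) (rule that)
  have "norm (?U t x) \<le> norm x * (K1 * exp (K1 * K2 * (t - \<tau>)))" for x
  proof -
    have sums: "(\<lambda>k. K1 * norm x * ((K1 * K2 * (t - \<tau>)) ^ k / fact k)) sums (K1 * norm x * exp (K1 * K2 * (t - \<tau>)))"
      using exp_converges[of "K1 * K2 * (t - \<tau>)"] by (intro sums_mult) (simp add: divide_inverse mult.commute)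
    have "norm (?U t x) \<le> (\<Sum>k. K1 * norm x * ((K1 * K2 * (t - \<tau>)) ^ k / fact k))"
      unfolding volterra_sol_def
      by (rule norm_suminf_le[OF volterra_iter_bound[OF K tm] sums_summable[OF sums]])
    then show ?thesis using sums_unique[OF sums] by (simp add: mult_ac)
  qed
  then show "bounded_linear (volterra_sol W B (fst p) (snd p))"
    unfolding pt using add scale by (intro bounded_linear_intro) auto
qed

end

section \<open>Evolution families of bounded generators\<close>

text \<open>Integrated form of the equation U' = L U with U the identity on the diagonal, posed
  vector by vector because \<open>L\<close> is only strongly continuous.\<close>

definition bounded_evolution :: "real set \<Rightarrow> (real \<Rightarrow> 'a \<Rightarrow> 'a::real_normed_vector) \<Rightarrow> (real \<Rightarrow> real \<Rightarrow> 'a \<Rightarrow> 'a) \<Rightarrow> bool" where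
  "bounded_evolution J L U \<longleftrightarrow> strongly_cont (Delta J) (\<lambda>p. U (fst p) (snd p)) \<and>
     (\<forall>t \<tau> z. (t, \<tau>) \<in> Delta J \<longrightarrow> ((\<lambda>s. L s (U s \<tau> z)) has_integral (U t \<tau> z - z)) {\<tau>..t})"

text \<open>With the constant family \<open>z\<close> as unperturbed family, the Volterra equation
  is exactly the integrated differential equation.\<close>

lemma bounded_evolution_exists:
  fixes L :: "real \<Rightarrow> 'a::banach \<Rightarrow> 'a"
  assumes "is_interval J" "closed J" "strongly_cont J L"
  shows "\<exists>U. bounded_evolution J L U"
proof -
  have W: "strongly_cont (Delta J) (\<lambda>p. (\<lambda>t s (z::'a). z) (fst p) (snd p))"
    by (simp add: strongly_cont_def bounded_linear_ident)
  show ?thesis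
    unfolding bounded_evolution_def
    using volterra_sol_strongly_cont[OF assms(1,2) W assms(3)] volterra_sol_eq[OF assms(1,2) W assms(3)]
    by (intro exI[of _ "volterra_sol (\<lambda>t s z. z) L"]) auto
qed

context
  fixes J :: "real set" and L :: "real \<Rightarrow> 'a::banach \<Rightarrow> 'a" and U :: "real \<Rightarrow> real \<Rightarrow> 'a \<Rightarrow> 'a"
  assumes J: "is_interval J" "closed J" and L: "strongly_cont J L" and U: "bounded_evolution J L U"
begin

lemma bounded_evolution_strongly_cont: "strongly_cont (Delta J) (\<lambda>p. U (fst p) (snd p))"
  and bounded_evolution_eq: "(t, \<tau>) \<in> Delta J \<Longrightarrow> ((\<lambda>s. L s (U s \<tau> z)) has_integral (U t \<tau> z - z)) {\<tau>..t}"
  using U by (auto simp: bounded_evolution_def)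

lemma bounded_evolution_linear: "(t, \<tau>) \<in> Delta J \<Longrightarrow> bounded_linear (U t \<tau>)"
  using strongly_contD(1)[OF bounded_evolution_strongly_cont, of "(t, \<tau>)"] by simp

lemma bounded_evolution_refl: "t \<in> J \<Longrightarrow> U t t z = z"
  using integral_unique[OF bounded_evolution_eq[of t t z]] by (simp add: Delta_def)

lemma bounded_evolution_section: "(t, \<tau>) \<in> Delta J \<Longrightarrow> continuous_on {\<tau>..t} (\<lambda>s. U s \<tau> z)"
  by (rule strongly_cont_apply2[OF bounded_evolution_strongly_cont, where v = "\<lambda>_. z"])
    (simp_all add: Delta_subinterval(3)[OF J(1)] continuous_on_id continuous_on_const)

lemma identity_strongly_cont: "strongly_cont (Delta J) (\<lambda>p. (\<lambda>t s (z::'a). z) (fst p) (snd p))"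
  by (simp add: strongly_cont_def bounded_linear_ident)

text \<open>Both sides, as functions of the later time, solve the integrated equation on
  \<open>{s..t}\<close> with the same value at \<open>s\<close>; subtracting the part of the
  integral over \<open>{\<tau>..s}\<close> makes this visible.\<close>

lemma bounded_evolution_cocycle:
  assumes "(t, s) \<in> Delta J" "(s, \<tau>) \<in> Delta J"
  shows "U t s (U s \<tau> z) = U t \<tau> z"
proof -
  have t\<tau>: "(t, \<tau>) \<in> Delta J" using assms by (auto simp: Delta_def)
  note S = Delta_subinterval[OF J(1) assms(1)]
  have S': "(r, \<tau>) \<in> Delta J" if "r \<in> {s..t}" for r
    using Delta_subinterval(3)[OF J(1) t\<tau>, of r] that assms(2) by (auto simp: Delta_def)
  let ?e = "\<lambda>r. U r s (U s \<tau> z) - U r \<tau> z"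
  have "?e t = 0"
  proof (rule volterra_unique[OF J identity_strongly_cont L _ assms(1)])
    have "continuous_on {s..t} (\<lambda>r. U r \<tau> z)"
      using bounded_evolution_section[OF t\<tau>] by (rule continuous_on_subset) (use assms in \<open>auto simp: Delta_def\<close>)
    then show "continuous_on {s..t} ?e" by (intro continuous_intros bounded_evolution_section assms)
    fix r assume r: "r \<in> {s..t}"
    have eqs: "U r \<tau> z = z + integral {\<tau>..r} (\<lambda>q. L q (U q \<tau> z))" "U s \<tau> z = z + integral {\<tau>..s} (\<lambda>q. L q (U q \<tau> z))"
      using integral_unique[OF bounded_evolution_eq[OF S'[OF r], of z]] integral_unique[OF bounded_evolution_eq[OF assms(2), of z]] by simp_all
    have "((\<lambda>q. L q (U q \<tau> z)) has_integral (integral {s..r} (\<lambda>q. L q (U q \<tau> z)))) {s..r}"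
      using bounded_evolution_eq[OF S'[OF r], of z] integrable_subinterval_real[of "\<lambda>q. L q (U q \<tau> z)" \<tau> r s r] assms(2) r
      by (auto simp: Delta_def intro!: integrable_integral)
    moreover have "integral {\<tau>..s} (\<lambda>q. L q (U q \<tau> z)) + integral {s..r} (\<lambda>q. L q (U q \<tau> z)) = integral {\<tau>..r} (\<lambda>q. L q (U q \<tau> z))"
      using Henstock_Kurzweil_Integration.integral_combine[of \<tau> s r "\<lambda>q. L q (U q \<tau> z)"]
        bounded_evolution_eq[OF S'[OF r], of z] assms(2) r
      by (auto simp: Delta_def has_integral_iff)
    then have "integral {s..r} (\<lambda>q. L q (U q \<tau> z)) = U r \<tau> z - U s \<tau> z"
      unfolding eqs by (simp add: algebra_simps)
    ultimately have "((\<lambda>q. L q (U q s (U s \<tau> z)) - L q (U q \<tau> z)) has_integral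
       (U r s (U s \<tau> z) - U s \<tau> z) - (U r \<tau> z - U s \<tau> z)) {s..r}"
      using has_integral_diff[OF bounded_evolution_eq[OF S(3)[OF r], of "U s \<tau> z"]] by metis
    then have "((\<lambda>q. L q (U q s (U s \<tau> z)) - L q (U q \<tau> z)) has_integral ?e r) {s..r}" by simp
    then show "((\<lambda>q. L q (?e q)) has_integral ?e r) {s..r}"
    proof (rule has_integral_eq[rotated])
      fix q assume "q \<in> {s..r}"
      then have "linear (L q)" using strongly_contD(1)[OF L S(1)] r by (auto intro: bounded_linear.linear)
      then show "L q (U q s (U s \<tau> z)) - L q (U q \<tau> z) = L q (?e q)" by (simp add: linear_diff)
    qed
  qed
  then show ?thesis by simp
qed

lemma bounded_evolution_average:
  assumes t: "(t, \<tau>) \<in> Delta J"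
  shows "U t \<tau> z - z = (t - \<tau>) *\<^sub>R integral {0..1} (\<lambda>r. L (\<tau> + r * (t - \<tau>)) (U (\<tau> + r * (t - \<tau>)) \<tau> z))"
proof -
  have "continuous_on {\<tau>..t} (\<lambda>s. L s (U s \<tau> z))"
    by (rule strongly_cont_apply'[OF L bounded_evolution_section[OF t]]) (use Delta_subinterval[OF J(1) t] in auto)
  moreover have "\<tau> \<le> t" using t by (auto simp: Delta_def)
  ultimately have "integral {\<tau>..t} (\<lambda>s. L s (U s \<tau> z)) = (t - \<tau>) *\<^sub>R integral {0..1} (\<lambda>r. L (\<tau> + r * (t - \<tau>)) (U (\<tau> + r * (t - \<tau>)) \<tau> z))"
    by (rule integral_unit_reparam[rotated])
  then show ?thesis using bounded_evolution_eq[OF t, of z] by (metis integral_unique)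
qed

text \<open>Difference quotients in the second argument are written as \<open>U t (max s r)\<close> applied to a
  forward difference quotient on the interval between \<open>s\<close> and \<open>r\<close>; this treats both signs of
  \<open>r - s\<close> at once.\<close>
lemma bounded_evolution_derivative_left:
  assumes t: "(t, \<tau>) \<in> Delta J" and s: "s \<in> {\<tau>..t}"
    and x: "\<And>s. s \<in> {\<tau>..t} \<Longrightarrow> (x has_vector_derivative x' s) (at s within {\<tau>..t})"
  shows "((\<lambda>s. U t s (x s)) has_vector_derivative U t s (x' s - L s (x s))) (at s within {\<tau>..t})"
proof -
  let ?S = "{\<tau>..t}"
  note S = Delta_subinterval[OF J(1) t]
  have xc: "continuous_on ?S x"
    using x by (meson continuous_on_eq_continuous_within has_vector_derivative_continuous)
  have mx: "(max r s, min r s) \<in> Delta J" "max r s \<in> ?S" "min r s \<in> ?S" if "r \<in> ?S" for r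
    using that s S by (auto simp: Delta_def max_def min_def)
  define q where "q r = (x r - x s) /\<^sub>R (r - s)" for r
  \<comment> \<open>Difference quotient of the evolution over the segment between \<open>s\<close>
    and \<open>r\<close>, written as an average. In this form it also makes sense at
    \<open>r = s\<close>, where it equals \<open>L s (x s)\<close>, and depends continuously on
    \<open>r\<close>.\<close>
  define a where "a r = integral {0..1} (\<lambda>v. L (min r s + v * (max r s - min r s)) (U (min r s + v * (max r s - min r s)) (min r s) (x (min r s))))" for r
  have q: "(q \<longlongrightarrow> x' s) (at s within ?S)"
    using x[OF s] unfolding has_vector_derivative_quotient q_def .
  have a: "(a \<longlongrightarrow> L s (x s)) (at s within ?S)"
  proof -
    have "continuous_on (?S \<times> cbox 0 1) (\<lambda>(r, v). L (min r s + v * (max r s - min r s)) (U (min r s + v * (max r s - min r s)) (min r s) (x (min r s))))"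
    proof -
      let ?h = "\<lambda>p::real\<times>real. min (fst p) s + snd p * (max (fst p) s - min (fst p) s)"
      have h: "continuous_on (?S \<times> cbox 0 1) ?h" by (intro continuous_intros)
      have hJ: "?h p \<in> J" "(?h p, min (fst p) s) \<in> Delta J" if "p \<in> ?S \<times> cbox 0 1" for p
        using Delta_segment[OF J(1) mx(1), of "fst p" "snd p"] mx that S by (auto simp: Delta_def)
      have "continuous_on (?S \<times> cbox 0 1) (\<lambda>p. x (min (fst p) s))"
        by (rule continuous_on_compose2[OF xc]) (use s in \<open>auto intro!: continuous_intros\<close>)
      then have "continuous_on (?S \<times> cbox 0 1) (\<lambda>p. U (?h p) (min (fst p) s) (x (min (fst p) s)))"
        by (rule strongly_cont_apply2[OF bounded_evolution_strongly_cont h, rotated 2])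
          (use hJ(2) in \<open>auto intro!: continuous_intros\<close>)
      then have "continuous_on (?S \<times> cbox 0 1) (\<lambda>p. L (?h p) (U (?h p) (min (fst p) s) (x (min (fst p) s))))"
        by (rule strongly_cont_apply[OF L h hJ(1), rotated])
      then show ?thesis by (simp add: case_prod_unfold)
    qed
    from integral_continuous_on_param[OF this] have "continuous_on ?S a" unfolding a_def by simp
    then have "(a \<longlongrightarrow> a s) (at s within ?S)" using s by (auto simp: continuous_on_def)
    moreover have "a s = L s (x s)" using S(1)[OF s] by (simp add: a_def bounded_evolution_refl)
    ultimately show ?thesis by simp
  qed
  have lim: "((\<lambda>r. U t (max r s) (q r - a r)) \<longlongrightarrow> U t s (x' s - L s (x s))) (at s within ?S)"
  proof (rule strong_tendsto_within[where F = "\<lambda>r. U t (max r s)" and ?F0.0 = "U t s"])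
    show "bounded_linear (U t (max r s))" if "r \<in> ?S" for r
      by (rule bounded_evolution_linear[OF S(2)[OF mx(2)[OF that]]])
    show "bounded_linear (U t s)" by (rule bounded_evolution_linear[OF S(2)[OF s]])
    show "((\<lambda>r. q r - a r) \<longlongrightarrow> x' s - L s (x s)) (at s within ?S)" by (intro tendsto_diff q a)
    fix z
    have "continuous_on ?S (\<lambda>r. U t (max r s) z)"
      by (rule strongly_cont_apply2[OF bounded_evolution_strongly_cont])
        (use S(2) mx(2) in \<open>auto intro!: continuous_intros\<close>)
    then have "((\<lambda>r. U t (max r s) z) \<longlongrightarrow> U t (max s s) z) (at s within ?S)"
      using s unfolding continuous_on_def by (rule bspec)
    then show "((\<lambda>r. U t (max r s) z) \<longlongrightarrow> U t s z) (at s within ?S)" by simp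
  qed
  have quot: "(U t r (x r) - U t s (x s)) /\<^sub>R (r - s) = U t (max r s) (q r - a r)" if r: "r \<in> ?S" "r \<noteq> s" for r
  proof -
    let ?m = "max r s" and ?l = "min r s"
    have lin: "linear (U t ?m)" using bounded_evolution_linear[OF S(2)[OF mx(2)[OF r(1)]]] bounded_linear.linear by blast
    have "U t ?l (x ?l) = U t ?m (U ?m ?l (x ?l))"
      using bounded_evolution_cocycle[OF S(2)[OF mx(2)[OF r(1)]] mx(1)[OF r(1)]] by simp
    moreover have "U ?m ?l (x ?l) = x ?l + (?m - ?l) *\<^sub>R a r"
      using bounded_evolution_average[OF mx(1)[OF r(1)], of "x ?l"] unfolding a_def by (simp add: algebra_simps)
    ultimately have "U t ?m (x ?m) - U t ?l (x ?l) = U t ?m ((x ?m - x ?l) - (?m - ?l) *\<^sub>R a r)"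
      by (simp add: linear_diff[OF lin] linear_add[OF lin])
    moreover have "x ?m - x ?l = (?m - ?l) *\<^sub>R q r"
    proof -
      have "(r - s) *\<^sub>R q r = x r - x s" using r(2) by (simp add: q_def)
      moreover have "(s - r) *\<^sub>R q r = - ((r - s) *\<^sub>R q r)" by (simp flip: scaleR_minus_left)
      ultimately show ?thesis by (cases "r \<le> s") (auto simp: max_def min_def)
    qed
    ultimately have *: "U t ?m (x ?m) - U t ?l (x ?l) = (?m - ?l) *\<^sub>R U t ?m (q r - a r)"
      by (simp add: linear_scale[OF lin] flip: scaleR_diff_right)
    have "U t r (x r) - U t s (x s) = (r - s) *\<^sub>R U t ?m (q r - a r)"
    proof (cases "r \<le> s")
      case True
      then have "U t s (x s) - U t r (x r) = (s - r) *\<^sub>R U t ?m (q r - a r)" using * by (simp add: max_def min_def)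
      then have "- (U t s (x s) - U t r (x r)) = (- (s - r)) *\<^sub>R U t ?m (q r - a r)" by (simp only: scaleR_minus_left)
      then show ?thesis by simp
    next
      case False
      then show ?thesis using * by (simp add: max_def min_def)
    qed
    then show ?thesis using r(2) by simp
  qed
  show ?thesis
    unfolding has_vector_derivative_quotient
    using lim by (rule Lim_transform_within[OF _ zero_less_one]) (use quot in auto)
qed

text \<open>Duhamel's formula: the derivative of \<open>U t s (x s)\<close> in \<open>s\<close> is
  \<open>U t s\<close> applied to the defect of \<open>x\<close> as a solution. Every comparison of
  two evolutions below is an instance.\<close>

lemma bounded_evolution_compare:
  assumes t: "(t, \<tau>) \<in> Delta J"
    and x: "\<And>s. s \<in> {\<tau>..t} \<Longrightarrow> (x has_vector_derivative x' s) (at s within {\<tau>..t})"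
  shows "((\<lambda>s. U t s (x' s - L s (x s))) has_integral (x t - U t \<tau> (x \<tau>))) {\<tau>..t}"
proof -
  have "\<tau> \<le> t" "t \<in> J" using t by (auto simp: Delta_def)
  then show ?thesis
    using fundamental_theorem_of_calculus[OF _ bounded_evolution_derivative_left[OF t _ x]] bounded_evolution_refl by simp
qed

lemma bounded_evolution_derivative:
  assumes "s \<in> {\<tau>..t}" "(t, \<tau>) \<in> Delta J"
  shows "((\<lambda>s. U s \<tau> z) has_vector_derivative L s (U s \<tau> z)) (at s within {\<tau>..t})"
proof -
  have c: "continuous_on {\<tau>..t} (\<lambda>s. L s (U s \<tau> z))"
    by (rule strongly_cont_apply'[OF L bounded_evolution_section[OF assms(2)]])
      (use Delta_subinterval[OF J(1) assms(2)] in auto)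
  have "((\<lambda>s. z + integral {\<tau>..s} (\<lambda>s. L s (U s \<tau> z))) has_vector_derivative 0 + L s (U s \<tau> z)) (at s within {\<tau>..t})"
    by (intro has_vector_derivative_add has_vector_derivative_const integral_has_vector_derivative c assms)
  then show ?thesis
    unfolding add_0
  proof (rule has_vector_derivative_transform[OF assms(1), rotated])
    fix r assume "r \<in> {\<tau>..t}"
    then show "U r \<tau> z = z + integral {\<tau>..r} (\<lambda>s. L s (U s \<tau> z))"
      using integral_unique[OF bounded_evolution_eq[OF Delta_subinterval(3)[OF J(1) assms(2)], of r z]] by simp
  qed
qed

lemma bounded_evolution_unique:
  assumes t: "(t, \<tau>) \<in> Delta J"
    and x: "\<And>s. s \<in> {\<tau>..t} \<Longrightarrow> (x has_vector_derivative L s (x s)) (at s within {\<tau>..t})"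
  shows "x t = U t \<tau> (x \<tau>)"
proof -
  have "((\<lambda>s. U t s (L s (x s) - L s (x s))) has_integral (x t - U t \<tau> (x \<tau>))) {\<tau>..t}"
    by (rule bounded_evolution_compare[OF t x])
  then have "((\<lambda>s. 0) has_integral (x t - U t \<tau> (x \<tau>))) {\<tau>..t}"
    by (rule has_integral_eq[rotated])
      (simp add: linear_0[OF bounded_linear.linear[OF bounded_evolution_linear[OF Delta_subinterval(2)[OF J(1) t]]]])
  then show ?thesis using has_integral_unique by fastforce
qed

end

text \<open>Duhamel's formula for an orbit of the second evolution. Only \<open>L2 - L1\<close>
  enters, so a term common to both generators, such as the Yosida part, cancels however large it
  is.\<close>

lemma bounded_evolution_difference:
  fixes L1 L2 :: "real \<Rightarrow> 'a::banach \<Rightarrow> 'a"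
  assumes J: "is_interval J" "closed J" and L: "strongly_cont J L1" "strongly_cont J L2"
    and U: "bounded_evolution J L1 U1" "bounded_evolution J L2 U2" and t: "(t, \<tau>) \<in> Delta J"
  shows "((\<lambda>s. U1 t s (L2 s (U2 s \<tau> z) - L1 s (U2 s \<tau> z))) has_integral (U2 t \<tau> z - U1 t \<tau> z)) {\<tau>..t}"
proof -
  have "\<tau> \<in> J" using t by (auto simp: Delta_def)
  then show ?thesis
    using bounded_evolution_compare[OF J L(1) U(1) t bounded_evolution_derivative[OF J L(2) U(2) _ t, of _ z]]
      bounded_evolution_refl[OF J L(2) U(2), of \<tau> z] by simp
qed

section \<open>Dissipative generators and Yosida approximations\<close>

text \<open>The range condition is posed for the parameter 1 only; other parameters are reached by
  scaling \<open>A\<close>.\<close>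

locale m_dissipative =
  fixes D :: "'a::{real_inner, banach} set" and A :: "'a \<Rightarrow> 'a"
  assumes sub: "subspace D"
    and A_add: "x \<in> D \<Longrightarrow> y \<in> D \<Longrightarrow> A (x + y) = A x + A y"
    and A_scale: "x \<in> D \<Longrightarrow> A (c *\<^sub>R x) = c *\<^sub>R A x"
    and dissip: "x \<in> D \<Longrightarrow> inner (A x) x \<le> 0"
    and range: "\<exists>x\<in>D. x - A x = y"
begin

lemma A_diff: "x \<in> D \<Longrightarrow> y \<in> D \<Longrightarrow> A (x - y) = A x - A y"
  using A_add[of x "(-1) *\<^sub>R y"] A_scale[of y "-1"] subspace_scale[OF sub, of y "-1"] by simp

lemma resolvent_unique:
  assumes "x \<in> D" "y \<in> D" "x - A x = y - A y"
  shows "x = y"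
proof -
  have "A x - A y = x - y" using assms(3) by (simp add: algebra_simps)
  then have "A (x - y) = x - y" using A_diff[OF assms(1,2)] by simp
  then have "inner (x - y) (x - y) \<le> 0"
    using dissip[of "x - y"] subspace_diff[OF sub assms(1,2)] by simp
  then show ?thesis using inner_ge_zero[of "x - y"] by (metis antisym inner_eq_zero_iff right_minus_eq)
qed

abbreviation "R \<equiv> resolvent1 D A"

lemma resolvent: "R y \<in> D" "R y - A (R y) = y"
proof -
  have "\<exists>!x. x \<in> D \<and> x - A x = y" using range[of y] resolvent_unique by blast
  from theI'[OF this] show "R y \<in> D" "R y - A (R y) = y" unfolding resolvent1_def by auto
qed

lemma A_resolvent: "A (R y) = R y - y"
  using resolvent(2)[of y] by (simp add: algebra_simps)

lemma resolvent_inverse: "x \<in> D \<Longrightarrow> R (x - A x) = x"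
  using resolvent[of "x - A x"] resolvent_unique by blast

lemma norm_resolvent: "norm (R y) \<le> norm y"
proof (cases "R y = 0")
  case False
  have "inner (R y - A (R y)) (R y) = inner y (R y)" by (simp add: resolvent)
  then have "inner (R y) (R y) \<le> inner y (R y)"
    using dissip[OF resolvent(1)[of y]] by (simp add: inner_diff_left)
  also have "\<dots> \<le> norm y * norm (R y)" by (rule norm_cauchy_schwarz)
  finally show ?thesis using False by (simp add: dot_square_norm power2_eq_square)
qed simp

lemma bounded_linear_resolvent: "bounded_linear R"
proof (rule bounded_linear_intro[where K = 1])
  fix x y :: 'a and r :: real
  show "R (x + y) = R x + R y"
  proof -
    have "R x + R y - A (R x + R y) = x + y" by (simp add: A_add resolvent A_resolvent)
    then show ?thesis using resolvent_inverse[OF subspace_add[OF sub resolvent(1) resolvent(1)]] by metis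
  qed
  show "R (r *\<^sub>R x) = r *\<^sub>R R x"
    using resolvent_inverse[of "r *\<^sub>R R x"] subspace_scale[OF sub] A_scale resolvent A_resolvent
    by (simp add: scaleR_diff_right)
  show "norm (R x) \<le> norm x * 1" using norm_resolvent by simp
qed

lemma resolvent_commute:
  assumes "linear T" "\<And>x. x \<in> D \<Longrightarrow> T x \<in> D \<and> A (T x) = T (A x)"
  shows "R (T y) = T (R y)"
  using resolvent_inverse[of "T (R y)"] assms(2) resolvent(1)[of y] A_resolvent[of y]
  by (simp add: linear_diff[OF assms(1)])

text \<open>\<open>A\<close> is closed because I - \<open>A\<close> has the bounded, everywhere
  defined inverse \<open>R\<close>: apply \<open>R\<close> to \<open>x n - A (x n)\<close> and pass
  to the limit.\<close>

lemma closed_operator: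
  assumes "\<And>n. x n \<in> D" "x \<longlonglongrightarrow> l" "(\<lambda>n. A (x n)) \<longlonglongrightarrow> m"
  shows "l \<in> D" "A l = m"
proof -
  have "(\<lambda>n. R (x n - A (x n))) \<longlonglongrightarrow> R (l - m)"
    by (intro bounded_linear.tendsto[OF bounded_linear_resolvent] tendsto_diff assms)
  then have "x \<longlonglongrightarrow> R (l - m)" using resolvent_inverse assms(1) by simp
  then have l: "l = R (l - m)" using assms(2) LIMSEQ_unique by blast
  then show "l \<in> D" using resolvent(1) by metis
  show "A l = m" using A_resolvent[of "l - m"] l[symmetric] by simp
qed

end

locale dissipative_generator =
  fixes D :: "'a::{real_inner, banach} set" and A :: "'a \<Rightarrow> 'a"
  assumes scaled: "c > 0 \<Longrightarrow> m_dissipative D (\<lambda>x. c *\<^sub>R A x)"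
    and dense: "closure D = UNIV"
begin

sublocale m_dissipative D A
  using scaled[of 1] by simp

text \<open>The operator (I - A/(n+1))^(-1), obtained as the resolvent at 1 of the scaled generator;
  \<open>Suc n\<close> keeps the parameter positive.\<close>

definition yosida_res :: "nat \<Rightarrow> 'a \<Rightarrow> 'a" where
  "yosida_res n = resolvent1 D (\<lambda>x. inverse (real (Suc n)) *\<^sub>R A x)"

definition yosida :: "nat \<Rightarrow> 'a \<Rightarrow> 'a" where
  "yosida n y = real (Suc n) *\<^sub>R (yosida_res n y - y)"

lemma scaled_n: "m_dissipative D (\<lambda>x. inverse (real (Suc n)) *\<^sub>R A x)"
  by (rule scaled) simp

lemma yosida_res_in: "yosida_res n y \<in> D"
  unfolding yosida_res_def by (rule m_dissipative.resolvent[OF scaled_n])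

lemma norm_yosida_res: "norm (yosida_res n y) \<le> norm y"
  unfolding yosida_res_def by (rule m_dissipative.norm_resolvent[OF scaled_n])

lemma bounded_linear_yosida_res: "bounded_linear (yosida_res n)"
  unfolding yosida_res_def by (rule m_dissipative.bounded_linear_resolvent[OF scaled_n])

lemma bounded_linear_yosida: "bounded_linear (yosida n)"
  unfolding yosida_def
  by (intro bounded_linear_scaleR_right bounded_linear_compose[OF bounded_linear_scaleR_right]
      bounded_linear_sub bounded_linear_yosida_res bounded_linear_ident)

lemma yosida_eq: "yosida n y = A (yosida_res n y)"
  unfolding yosida_def yosida_res_def m_dissipative.A_resolvent[OF scaled_n, symmetric] by simp

lemma yosida_res_eq: "yosida_res n y - y = inverse (real (Suc n)) *\<^sub>R yosida n y"
  by (simp add: yosida_def)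

lemma yosida_dom: assumes "x \<in> D" shows "yosida n x = yosida_res n (A x)"
proof -
  have "yosida_res n (x - inverse (real (Suc n)) *\<^sub>R A x) = x"
    unfolding yosida_res_def by (rule m_dissipative.resolvent_inverse[OF scaled_n assms])
  then have "yosida_res n x - x = inverse (real (Suc n)) *\<^sub>R yosida_res n (A x)"
    using bounded_linear_yosida_res[of n] by (simp add: linear_simps algebra_simps)
  then show ?thesis by (simp add: yosida_def)
qed

lemma norm_yosida_dom: "x \<in> D \<Longrightarrow> norm (yosida n x) \<le> norm (A x)"
  by (simp add: yosida_dom norm_yosida_res)

text \<open>\<open>y\<close> is split into \<open>yosida_res n y\<close>, on which \<open>A\<close>
  is dissipative, and a negative multiple of \<open>yosida n y\<close> itself.\<close>

lemma yosida_dissip: "inner (yosida n y) y \<le> 0"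
proof -
  have "y = yosida_res n y - inverse (real (Suc n)) *\<^sub>R yosida n y"
    using yosida_res_eq[of n y] by (simp add: algebra_simps)
  then have "inner (yosida n y) y = inner (yosida n y) (yosida_res n y) - inverse (real (Suc n)) * inner (yosida n y) (yosida n y)"
    by (metis inner_diff_right inner_scaleR_right)
  also have "\<dots> \<le> 0"
  proof -
    have "0 \<le> inverse (real (Suc n)) * inner (yosida n y) (yosida n y)"
      by (intro mult_nonneg_nonneg inner_ge_zero) simp
    then show ?thesis using dissip[OF yosida_res_in[of n y]] by (simp only: yosida_eq)
  qed
  finally show ?thesis .
qed

text \<open>Two different approximations are together almost dissipative: the contribution of the
  two points in \<open>D\<close> has a sign, and the remaining parts of \<open>y\<close> and
  \<open>z\<close> are small multiples of the approximations. This drives the Cauchy estimate for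
  the approximating evolutions.\<close>

lemma yosida_pair:
  assumes "norm (yosida n y) \<le> M" "norm (yosida m z) \<le> M"
  shows "inner (yosida n y - yosida m z) (y - z) \<le> 2 * M\<^sup>2 * (inverse (real (Suc n)) + inverse (real (Suc m)))"
proof -
  let ?p = "yosida n y" and ?q = "yosida m z"
  let ?n = "inverse (real (Suc n))" and ?m = "inverse (real (Suc m))"
  let ?d = "yosida_res n y - yosida_res m z"
  have M: "M \<ge> 0" using norm_ge_zero assms(1) by (rule order_trans)
  have "y - z = ?d + (?m *\<^sub>R ?q - ?n *\<^sub>R ?p)"
    using yosida_res_eq[of n y] yosida_res_eq[of m z] by (simp add: algebra_simps)
  then have "inner (?p - ?q) (y - z) = inner (?p - ?q) ?d + inner (?p - ?q) (?m *\<^sub>R ?q - ?n *\<^sub>R ?p)"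
    by (simp only: inner_add_right)
  also have "inner (?p - ?q) ?d \<le> 0"
    using dissip[of ?d] A_diff[OF yosida_res_in yosida_res_in] subspace_diff[OF sub yosida_res_in yosida_res_in]
    by (simp add: yosida_eq)
  also have "inner (?p - ?q) (?m *\<^sub>R ?q - ?n *\<^sub>R ?p) \<le> norm (?p - ?q) * norm (?m *\<^sub>R ?q - ?n *\<^sub>R ?p)"
    by (rule norm_cauchy_schwarz)
  also have "\<dots> \<le> (2 * M) * (?m * M + ?n * M)"
  proof (rule mult_mono)
    show "norm (?p - ?q) \<le> 2 * M" using norm_triangle_ineq4[of ?p ?q] assms by linarith
    have "norm (?m *\<^sub>R ?q - ?n *\<^sub>R ?p) \<le> ?m * norm ?q + ?n * norm ?p"
      using norm_triangle_ineq4[of "?m *\<^sub>R ?q" "?n *\<^sub>R ?p"] by simp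
    also have "\<dots> \<le> ?m * M + ?n * M" using assms by (intro add_mono mult_left_mono) auto
    finally show "norm (?m *\<^sub>R ?q - ?n *\<^sub>R ?p) \<le> ?m * M + ?n * M" .
  qed (use M in auto)
  finally show ?thesis by (simp add: power2_eq_square algebra_simps)
qed

lemma inverse_Suc_tendsto: "(\<lambda>n. inverse (real (Suc n)) * c) \<longlonglongrightarrow> 0"
  using tendsto_mult_right[OF LIMSEQ_inverse_real_of_nat, of c] by (simp add: mult.commute)

lemma dense_tendsto:
  fixes F :: "nat \<Rightarrow> 'a \<Rightarrow> 'b::real_normed_vector"
  assumes lin: "\<And>n. bounded_linear (F n)" "bounded_linear F0"
    and bd: "\<And>n z. norm (F n z) \<le> C * norm z" and D: "\<And>x. x \<in> D \<Longrightarrow> (\<lambda>n. F n x) \<longlonglongrightarrow> F0 x"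
  shows "(\<lambda>n. F n z) \<longlonglongrightarrow> F0 z"
proof (rule LIMSEQ_I)
  fix e :: real assume e: "e > 0"
  have C: "norm (F n z) \<le> \<bar>C\<bar> * norm z" for n z
    by (rule order_trans[OF bd mult_right_mono]) auto
  obtain K where K: "K > 0" "\<And>z. norm (F0 z) \<le> norm z * K" using bounded_linear.pos_bounded[OF lin(2)] by blast
  let ?d = "e / (3 * (\<bar>C\<bar> + K))"
  have pos: "\<bar>C\<bar> + K > 0" using K by simp
  obtain x where x: "x \<in> D" "dist x z < ?d"
    using dense e pos closure_approachable[of z D] by (metis UNIV_I divide_pos_pos mult_pos_pos zero_less_numeral)
  obtain N where N: "\<And>n. n \<ge> N \<Longrightarrow> norm (F n x - F0 x) < e / 3"
    using LIMSEQ_D[OF D[OF x(1)], of "e/3"] e by auto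
  show "\<exists>no. \<forall>n\<ge>no. norm (F n z - F0 z) < e"
  proof (intro exI allI impI)
    fix n assume n: "n \<ge> N"
    have "F n z - F0 z = (F n x - F0 x) + (F n (z - x) - F0 (z - x))"
      using lin(1)[of n] lin(2) by (simp add: linear_simps)
    then have "norm (F n z - F0 z) \<le> norm (F n x - F0 x) + (norm (F n (z - x)) + norm (F0 (z - x)))"
      by (smt (verit) norm_triangle_ineq norm_triangle_ineq4)
    also have "\<dots> < e/3 + (\<bar>C\<bar> * norm (z - x) + norm (z - x) * K)"
      using N[OF n] C[of n "z - x"] K(2)[of "z - x"] by linarith
    also have "\<bar>C\<bar> * norm (z - x) + norm (z - x) * K = (\<bar>C\<bar> + K) * norm (z - x)" by (simp add: algebra_simps)
    also have "(\<bar>C\<bar> + K) * norm (z - x) \<le> (\<bar>C\<bar> + K) * ?d"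
      using x(2) pos by (intro mult_left_mono) (auto simp: dist_norm norm_minus_commute)
    also have "\<dots> = e/3" using pos by (simp add: divide_simps)
    finally show "norm (F n z - F0 z) < e" using e by linarith
  qed
qed

lemma yosida_res_tendsto: "(\<lambda>n. yosida_res n y) \<longlonglongrightarrow> y"
proof (rule dense_tendsto[where ?F0.0 = "\<lambda>y. y" and C = 1])
  fix x assume x: "x \<in> D"
  have "norm (yosida_res n x - x) \<le> inverse (real (Suc n)) * norm (A x)" for n
    unfolding yosida_res_eq using norm_yosida_dom[OF x] by (simp add: mult_left_mono)
  then show "(\<lambda>n. yosida_res n x) \<longlonglongrightarrow> x"
    by (intro LIM_zero_cancel[OF Lim_null_comparison[OF always_eventually inverse_Suc_tendsto]] allI)
qed (use norm_yosida_res bounded_linear_yosida_res bounded_linear_ident in auto)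

lemma yosida_tendsto: "x \<in> D \<Longrightarrow> (\<lambda>n. yosida n x) \<longlonglongrightarrow> A x"
  using yosida_res_tendsto by (simp add: yosida_dom)

text \<open>The right side stays bounded and converges as \<open>n\<close> grows for every
  \<open>y\<close>, although \<open>yosida n y\<close> itself is only controlled for
  \<open>y\<close> in \<open>D\<close>. This is why the limit equation can be read in the
  extrapolation space.\<close>

lemma resolvent_yosida: "R (yosida n y) = R (yosida_res n y) - yosida_res n y"
proof -
  have "R (yosida_res n y - A (yosida_res n y)) = yosida_res n y" by (rule resolvent_inverse[OF yosida_res_in])
  then show ?thesis using bounded_linear_resolvent by (simp add: yosida_eq linear_simps algebra_simps)
qed

text \<open>Meant for \<open>T\<close> equal to the complex structure: it carries complex linearity
  to the approximations.\<close>

lemma yosida_commute: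
  assumes "linear T" "\<And>x. x \<in> D \<Longrightarrow> T x \<in> D \<and> A (T x) = T (A x)"
  shows "yosida n (T y) = T (yosida n y)"
proof -
  have "yosida_res n (T y) = T (yosida_res n y)"
    unfolding yosida_res_def using assms by (intro m_dissipative.resolvent_commute[OF scaled_n]) (auto simp: linear_scale)
  then show ?thesis by (simp add: yosida_def linear_scale[OF assms(1)] linear_diff[OF assms(1)])
qed

end

section \<open>Generators of contraction semigroups are densely defined and m-dissipative\<close>

context
  fixes ci :: "'a::{real_inner, banach} \<Rightarrow> 'a" and S D A
  assumes c0: "c0_semigroup ci S" and contr: "\<And>t x. t \<ge> 0 \<Longrightarrow> norm (S t x) \<le> norm x"
    and gen: "sg_generator S D A"
begin

lemma semigroup_linear: "t \<ge> 0 \<Longrightarrow> bounded_linear (S t)"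
  and semigroup_commute: "t \<ge> 0 \<Longrightarrow> S t (ci x) = ci (S t x)"
  and semigroup_add: "t \<ge> 0 \<Longrightarrow> s \<ge> 0 \<Longrightarrow> S (t + s) x = S t (S s x)"
  and semigroup_0: "S 0 x = x" and semigroup_cont: "continuous_on {0..} (\<lambda>t. S t x)"
  using c0 by (auto simp: c0_semigroup_def cblin_def)

lemma generator_iff: "x \<in> D \<and> A x = y \<longleftrightarrow> ((\<lambda>h. (S h x - x) /\<^sub>R h) \<longlongrightarrow> y) (at_right 0)"
  using gen tendsto_unique[OF trivial_limit_at_right_real] unfolding sg_generator_def by blast

text \<open>Truncated Laplace transform of an orbit: \<open>S h\<close> shifts the window of
  integration and rescales by \<open>exp (c * h)\<close>, so the difference quotient becomes an
  ordinary derivative at 0. The value \<open>c = 0\<close> gives density of \<open>D\<close>,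
  positive \<open>c\<close> gives the range condition, and truncation avoids improper
  integrals.\<close>

lemma laplace_in_domain:
  fixes c :: real and y :: 'a
  assumes T: "T > 0"
  defines "g \<equiv> \<lambda>s. exp (- c * s) *\<^sub>R S s y"
  shows "integral {0..T} g \<in> D \<and> A (integral {0..T} g) = c *\<^sub>R integral {0..T} g - y + exp (- c * T) *\<^sub>R S T y"
  unfolding generator_iff
proof -
  have gc: "continuous_on {a..b} g" if "a \<ge> 0" for a b
    unfolding g_def using continuous_on_subset[OF semigroup_cont, of "{a..b}"] that
    by (intro continuous_intros) auto
  define G where "G u = integral {0..u} g" for u
  have G: "(G has_vector_derivative g u) (at u within {0..T + 1})" if "u \<in> {0..T+1}" for u
    unfolding G_def by (rule integral_has_vector_derivative[OF gc that]) simp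
  \<comment> \<open>This is \<open>S h (G T)\<close> after the shift of the window from
    \<open>{0..T}\<close> to \<open>{h..T + h}\<close>.\<close>
  define \<phi> where "\<phi> h = exp (c * h) *\<^sub>R (G (T + h) - G h)" for h
  have SG: "S h (G T) = \<phi> h" if h: "h \<in> {0..1}" for h
  proof -
    have h0: "h \<ge> 0" using h by simp
    have "(g has_integral (G (T + h) - G h)) {h..T + h}"
    proof -
      have "G h + integral {h..T + h} g = G (T + h)"
        unfolding G_def by (rule Henstock_Kurzweil_Integration.integral_combine) (use h T gc in \<open>auto intro!: integrable_continuous_interval\<close>)
      moreover have "g integrable_on {h..T + h}" using gc[OF h0] by (rule integrable_continuous_interval)
      ultimately show ?thesis by (simp add: has_integral_iff algebra_simps)
    qed
    from has_integral_affinity'[of g _ h "T + h" 1 h] this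
    have 1: "((\<lambda>s. g (s + h)) has_integral (G (T + h) - G h)) {0..T}" by simp
    have 2: "((\<lambda>s. exp (c * h) *\<^sub>R g (s + h)) has_integral \<phi> h) {0..T}"
      unfolding \<phi>_def by (rule has_integral_cmul[OF 1])
    have "exp (c * h) *\<^sub>R g (s + h) = S h (g s)" if "s \<in> {0..T}" for s
    proof -
      have "S h (g s) = exp (- c * s) *\<^sub>R S (h + s) y"
        using semigroup_linear[OF h0] semigroup_add[OF h0, of s y] that by (simp add: g_def linear_simps)
      moreover have "exp (c * h) * exp (- c * (s + h)) = exp (- c * s)" by (simp add: exp_add[symmetric] algebra_simps)
      ultimately show ?thesis by (simp add: g_def add.commute)
    qed
    then have "((\<lambda>s. S h (g s)) has_integral \<phi> h) {0..T}" by (rule has_integral_eq[OF _ 2])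
    moreover have "(g has_integral G T) {0..T}"
      unfolding G_def using gc by (intro integrable_integral integrable_continuous_interval) simp
    then have "((\<lambda>s. S h (g s)) has_integral S h (G T)) {0..T}"
      using has_integral_linear[OF _ semigroup_linear[OF h0]] by (simp add: o_def)
    ultimately show ?thesis by (rule has_integral_unique[symmetric])
  qed
  have "(\<phi> has_vector_derivative (c *\<^sub>R G T - y + exp (- c * T) *\<^sub>R S T y)) (at 0 within {0..1})"
  proof -
    have "((\<lambda>h. T + h) has_real_derivative 1) (at 0 within {0..1})" by (auto intro!: derivative_eq_intros)
    moreover have "(G has_vector_derivative g (T + 0)) (at (T + 0) within (\<lambda>h. T + h) ` {0..1})"
      using G[of T] T by (auto intro: has_vector_derivative_within_subset)
    ultimately have "(G \<circ> (\<lambda>h. T + h) has_vector_derivative 1 *\<^sub>R g (T + 0)) (at 0 within {0..1})"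
      by (intro vector_diff_chain_within) (auto simp: has_real_derivative_iff_has_vector_derivative)
    then have 1: "((\<lambda>h. G (T + h)) has_vector_derivative g T) (at 0 within {0..1})" by (simp add: o_def)
    have 2: "(G has_vector_derivative g 0) (at 0 within {0..1})"
      using G[of 0] T by (auto intro: has_vector_derivative_within_subset)
    have 3: "((\<lambda>h. exp (c * h)) has_real_derivative c) (at 0 within {0..1})" by (auto intro!: derivative_eq_intros)
    have "(\<phi> has_vector_derivative (exp (c * 0) *\<^sub>R (g T - g 0) + c *\<^sub>R (G (T + 0) - G 0))) (at 0 within {0..1})"
      unfolding \<phi>_def by (intro has_vector_derivative_scaleR has_vector_derivative_diff 1 2 3)
    then show ?thesis by (simp add: g_def G_def semigroup_0 algebra_simps)
  qed
  then have "((\<lambda>h. (\<phi> h - \<phi> 0) /\<^sub>R (h - 0)) \<longlongrightarrow> c *\<^sub>R G T - y + exp (- c * T) *\<^sub>R S T y) (at_right 0)"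
    unfolding has_vector_derivative_quotient by (simp add: at_within_Icc_at_right)
  then have "((\<lambda>h. (S h (G T) - G T) /\<^sub>R h) \<longlongrightarrow> c *\<^sub>R G T - y + exp (- c * T) *\<^sub>R S T y) (at_right 0)"
  proof (rule Lim_transform_eventually)
    have "eventually (\<lambda>h::real. h \<in> {0<..<1}) (at_right 0)" by (rule eventually_at_right_real) simp
    then show "\<forall>\<^sub>F h in at_right 0. (\<phi> h - \<phi> 0) /\<^sub>R (h - 0) = (S h (G T) - G T) /\<^sub>R h"
      by eventually_elim (simp add: SG, simp add: \<phi>_def G_def)
  qed
  then show "((\<lambda>h. (S h (integral {0..T} g) - integral {0..T} g) /\<^sub>R h) \<longlongrightarrow>
     c *\<^sub>R integral {0..T} g - y + exp (- c * T) *\<^sub>R S T y) (at_right 0)"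
    unfolding G_def .
qed

text \<open>The averages of \<open>S s y\<close> over \<open>{0..u}\<close> lie in \<open>D\<close>
  and tend to \<open>y\<close> as \<open>u\<close> decreases to 0.\<close>

lemma generator_dense: "closure D = UNIV"
proof -
  have "y \<in> closure D" for y
  proof -
    define G where "G u = integral {0..u} (\<lambda>s. S s y)" for u
    have "(G has_vector_derivative S 0 y) (at 0 within {0..1})"
      unfolding G_def by (rule integral_has_vector_derivative[OF continuous_on_subset[OF semigroup_cont]]) auto
    then have lim: "((\<lambda>u. G u /\<^sub>R u) \<longlongrightarrow> y) (at_right 0)"
      unfolding has_vector_derivative_quotient by (simp add: at_within_Icc_at_right semigroup_0 G_def)
    have GD: "G u \<in> D" if "u > 0" for u
      using laplace_in_domain[OF that, of 0 y] by (simp add: G_def)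
    have scale: "a *\<^sub>R x \<in> D" if "x \<in> D" for a x
    proof -
      have "((\<lambda>h. (S h x - x) /\<^sub>R h) \<longlongrightarrow> A x) (at_right 0)" using generator_iff that by blast
      then have "((\<lambda>h. a *\<^sub>R ((S h x - x) /\<^sub>R h)) \<longlongrightarrow> a *\<^sub>R A x) (at_right 0)" by (intro tendsto_intros)
      then have "((\<lambda>h. (S h (a *\<^sub>R x) - a *\<^sub>R x) /\<^sub>R h) \<longlongrightarrow> a *\<^sub>R A x) (at_right 0)"
        by (rule Lim_transform_eventually)
          (auto simp: eventually_at_filter scaleR_diff_right linear_simps(5)[OF semigroup_linear] mult.commute)
      then show ?thesis using generator_iff by blast
    qed
    show ?thesis
    proof (rule Lim_in_closed_set[OF closed_closure _ _ lim])
      show "\<forall>\<^sub>F u in at_right 0. G u /\<^sub>R u \<in> closure D"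
        using eventually_at_right_less[of "0::real"]
        by eventually_elim (use GD scale closure_subset in blast)
    qed simp
  qed
  then show ?thesis by auto
qed

lemma generator_dissipative: "dissipative_generator D A"
proof
  fix c :: real assume c: "c > 0"
  have at: "eventually (\<lambda>h::real. h > 0) (at_right 0)" by (rule eventually_at_right_less)
  have lim: "((\<lambda>h. (S h x - x) /\<^sub>R h) \<longlongrightarrow> A x) (at_right 0)" if "x \<in> D" for x
    using that generator_iff by blast
  have add: "x + y \<in> D \<and> A (x + y) = A x + A y" if "x \<in> D" "y \<in> D" for x y
    unfolding generator_iff
  proof (rule Lim_transform_eventually[OF tendsto_add[OF lim[OF that(1)] lim[OF that(2)]]])
    show "\<forall>\<^sub>F h in at_right 0. (S h x - x) /\<^sub>R h + (S h y - y) /\<^sub>R h = (S h (x + y) - (x + y)) /\<^sub>R h"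
      using at by eventually_elim (simp add: linear_simps(1)[OF semigroup_linear] algebra_simps)
  qed
  have scale: "a *\<^sub>R x \<in> D \<and> A (a *\<^sub>R x) = a *\<^sub>R A x" if "x \<in> D" for a x
    unfolding generator_iff
  proof (rule Lim_transform_eventually[OF tendsto_scaleR[OF tendsto_const lim[OF that]]])
    show "\<forall>\<^sub>F h in at_right 0. a *\<^sub>R ((S h x - x) /\<^sub>R h) = (S h (a *\<^sub>R x) - a *\<^sub>R x) /\<^sub>R h"
      using at by eventually_elim (simp add: linear_simps(5)[OF semigroup_linear] algebra_simps)
  qed
  have zero: "0 \<in> D"
  proof -
    obtain x where "x \<in> D" using generator_dense by fastforce
    then show ?thesis using scale[of x 0] by simp
  qed
  show "subspace D" unfolding subspace_def using zero add scale by auto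
  show "c *\<^sub>R A (x + y) = c *\<^sub>R A x + c *\<^sub>R A y" if "x \<in> D" "y \<in> D" for x y
    using add[OF that] by (simp add: scaleR_add_right)
  show "c *\<^sub>R A (a *\<^sub>R x) = a *\<^sub>R c *\<^sub>R A x" if "x \<in> D" for a x
    using scale[OF that] by (simp add: mult.commute)
  show "inner (c *\<^sub>R A x) x \<le> 0" if "x \<in> D" for x
  proof -
    have "inner (A x) x \<le> 0"
    proof (rule tendsto_upperbound[OF tendsto_inner[OF lim[OF that] tendsto_const]])
      show "\<forall>\<^sub>F h in at_right 0. inner ((S h x - x) /\<^sub>R h) x \<le> 0" using at
      proof eventually_elim
        case (elim h)
        have "inner (S h x) x \<le> norm (S h x) * norm x" by (rule norm_cauchy_schwarz)
        also have "\<dots> \<le> norm x * norm x" using contr[of h x] elim by (intro mult_right_mono) auto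
        finally have "inner (S h x - x) x \<le> 0" by (simp add: inner_diff_left dot_square_norm power2_eq_square)
        then show ?case using elim by (simp add: mult_nonneg_nonpos)
      qed
    qed simp
    then show ?thesis using c by (simp add: mult_nonneg_nonpos)
  qed
  show "\<exists>x\<in>D. x - c *\<^sub>R A x = y" for y
  proof -
    let ?l = "inverse c"
    \<comment> \<open>Truncation at time 1 leaves the boundary term
      \<open>exp (- ?l) *\<^sub>R S 1 w\<close>. Contractivity makes \<open>?f\<close> a strict
      contraction, and its fixed point \<open>w\<close> absorbs this term, so that the transform
      \<open>x\<close> of \<open>w\<close> satisfies
      \<open>?l *\<^sub>R x - A x = ?l *\<^sub>R y\<close>.\<close>
    let ?f = "\<lambda>w. ?l *\<^sub>R y + exp (- ?l) *\<^sub>R S 1 w"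
    have l: "?l > 0" using c by simp
    have "\<exists>!w. ?f w = w"
    proof (rule banach_fix_type[where c = "exp (- ?l)"])
      show "\<forall>v w. dist (?f v) (?f w) \<le> exp (- ?l) * dist v w"
      proof (intro allI)
        fix v w
        have "?f v - ?f w = exp (- ?l) *\<^sub>R S 1 (v - w)"
          using semigroup_linear[of 1] by (simp add: linear_simps scaleR_diff_right)
        then show "dist (?f v) (?f w) \<le> exp (- ?l) * dist v w"
          using contr[of 1 "v - w"] by (simp add: dist_norm mult_left_mono)
      qed
    qed (use l in auto)
    then obtain w where w: "?l *\<^sub>R y + exp (- ?l) *\<^sub>R S 1 w = w" by blast
    define x where "x = integral {0..1} (\<lambda>s. exp (- ?l * s) *\<^sub>R S s w)"
    have "x \<in> D" and "A x = ?l *\<^sub>R x - w + exp (- ?l * 1) *\<^sub>R S 1 w"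
      using laplace_in_domain[of 1 ?l w] by (auto simp: x_def)
    moreover have "exp (- ?l) *\<^sub>R S 1 w = w - ?l *\<^sub>R y" using w by (metis add_diff_cancel_left')
    ultimately have "A x = ?l *\<^sub>R x - ?l *\<^sub>R y" by simp
    then have "c *\<^sub>R A x = x - y" using c by (simp add: scaleR_diff_right)
    then show ?thesis using \<open>x \<in> D\<close> by (intro bexI[of _ x]) auto
  qed
qed (rule generator_dense)

lemma generator_commute:
  assumes "x \<in> D" and ci: "bounded_linear ci"
  shows "ci x \<in> D \<and> A (ci x) = ci (A x)"
  unfolding generator_iff
proof (rule Lim_transform_eventually)
  show "((\<lambda>h. ci ((S h x - x) /\<^sub>R h)) \<longlongrightarrow> ci (A x)) (at_right 0)"
    using assms(1) generator_iff by (intro bounded_linear.tendsto[OF ci]) blast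
  show "\<forall>\<^sub>F h in at_right 0. ci ((S h x - x) /\<^sub>R h) = (S h (ci x) - ci x) /\<^sub>R h"
    using eventually_at_right_less[of "0::real"]
    by eventually_elim (use ci in \<open>simp add: linear_simps semigroup_commute\<close>)
qed

end

lemma bounded_linear_lim:
  fixes F :: "nat \<Rightarrow> 'a::banach \<Rightarrow> 'b::real_normed_vector"
  assumes lin: "\<And>n. bounded_linear (F n)" and lim: "\<And>z. (\<lambda>n. F n z) \<longlonglongrightarrow> F0 z"
  shows "bounded_linear F0"
proof -
  have "\<exists>C. \<forall>i\<in>UNIV. norm (F i z) \<le> C" for z
    using convergent_imp_Bseq[of "\<lambda>n. F n z"] lim by (auto simp: convergent_def Bseq_def)
  then obtain C where C: "\<And>n z. norm (F n z) \<le> C * norm z"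
    using banach_steinhaus[of UNIV F] lin by auto
  show ?thesis
  proof (rule bounded_linear_intro[where K = C])
    fix x y :: 'a and r :: real
    have "(\<lambda>n. F n (x + y)) \<longlonglongrightarrow> F0 x + F0 y"
      using tendsto_add[OF lim[of x] lim[of y]] lin by (simp add: linear_simps)
    then show "F0 (x + y) = F0 x + F0 y" using lim LIMSEQ_unique by blast
    have "(\<lambda>n. F n (r *\<^sub>R x)) \<longlonglongrightarrow> r *\<^sub>R F0 x"
      using tendsto_scaleR[OF tendsto_const lim[of x], of r] lin by (simp add: linear_simps)
    then show "F0 (r *\<^sub>R x) = r *\<^sub>R F0 x" using lim LIMSEQ_unique by blast
    show "norm (F0 x) \<le> norm x * C"
      by (rule LIMSEQ_le_const2[OF tendsto_norm[OF lim]]) (use C in \<open>auto simp: mult.commute\<close>)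
  qed
qed

section \<open>Energy estimates\<close>

lemma linear_differential_inequality:
  fixes E :: "real \<Rightarrow> real"
  assumes ab: "a \<le> b" and c: "c \<ge> 0" "\<delta> \<ge> 0"
    and der: "\<And>s. s \<in> {a..b} \<Longrightarrow> (E has_real_derivative E' s) (at s within {a..b})"
    and le: "\<And>s. s \<in> {a..b} \<Longrightarrow> E' s \<le> c * E s + \<delta>"
  shows "E b \<le> (E a + \<delta> * (b - a)) * exp (c * (b - a))"
proof (cases "a = b")
  case False
  then have ab: "a < b" using ab by simp
  \<comment> \<open>Integrating factor. Subtracting \<open>\<delta> * (s - a)\<close> suffices
    because the exponential factor in front of \<open>\<delta>\<close> is at most 1.\<close>
  define g where "g s = exp (- c * (s - a)) * E s - \<delta> * (s - a)" for s
  have dg: "(g has_real_derivative (- c * exp (- c * (s - a)) * E s + exp (- c * (s - a)) * E' s - \<delta>)) (at s within {a..b})"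
    if "s \<in> {a..b}" for s
    unfolding g_def by (rule derivative_eq_intros der[OF that] refl)+ (simp add: algebra_simps)
  have "g b \<le> g a"
  proof (rule DERIV_nonpos_imp_decreasing_open[OF less_imp_le[OF ab]])
    show "continuous_on {a..b} g"
      using dg by (meson DERIV_continuous continuous_on_eq_continuous_within)
    fix s assume s: "a < s" "s < b"
    have "(g has_real_derivative (- c * exp (- c * (s - a)) * E s + exp (- c * (s - a)) * E' s - \<delta>)) (at s)"
      using dg[of s] s at_within_Icc_at[OF s] by simp
    moreover have "exp (- c * (s - a)) * E' s \<le> exp (- c * (s - a)) * (c * E s + \<delta>)"
      using le[of s] s by (intro mult_left_mono) auto
    moreover have "exp (- c * (s - a)) * \<delta> \<le> 1 * \<delta>"
      using c s by (intro mult_right_mono) auto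
    ultimately show "\<exists>y. (g has_real_derivative y) (at s) \<and> y \<le> 0"
      by (intro exI conjI) (auto simp: algebra_simps)
  qed
  then have "exp (- c * (b - a)) * E b \<le> E a + \<delta> * (b - a)" by (simp add: g_def)
  then have "exp (c * (b - a)) * (exp (- c * (b - a)) * E b) \<le> exp (c * (b - a)) * (E a + \<delta> * (b - a))"
    by (rule mult_left_mono) simp
  moreover have "exp (c * (b - a)) * (exp (- c * (b - a)) * E b) = E b"
    using exp_minus_inverse[of "c * (b - a)"] by (simp only: mult.assoc[symmetric] minus_mult_left)
  ultimately have "E b \<le> exp (c * (b - a)) * (E a + \<delta> * (b - a))" by (simp only:)
  then show ?thesis by (simp only: mult.commute)
qed simp

text \<open>In the split difference quotient the increment of \<open>y\<close> is acted on by the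
  moving operator \<open>P r\<close>; strong convergence against a converging vector handles it.
  Differentiability of \<open>P\<close> enters only at the single vector \<open>y s\<close>.\<close>

lemma strong_product_derivative:
  fixes P :: "real \<Rightarrow> 'a::banach \<Rightarrow> 'a"
  assumes P: "strongly_cont J P" "bounded_linear (P s)" and s: "s \<in> J" and S: "S \<subseteq> J"
    and der: "((\<lambda>t. P t (y s)) has_vector_derivative d) (at s within J)"
    and y: "(y has_vector_derivative y') (at s within S)"
  shows "((\<lambda>s. P s (y s)) has_vector_derivative P s y' + d) (at s within S)"
  unfolding has_vector_derivative_quotient
proof -
  have "((\<lambda>r. P r ((y r - y s) /\<^sub>R (r - s))) \<longlongrightarrow> P s y') (at s within S)"
  proof (rule strong_tendsto_within[where F = P and ?F0.0 = "P s"])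
    show "bounded_linear (P t)" if "t \<in> S" for t using strongly_contD(1)[OF P(1)] that S by auto
    show "((\<lambda>t. P t z) \<longlongrightarrow> P s z) (at s within S)" for z
      using strongly_contD(2)[OF P(1), of z] s S unfolding continuous_on_def
      by (meson tendsto_within_subset)
  qed (use y P(2) in \<open>auto simp: has_vector_derivative_quotient\<close>)
  moreover have "((\<lambda>r. (P r (y s) - P s (y s)) /\<^sub>R (r - s)) \<longlongrightarrow> d) (at s within S)"
    using has_vector_derivative_within_subset[OF der S] by (simp add: has_vector_derivative_quotient)
  ultimately have "((\<lambda>r. P r ((y r - y s) /\<^sub>R (r - s)) + (P r (y s) - P s (y s)) /\<^sub>R (r - s)) \<longlongrightarrow> P s y' + d) (at s within S)"
    by (rule tendsto_add)
  then show "((\<lambda>r. (P r (y r) - P s (y s)) /\<^sub>R (r - s)) \<longlongrightarrow> P s y' + d) (at s within S)"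
  proof (rule Lim_transform_within[OF _ zero_less_one])
    fix r assume "r \<in> S"
    then have "bounded_linear (P r)" using strongly_contD(1)[OF P(1)] S by auto
    then show "P r ((y r - y s) /\<^sub>R (r - s)) + (P r (y s) - P s (y s)) /\<^sub>R (r - s) = (P r (y r) - P s (y s)) /\<^sub>R (r - s)"
      by (simp add: linear_simps scaleR_add_right[symmetric] scaleR_diff_right[symmetric])
  qed
qed

text \<open>The complex structure is absent here: the energy estimates only use the real inner
  product. Complex linearity is recovered at the end from \<open>Yl_commute\<close>.\<close>

locale evolution_problem = dissipative_generator D A
  for D :: "'a::{real_inner, banach} set" and A +
  fixes J :: "real set" and P Pinv Pd :: "real \<Rightarrow> 'a \<Rightarrow> 'a"
  assumes J: "is_interval J" "closed J"
    and P: "strongly_cont J P" and Pinv: "strongly_cont J Pinv" and Pd: "strongly_cont J Pd"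
    and P_sa: "t \<in> J \<Longrightarrow> inner (P t x) y = inner x (P t y)"
    and P_nonneg: "t \<in> J \<Longrightarrow> 0 \<le> inner (P t x) x"
    and P_Pinv: "t \<in> J \<Longrightarrow> P t (Pinv t x) = x" and Pinv_P: "t \<in> J \<Longrightarrow> Pinv t (P t x) = x"
    and P_deriv: "t \<in> J \<Longrightarrow> ((\<lambda>t. P t z) has_vector_derivative Pd t z) (at t within J)"
begin

abbreviation Jm :: "real \<Rightarrow> real set" where "Jm m \<equiv> J \<inter> {-m..m}"

definition K :: "real \<Rightarrow> 'a \<Rightarrow> 'a" where "K t z = Pinv t (Pd t z)"

text \<open>Bounded approximation of \<open>A P + Q\<close>; not to be confused with the averages
  \<open>Gn\<close> of \<open>G\<close>.\<close>

definition G_n :: "nat \<Rightarrow> (real \<Rightarrow> 'a \<Rightarrow> 'a) \<Rightarrow> real \<Rightarrow> 'a \<Rightarrow> 'a" where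
  "G_n n Q t z = yosida n (P t z) + Q t z"

definition Y :: "nat \<Rightarrow> (real \<Rightarrow> 'a \<Rightarrow> 'a) \<Rightarrow> real \<Rightarrow> real \<Rightarrow> 'a \<Rightarrow> 'a" where
  "Y n Q = (SOME U. bounded_evolution J (G_n n Q) U)"

lemma K_strongly_cont: "strongly_cont J K"
  using strongly_cont_compose[OF Pinv Pd] by (simp add: K_def[abs_def])

lemma P_K: "t \<in> J \<Longrightarrow> P t (K t z) = Pd t z"
  by (simp add: K_def P_Pinv)

lemma G_n_strongly_cont: "strongly_cont J Q \<Longrightarrow> strongly_cont J (G_n n Q)"
  unfolding G_n_def[abs_def]
  by (intro strongly_cont_add(1) strongly_cont_compose[OF strongly_cont_const[OF bounded_linear_yosida] P])

lemma Y: "strongly_cont J Q \<Longrightarrow> bounded_evolution J (G_n n Q) (Y n Q)"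
  unfolding Y_def using bounded_evolution_exists[OF J G_n_strongly_cont] by (rule someI_ex)

context
  fixes Q :: "real \<Rightarrow> 'a \<Rightarrow> 'a" assumes Q: "strongly_cont J Q"
begin

lemmas Y_evol = bounded_evolution_strongly_cont[OF J G_n_strongly_cont[OF Q] Y[OF Q]]
  bounded_evolution_linear[OF J G_n_strongly_cont[OF Q] Y[OF Q]]
  bounded_evolution_refl[OF J G_n_strongly_cont[OF Q] Y[OF Q]]
  bounded_evolution_cocycle[OF J G_n_strongly_cont[OF Q] Y[OF Q]]
  bounded_evolution_section[OF J G_n_strongly_cont[OF Q] Y[OF Q]]
  bounded_evolution_eq[OF J G_n_strongly_cont[OF Q] Y[OF Q]]
lemmas Y_derivative = bounded_evolution_derivative[OF J G_n_strongly_cont[OF Q] Y[OF Q]]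
lemmas Y_compare = bounded_evolution_compare[OF J G_n_strongly_cont[OF Q] Y[OF Q]]
lemmas Y_unique = bounded_evolution_unique[OF J G_n_strongly_cont[OF Q] Y[OF Q]]

end

lemma P_product:
  assumes "s \<in> S" "S \<subseteq> J" "(y has_vector_derivative y') (at s within S)"
  shows "((\<lambda>s. P s (y s)) has_vector_derivative P s y' + Pd s (y s)) (at s within S)"
  using assms strongly_contD(1)[OF P] by (intro strong_product_derivative[OF P _ _ assms(2) P_deriv]) auto

lemma energy_derivative:
  assumes s: "s \<in> S" "S \<subseteq> J" and y: "(y has_vector_derivative y') (at s within S)"
  shows "((\<lambda>s. inner (P s (y s)) (y s)) has_real_derivative inner (Pd s (y s)) (y s) + 2 * inner y' (P s (y s))) (at s within S)"
proof -
  have "((\<lambda>s. inner (P s (y s)) (y s)) has_derivative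
     (\<lambda>h. inner (P s (y s)) (h *\<^sub>R y') + inner (h *\<^sub>R (P s y' + Pd s (y s))) (y s))) (at s within S)"
    using P_product[OF s y] y unfolding has_vector_derivative_def by (rule has_derivative_inner)
  moreover have "(\<lambda>h. inner (P s (y s)) (h *\<^sub>R y') + inner (h *\<^sub>R (P s y' + Pd s (y s))) (y s))
     = (*) (inner (Pd s (y s)) (y s) + 2 * inner y' (P s (y s)))"
    using P_sa[of s y' "y s"] s by (auto simp: fun_eq_iff inner_add_left inner_commute algebra_simps)
  ultimately show ?thesis by (simp add: has_field_derivative_def)
qed

text \<open>Expand \<open>0 \<le> \<langle>P (y - r P\<^sup>-\<^sup>1 y), y - r P\<^sup>-\<^sup>1 y\<rangle>\<close> with \<open>r = 1/k\<close>.\<close>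
lemma energy_lower:
  assumes t: "t \<in> J" and k: "k > 0" "\<And>x. norm (Pinv t x) \<le> k * norm x"
  shows "(norm y)\<^sup>2 \<le> k * inner (P t y) y"
proof -
  let ?r = "inverse k" and ?v = "Pinv t y"
  have lin: "linear (P t)" using strongly_contD(1)[OF P t] bounded_linear.linear by blast
  have "0 \<le> inner (P t (y - ?r *\<^sub>R ?v)) (y - ?r *\<^sub>R ?v)" by (rule P_nonneg[OF t])
  also have "P t (y - ?r *\<^sub>R ?v) = P t y - ?r *\<^sub>R y"
    by (simp add: linear_diff[OF lin] linear_scale[OF lin] P_Pinv[OF t])
  also have "inner (P t y - ?r *\<^sub>R y) (y - ?r *\<^sub>R ?v) = inner (P t y) y - 2 * ?r * inner y y + ?r\<^sup>2 * inner y ?v"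
    using P_sa[OF t, of y ?v] P_Pinv[OF t, of y] by (simp add: inner_diff_left inner_diff_right algebra_simps power2_eq_square)
  also have "?r\<^sup>2 * inner y ?v \<le> ?r\<^sup>2 * (k * inner y y)"
  proof (rule mult_left_mono)
    have "inner y ?v \<le> norm y * norm ?v" by (rule norm_cauchy_schwarz)
    also have "\<dots> \<le> norm y * (k * norm y)" by (intro mult_left_mono k) simp
    finally show "inner y ?v \<le> k * inner y y" by (simp add: dot_square_norm power2_eq_square mult_ac)
  qed simp
  also have "?r\<^sup>2 * (k * inner y y) = ?r * inner y y" using k by (simp add: power2_eq_square)
  finally have "?r * inner y y \<le> inner (P t y) y" by linarith
  then have "k * (?r * inner y y) \<le> k * inner (P t y) y" using k by (intro mult_left_mono) auto
  then show ?thesis using k by (simp add: dot_square_norm mult.assoc[symmetric])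
qed

lemma local_bounds:
  obtains p k d where "p > 0" "k > 0" "d > 0"
    "\<And>s z. s \<in> Jm m \<Longrightarrow> norm (P s z) \<le> p * norm z"
    "\<And>s z. s \<in> Jm m \<Longrightarrow> norm (Pinv s z) \<le> k * norm z"
    "\<And>s z. s \<in> Jm m \<Longrightarrow> norm (Pd s z) \<le> d * norm z"
proof -
  have *: "\<exists>C>0. \<forall>s\<in>Jm m. \<forall>z. norm (F s z) \<le> C * norm z" if F: "strongly_cont J F" for F :: "real \<Rightarrow> 'a \<Rightarrow> 'a"
  proof -
    obtain C where C: "C \<ge> 0" "\<forall>s\<in>Jm m. \<forall>z. norm (F s z) \<le> C * norm z"
      using strongly_cont_bound[OF F compact_exhaustion(1)[OF J]] by blast
    then have "norm (F s z) \<le> (C + 1) * norm z" if "s \<in> Jm m" for s z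
      using that by (intro order_trans[OF C(2)[rule_format, OF that]] mult_right_mono) auto
    then show ?thesis using C(1) by (intro exI[of _ "C + 1"]) auto
  qed
  show ?thesis using *[OF P] *[OF Pinv] *[OF Pd] that by metis
qed

lemma Jm_segment:
  assumes t: "(t, \<tau>) \<in> Delta (Jm m)"
  shows "{\<tau>..t} \<subseteq> Jm m" "(t, \<tau>) \<in> Delta J" "t - \<tau> \<le> 2 * m \<and> \<tau> \<le> t \<and> \<tau> \<in> Jm m \<and> t \<in> Jm m"
  using Delta_subinterval(1)[OF compact_exhaustion(2)[OF J] t] t by (simp_all add: Delta_def subset_iff)

text \<open>The energy \<open>\<langle>P y, y\<rangle>\<close> absorbs the unbounded part because \<open>A\<close> is dissipative, which makes
  the bound independent of \<open>n\<close>.\<close>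
lemma Y_bound:
  assumes \<beta>: "\<beta> \<ge> 0"
  shows "\<exists>C\<ge>0. \<forall>n Q t \<tau> z. strongly_cont J Q \<longrightarrow> (\<forall>s\<in>Jm m. \<forall>z. norm (Q s z) \<le> \<beta> * norm z)
     \<longrightarrow> (t, \<tau>) \<in> Delta (Jm m) \<longrightarrow> norm (Y n Q t \<tau> z) \<le> C * norm z"
proof -
  obtain p k d where b: "p > 0" "k > 0" "d > 0"
    "\<And>s z. s \<in> Jm m \<Longrightarrow> norm (P s z) \<le> p * norm z"
    "\<And>s z. s \<in> Jm m \<Longrightarrow> norm (Pinv s z) \<le> k * norm z"
    "\<And>s z. s \<in> Jm m \<Longrightarrow> norm (Pd s z) \<le> d * norm z"
    by (rule local_bounds[of m]) (rule that)
  \<comment> \<open>\<open>d\<close> stems from the derivative of \<open>P\<close>,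
    \<open>2 * \<beta> * p\<close> from \<open>Q\<close>, and \<open>k\<close> turns the squared
    norm into energy. Since \<open>Q\<close> enters only through \<open>\<beta>\<close>, one
    constant serves a whole sequence of perturbations.\<close>
  define c where "c = (d + 2 * \<beta> * p) * k"
  have c0: "c \<ge> 0" using b \<beta> by (simp add: c_def)
  have "norm (Y n Q t \<tau> z) \<le> sqrt (k * (p * exp (c * (2 * m)))) * norm z"
    if Q: "strongly_cont J Q" and Qb: "\<forall>s\<in>Jm m. \<forall>z. norm (Q s z) \<le> \<beta> * norm z" and t: "(t, \<tau>) \<in> Delta (Jm m)"
    for n Q t \<tau> z
  proof -
    note t' = Jm_segment[OF t]
    let ?y = "\<lambda>s. Y n Q s \<tau> z"
    let ?E = "\<lambda>s. inner (P s (?y s)) (?y s)"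
    have "?E t \<le> (?E \<tau> + 0 * (t - \<tau>)) * exp (c * (t - \<tau>))"
    proof (rule linear_differential_inequality)
      fix s assume s: "s \<in> {\<tau>..t}"
      then have sm: "s \<in> Jm m" and sJ: "s \<in> J" using t'(1) by auto
      show "(?E has_real_derivative inner (Pd s (?y s)) (?y s) + 2 * inner (G_n n Q s (?y s)) (P s (?y s))) (at s within {\<tau>..t})"
        by (rule energy_derivative[OF s _ Y_derivative[OF Q s t'(2)]]) (use t'(1) in auto)
      have "inner (Pd s (?y s)) (?y s) \<le> norm (Pd s (?y s)) * norm (?y s)" by (rule norm_cauchy_schwarz)
      also have "\<dots> \<le> d * norm (?y s) * norm (?y s)" by (intro mult_right_mono b(6)[OF sm]) simp
      finally have 1: "inner (Pd s (?y s)) (?y s) \<le> d * (norm (?y s))\<^sup>2" by (simp add: power2_eq_square mult.assoc)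
      have "inner (Q s (?y s)) (P s (?y s)) \<le> norm (Q s (?y s)) * norm (P s (?y s))" by (rule norm_cauchy_schwarz)
      also have "\<dots> \<le> (\<beta> * norm (?y s)) * (p * norm (?y s))"
        using Qb sm \<beta> b by (intro mult_mono) auto
      finally have 2: "inner (Q s (?y s)) (P s (?y s)) \<le> \<beta> * p * (norm (?y s))\<^sup>2" by (simp add: power2_eq_square mult_ac)
      have "inner (Pd s (?y s)) (?y s) + 2 * inner (G_n n Q s (?y s)) (P s (?y s)) \<le> (d + 2 * \<beta> * p) * (norm (?y s))\<^sup>2"
        using 1 2 yosida_dissip[of n "P s (?y s)"] by (simp add: G_n_def inner_add_left algebra_simps)
      also have "\<dots> \<le> (d + 2 * \<beta> * p) * (k * ?E s)"
        using \<beta> b by (intro mult_left_mono energy_lower[OF sJ b(2) b(5)[OF sm]]) auto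
      finally show "inner (Pd s (?y s)) (?y s) + 2 * inner (G_n n Q s (?y s)) (P s (?y s)) \<le> c * ?E s + 0"
        by (simp add: c_def mult_ac)
    qed (use t' c0 in auto)
    also have "?E \<tau> = inner (P \<tau> z) z" using Y_evol(3)[OF Q, of \<tau>] t'(3) by simp
    also have "inner (P \<tau> z) z \<le> p * (norm z)\<^sup>2"
    proof -
      have "inner (P \<tau> z) z \<le> norm (P \<tau> z) * norm z" by (rule norm_cauchy_schwarz)
      also have "\<dots> \<le> (p * norm z) * norm z" using b(4) t'(3) by (intro mult_right_mono) auto
      finally show ?thesis by (simp add: power2_eq_square mult.assoc)
    qed
    finally have "?E t \<le> (p * (norm z)\<^sup>2) * exp (c * (t - \<tau>))" by simp
    also have "\<dots> \<le> (p * (norm z)\<^sup>2) * exp (c * (2 * m))"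
      using b t'(3) c0 by (intro mult_left_mono) (auto intro: mult_left_mono)
    finally have "k * ?E t \<le> k * ((p * (norm z)\<^sup>2) * exp (c * (2 * m)))" using b by (intro mult_left_mono) auto
    moreover have "(norm (?y t))\<^sup>2 \<le> k * ?E t"
      using t'(3) by (intro energy_lower[OF _ b(2) b(5)]) auto
    ultimately have "(norm (?y t))\<^sup>2 \<le> (k * (p * exp (c * (2 * m)))) * (norm z)\<^sup>2" by (simp add: mult_ac)
    then have "sqrt ((norm (?y t))\<^sup>2) \<le> sqrt ((k * (p * exp (c * (2 * m)))) * (norm z)\<^sup>2)" by (rule real_sqrt_le_mono)
    then show ?thesis by (simp add: real_sqrt_mult)
  qed
  then show ?thesis using b by (intro exI[of _ "sqrt (k * (p * exp (c * (2 * m))))"]) auto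
qed

lemma Y_bound_fixed:
  assumes Q: "strongly_cont J Q"
  shows "\<exists>C\<ge>0. \<forall>n t \<tau> z. (t, \<tau>) \<in> Delta (Jm m) \<longrightarrow> norm (Y n Q t \<tau> z) \<le> C * norm z"
proof -
  obtain \<beta> where "\<beta> \<ge> 0" "\<forall>s\<in>Jm m. \<forall>z. norm (Q s z) \<le> \<beta> * norm z"
    using strongly_cont_bound[OF Q compact_exhaustion(1)[OF J]] by blast
  then show ?thesis using Y_bound[of \<beta> m] Q by blast
qed

section \<open>The case \<open>Q = -K\<close> and its limit\<close>

abbreviation nK :: "real \<Rightarrow> 'a \<Rightarrow> 'a" where "nK \<equiv> \<lambda>t z. - K t z"

lemma nK: "strongly_cont J nK"
  using strongly_cont_add(3)[OF K_strongly_cont K_strongly_cont] .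

text \<open>In the variable x = P y the choice \<open>Q = -K\<close> cancels the derivative of
  \<open>P\<close>, which leaves the pure equation x' = P A_n x.\<close>

definition Xn :: "nat \<Rightarrow> real \<Rightarrow> real \<Rightarrow> 'a \<Rightarrow> 'a" where
  "Xn n t \<tau> x = P t (Y n nK t \<tau> (Pinv \<tau> x))"

lemma bounded_linear_P: "t \<in> J \<Longrightarrow> bounded_linear (P t)" "t \<in> J \<Longrightarrow> bounded_linear (Pinv t)"
  "t \<in> J \<Longrightarrow> bounded_linear (Pd t)" "t \<in> J \<Longrightarrow> bounded_linear (K t)"
  by (rule strongly_contD(1)[OF P], assumption) (rule strongly_contD(1)[OF Pinv], assumption,
    rule strongly_contD(1)[OF Pd], assumption, rule strongly_contD(1)[OF K_strongly_cont])

lemma Xn_derivative: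
  assumes "s \<in> {\<tau>..t}" "(t, \<tau>) \<in> Delta J"
  shows "((\<lambda>s. Xn n s \<tau> x) has_vector_derivative P s (yosida n (Xn n s \<tau> x))) (at s within {\<tau>..t})"
proof -
  have S: "{\<tau>..t} \<subseteq> J" using Delta_subinterval(1)[OF J(1) assms(2)] by auto
  then have sJ: "s \<in> J" using assms by auto
  have "((\<lambda>s. P s (Y n nK s \<tau> (Pinv \<tau> x))) has_vector_derivative
     P s (G_n n nK s (Y n nK s \<tau> (Pinv \<tau> x))) + Pd s (Y n nK s \<tau> (Pinv \<tau> x))) (at s within {\<tau>..t})"
    by (rule P_product[OF assms(1) S Y_derivative[OF nK assms]])
  moreover have "P s (G_n n nK s v) + Pd s v = P s (yosida n (P s v))" for v
    using bounded_linear_P(1)[OF sJ] P_K[OF sJ, of v] by (simp add: G_n_def linear_simps)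
  ultimately show ?thesis unfolding Xn_def by simp
qed

lemma zero_strongly_cont: "strongly_cont J (\<lambda>t z. 0)"
  by (simp add: strongly_cont_def)

text \<open>Combined with the bound for the family with \<open>Q = 0\<close>, this controls
  \<open>yosida n (Xn n t \<tau> x)\<close> by \<open>norm (A x)\<close> uniformly in
  \<open>n\<close>, as \<open>yosida_pair\<close> demands.\<close>

lemma yosida_Xn:
  assumes "(t, \<tau>) \<in> Delta J"
  shows "yosida n (Xn n t \<tau> x) = Y n (\<lambda>t z. 0) t \<tau> (yosida n x)"
proof -
  have "yosida n (Xn n t \<tau> x) = Y n (\<lambda>t z. 0) t \<tau> (yosida n (Xn n \<tau> \<tau> x))"
  proof (rule Y_unique[OF zero_strongly_cont assms, where x = "\<lambda>s. yosida n (Xn n s \<tau> x)"])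
    fix s assume s: "s \<in> {\<tau>..t}"
    show "((\<lambda>s. yosida n (Xn n s \<tau> x)) has_vector_derivative G_n n (\<lambda>t z. 0) s (yosida n (Xn n s \<tau> x))) (at s within {\<tau>..t})"
      using bounded_linear.has_vector_derivative[OF bounded_linear_yosida Xn_derivative[OF s assms]]
      by (simp add: G_n_def)
  qed
  moreover have "\<tau> \<in> J" using assms by (auto simp: Delta_def)
  ultimately show ?thesis using Y_evol(3)[OF nK, of \<tau>] by (simp add: Xn_def P_Pinv)
qed

text \<open>The energy of the difference of two approximations starts at 0 and grows at most with a
  source of order 1/n + 1/l supplied by \<open>yosida_pair\<close>. Energy is quadratic in the norm,
  hence the square root.\<close>

lemma Xn_Cauchy_estimate:
  "\<exists>C\<ge>0. \<forall>n l t \<tau>. \<forall>x\<in>D. (t, \<tau>) \<in> Delta (Jm m) \<longrightarrow>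
    norm (Xn n t \<tau> x - Xn l t \<tau> x) \<le> C * norm (A x) * sqrt (inverse (real (Suc n)) + inverse (real (Suc l)))"
proof -
  obtain p k d where b: "p > 0" "k > 0" "d > 0"
    "\<And>s z. s \<in> Jm m \<Longrightarrow> norm (P s z) \<le> p * norm z"
    "\<And>s z. s \<in> Jm m \<Longrightarrow> norm (Pinv s z) \<le> k * norm z"
    "\<And>s z. s \<in> Jm m \<Longrightarrow> norm (Pd s z) \<le> d * norm z"
    by (rule local_bounds[of m]) (rule that)
  obtain C0 where C0: "C0 \<ge> 0" "\<And>n t \<tau> z. (t, \<tau>) \<in> Delta (Jm m) \<Longrightarrow> norm (Y n (\<lambda>t z. 0) t \<tau> z) \<le> C0 * norm z"
    using Y_bound_fixed[OF zero_strongly_cont, of m] by blast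
  define c where "c = d * k"
  define h where "h n l = inverse (real (Suc n)) + inverse (real (Suc l))" for n l
  \<comment> \<open>The absolute value keeps \<open>C\<close> nonnegative for negative
    \<open>m\<close>, where the window is empty.\<close>
  define C where "C = p * (sqrt (k * (4 * (2 * \<bar>m\<bar>) * exp (c * (2 * m)))) * C0)"
  have "norm (Xn n t \<tau> x - Xn l t \<tau> x) \<le> C * norm (A x) * sqrt (h n l)"
    if x: "x \<in> D" and t: "(t, \<tau>) \<in> Delta (Jm m)" for n l t \<tau> x
  proof -
    note t' = Jm_segment[OF t]
    define M where "M = C0 * norm (A x)"
    have hn: "h n l \<ge> 0" by (simp add: h_def)
    have w: "norm (yosida n (Xn n s \<tau> x)) \<le> M" if "s \<in> {\<tau>..t}" for n s
    proof -
      have s: "(s, \<tau>) \<in> Delta (Jm m)" using t' that by (auto simp: Delta_def)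
      have "norm (yosida n (Xn n s \<tau> x)) \<le> C0 * norm (yosida n x)"
        using C0(2)[OF s] yosida_Xn[OF Jm_segment(2)[OF s]] by simp
      also have "\<dots> \<le> M" unfolding M_def by (rule mult_left_mono[OF norm_yosida_dom[OF x] C0(1)])
      finally show ?thesis .
    qed
    let ?y = "\<lambda>n s. Y n nK s \<tau> (Pinv \<tau> x)"
    let ?e = "\<lambda>s. ?y n s - ?y l s"
    let ?E = "\<lambda>s. inner (P s (?e s)) (?e s)"
    let ?\<delta> = "4 * M\<^sup>2 * h n l"
    have PX: "P s (?y n s) = Xn n s \<tau> x" for n s by (simp add: Xn_def)
    have "?E t \<le> (?E \<tau> + ?\<delta> * (t - \<tau>)) * exp (c * (t - \<tau>))"
    proof (rule linear_differential_inequality)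
      fix s assume s: "s \<in> {\<tau>..t}"
      then have sm: "s \<in> Jm m" and sJ: "s \<in> J" using t'(1) by auto
      let ?e' = "G_n n nK s (?y n s) - G_n l nK s (?y l s)"
      show "(?E has_real_derivative inner (Pd s (?e s)) (?e s) + 2 * inner ?e' (P s (?e s))) (at s within {\<tau>..t})"
        by (rule energy_derivative[OF s _ has_vector_derivative_diff[OF Y_derivative[OF nK s t'(2)] Y_derivative[OF nK s t'(2)]]])
          (use t'(1) in auto)
      have e': "?e' = (yosida n (Xn n s \<tau> x) - yosida l (Xn l s \<tau> x)) - K s (?e s)"
        using bounded_linear_P(4)[OF sJ] by (simp add: G_n_def PX linear_simps)
      have Pe: "P s (?e s) = Xn n s \<tau> x - Xn l s \<tau> x"
        using bounded_linear_P(1)[OF sJ] by (simp add: PX linear_simps)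
      \<comment> \<open>The \<open>K\<close> term enters the energy derivative with factor -2 and
        meets the term from differentiating \<open>P\<close> with factor 1; the sum is again of the
        size of \<open>Pd\<close>.\<close>
      have "inner (K s (?e s)) (P s (?e s)) = inner (Pd s (?e s)) (?e s)"
        using P_sa[OF sJ, of "K s (?e s)" "?e s"] P_K[OF sJ] by simp
      moreover have "inner (yosida n (Xn n s \<tau> x) - yosida l (Xn l s \<tau> x)) (P s (?e s)) \<le> 2 * M\<^sup>2 * h n l"
        unfolding Pe h_def by (rule yosida_pair[OF w[OF s] w[OF s]])
      ultimately have "inner (Pd s (?e s)) (?e s) + 2 * inner ?e' (P s (?e s)) \<le> - inner (Pd s (?e s)) (?e s) + ?\<delta>"
        unfolding e' by (simp add: inner_diff_left)
      also have "- inner (Pd s (?e s)) (?e s) \<le> norm (Pd s (?e s)) * norm (?e s)"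
        using norm_cauchy_schwarz[of "- Pd s (?e s)" "?e s"] by simp
      also have "\<dots> \<le> d * norm (?e s) * norm (?e s)" by (intro mult_right_mono b(6)[OF sm]) simp
      also have "\<dots> = d * (norm (?e s))\<^sup>2" by (simp add: power2_eq_square)
      also have "\<dots> \<le> d * (k * ?E s)"
        using b by (intro mult_left_mono energy_lower[OF sJ b(2) b(5)[OF sm]]) auto
      finally show "inner (Pd s (?e s)) (?e s) + 2 * inner ?e' (P s (?e s)) \<le> c * ?E s + ?\<delta>"
        by (simp add: c_def mult.assoc)
    qed (use t' b hn in \<open>auto simp: c_def\<close>)
    also have "?E \<tau> = 0"
      using Y_evol(3)[OF nK, of \<tau>] t'(3) by simp
    also have "(0 + ?\<delta> * (t - \<tau>)) * exp (c * (t - \<tau>)) \<le> (?\<delta> * (2 * \<bar>m\<bar>)) * exp (c * (2 * m))"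
    proof (rule mult_mono)
      show "0 + ?\<delta> * (t - \<tau>) \<le> ?\<delta> * (2 * \<bar>m\<bar>)"
        unfolding add_0 by (rule mult_left_mono) (use t'(3) hn in auto)
      show "exp (c * (t - \<tau>)) \<le> exp (c * (2 * m))"
        using t'(3) b by (simp add: c_def)
    qed (use hn in auto)
    finally have "?E t \<le> (?\<delta> * (2 * \<bar>m\<bar>)) * exp (c * (2 * m))" .
    then have "k * ?E t \<le> k * ((?\<delta> * (2 * \<bar>m\<bar>)) * exp (c * (2 * m)))" using b by (intro mult_left_mono) auto
    moreover have "(norm (?e t))\<^sup>2 \<le> k * ?E t" using t'(3) by (intro energy_lower[OF _ b(2) b(5)]) auto
    ultimately have "(norm (?e t))\<^sup>2 \<le> (k * (4 * (2 * \<bar>m\<bar>) * exp (c * (2 * m)))) * M\<^sup>2 * h n l" by (simp add: mult_ac)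
    then have "sqrt ((norm (?e t))\<^sup>2) \<le> sqrt ((k * (4 * (2 * \<bar>m\<bar>) * exp (c * (2 * m)))) * M\<^sup>2 * h n l)" by (rule real_sqrt_le_mono)
    then have "norm (?e t) \<le> sqrt (k * (4 * (2 * \<bar>m\<bar>) * exp (c * (2 * m)))) * M * sqrt (h n l)"
      using C0(1) by (simp add: real_sqrt_mult M_def)
    then have "p * norm (?e t) \<le> p * (sqrt (k * (4 * (2 * \<bar>m\<bar>) * exp (c * (2 * m)))) * M * sqrt (h n l))"
      using b by (intro mult_left_mono) auto
    moreover have "Xn n t \<tau> x - Xn l t \<tau> x = P t (?e t)"
      using bounded_linear_P(1) t'(3) by (simp add: PX linear_simps)
    moreover have "norm (P t (?e t)) \<le> p * norm (?e t)" using t'(3) by (intro b(4)) auto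
    ultimately show ?thesis by (simp add: C_def M_def mult_ac)
  qed
  moreover have "C \<ge> 0" using b C0 by (simp add: C_def)
  ultimately show ?thesis unfolding h_def by blast
qed

lemma Xn_bound: "\<exists>C\<ge>0. \<forall>n t \<tau> z. (t, \<tau>) \<in> Delta (Jm m) \<longrightarrow> norm (Xn n t \<tau> z) \<le> C * norm z"
proof -
  obtain p k d where b: "p > 0" "k > 0" "d > 0"
    "\<And>s z. s \<in> Jm m \<Longrightarrow> norm (P s z) \<le> p * norm z"
    "\<And>s z. s \<in> Jm m \<Longrightarrow> norm (Pinv s z) \<le> k * norm z"
    "\<And>s z. s \<in> Jm m \<Longrightarrow> norm (Pd s z) \<le> d * norm z"
    by (rule local_bounds[of m]) (rule that)
  obtain C where C: "C \<ge> 0" "\<And>n t \<tau> z. (t, \<tau>) \<in> Delta (Jm m) \<Longrightarrow> norm (Y n nK t \<tau> z) \<le> C * norm z"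
    using Y_bound_fixed[OF nK, of m] by blast
  have "norm (Xn n t \<tau> z) \<le> (p * (C * k)) * norm z" if t: "(t, \<tau>) \<in> Delta (Jm m)" for n t \<tau> z
  proof -
    have "norm (Xn n t \<tau> z) \<le> p * norm (Y n nK t \<tau> (Pinv \<tau> z))"
      unfolding Xn_def using Jm_segment(3)[OF t] by (intro b(4)) auto
    also have "\<dots> \<le> p * (C * norm (Pinv \<tau> z))" using b(1) C(2)[OF t] by (intro mult_left_mono) auto
    also have "\<dots> \<le> p * (C * (k * norm z))" using b(1) C(1) Jm_segment(3)[OF t] by (intro mult_left_mono b(5)) auto
    finally show ?thesis by (simp add: mult.assoc)
  qed
  then show ?thesis using b C(1) by (intro exI[of _ "p * (C * k)"]) auto
qed

lemma Xn_linear: "(t, \<tau>) \<in> Delta J \<Longrightarrow> bounded_linear (Xn n t \<tau>)"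
  unfolding Xn_def[abs_def]
  by (intro bounded_linear_compose[OF bounded_linear_P(1)] bounded_linear_compose[OF Y_evol(2)[OF nK]] bounded_linear_P(2))
    (auto simp: Delta_def)

lemma Xn_continuous: "continuous_on (Delta J) (\<lambda>p. Xn n (fst p) (snd p) x)"
  unfolding Xn_def
proof (rule strongly_cont_apply[OF P])
  have "continuous_on (Delta J) (\<lambda>p. Pinv (snd p) x)"
    by (rule strongly_cont_apply[OF Pinv]) (auto intro!: continuous_intros simp: Delta_def)
  then show "continuous_on (Delta J) (\<lambda>p. Y n nK (fst p) (snd p) (Pinv (snd p) x))"
    by (rule strongly_cont_apply'[OF Y_evol(1)[OF nK] _ order_refl])
qed (auto intro!: continuous_intros simp: Delta_def)

text \<open>For vectors in \<open>D\<close> this is the Cauchy estimate; density of \<open>D\<close>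
  and the bound uniform in \<open>n\<close> extend it to every \<open>z\<close>, uniformly over the
  window of times.\<close>

lemma Xn_uniformly_Cauchy: "uniformly_Cauchy_on (Delta (Jm m)) (\<lambda>n p. Xn n (fst p) (snd p) z)"
proof (rule uniformly_Cauchy_onI)
  fix e :: real assume e: "e > 0"
  obtain C1 where C1: "C1 \<ge> 0" "\<And>n t \<tau> z. (t, \<tau>) \<in> Delta (Jm m) \<Longrightarrow> norm (Xn n t \<tau> z) \<le> C1 * norm z"
    using Xn_bound[of m] by blast
  obtain C2 where C2: "C2 \<ge> 0" "\<And>n l t \<tau> x. x \<in> D \<Longrightarrow> (t, \<tau>) \<in> Delta (Jm m) \<Longrightarrow>
    norm (Xn n t \<tau> x - Xn l t \<tau> x) \<le> C2 * norm (A x) * sqrt (inverse (real (Suc n)) + inverse (real (Suc l)))"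
    using Xn_Cauchy_estimate[of m] by blast
  let ?d = "e / (3 * (C1 + 1))"
  have d: "?d > 0" using e C1 by simp
  obtain x where x: "x \<in> D" "dist x z < ?d"
    using dense closure_approachable[of z D] d by (metis UNIV_I)
  have "(\<lambda>n. C2 * norm (A x) * sqrt (inverse (real (Suc n)) * 2)) \<longlonglongrightarrow> C2 * norm (A x) * sqrt 0"
    by (intro tendsto_intros inverse_Suc_tendsto)
  then have "eventually (\<lambda>n. C2 * norm (A x) * sqrt (inverse (real (Suc n)) * 2) < e / 3) sequentially"
    by (rule order_tendstoD) (use e in simp)
  then obtain N where N: "C2 * norm (A x) * sqrt (inverse (real (Suc N)) * 2) < e / 3"
    using eventually_sequentially by auto
  show "\<exists>M. \<forall>p\<in>Delta (Jm m). \<forall>n\<ge>M. \<forall>l\<ge>M. dist (Xn n (fst p) (snd p) z) (Xn l (fst p) (snd p) z) < e"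
  proof (intro exI[of _ N] ballI allI impI)
    fix p n l assume p: "p \<in> Delta (Jm m)" and nl: "n \<ge> N" "l \<ge> N"
    have p': "(fst p, snd p) \<in> Delta (Jm m)" using p by simp
    let ?X = "\<lambda>n. Xn n (fst p) (snd p)"
    have lin: "bounded_linear (?X n)" for n by (rule Xn_linear[OF Jm_segment(2)[OF p']])
    have "?X n z - ?X l z = (?X n x - ?X l x) + (?X n (z - x) - ?X l (z - x))"
      using lin by (simp add: linear_simps)
    then have "norm (?X n z - ?X l z) \<le> norm (?X n x - ?X l x) + (norm (?X n (z - x)) + norm (?X l (z - x)))"
      by (smt (verit) norm_triangle_ineq norm_triangle_ineq4)
    also have "norm (?X n x - ?X l x) < e / 3"
    proof -
      have "inverse (real (Suc n)) + inverse (real (Suc l)) \<le> inverse (real (Suc N)) * 2"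
      proof -
        have "inverse (real (Suc i)) \<le> inverse (real (Suc N))" if "i \<ge> N" for i
          using that by (intro le_imp_inverse_le) auto
        from this[OF nl(1)] this[OF nl(2)] show ?thesis by linarith
      qed
      then have "C2 * norm (A x) * sqrt (inverse (real (Suc n)) + inverse (real (Suc l))) \<le> C2 * norm (A x) * sqrt (inverse (real (Suc N)) * 2)"
        using C2(1) by (intro mult_left_mono real_sqrt_le_mono) auto
      then show ?thesis using C2(2)[OF x(1) p', of n l] N by linarith
    qed
    also have "norm (?X n (z - x)) + norm (?X l (z - x)) \<le> 2 * (C1 * norm (z - x))"
      using C1(2)[OF p', of n "z - x"] C1(2)[OF p', of l "z - x"] by linarith
    also have "2 * (C1 * norm (z - x)) \<le> 2 * ((C1 + 1) * ?d)"
      using x(2) C1(1) d by (intro mult_left_mono mult_mono) (auto simp: dist_norm norm_minus_commute)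
    also have "2 * ((C1 + 1) * ?d) = 2 * e / 3" using C1(1) by (simp add: divide_simps)
    finally show "dist (?X n z) (?X l z) < e" by (simp add: dist_norm)
  qed
qed

definition Xl :: "real \<Rightarrow> real \<Rightarrow> 'a \<Rightarrow> 'a" where
  "Xl t \<tau> x = lim (\<lambda>n. Xn n t \<tau> x)"

lemma Xl_uniform: "uniform_limit (Delta (Jm m)) (\<lambda>n p. Xn n (fst p) (snd p) z) (\<lambda>p. Xl (fst p) (snd p) z) sequentially"
proof -
  have "uniformly_convergent_on (Delta (Jm m)) (\<lambda>n p. Xn n (fst p) (snd p) z)"
    by (rule Cauchy_uniformly_convergent[OF Xn_uniformly_Cauchy])
  then show ?thesis by (simp add: uniformly_convergent_uniform_limit_iff Xl_def)
qed

lemma Delta_exhausted: "(t, \<tau>) \<in> Delta J \<Longrightarrow> (t, \<tau>) \<in> Delta (Jm (max \<bar>t\<bar> \<bar>\<tau>\<bar>))"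
  by (auto simp: Delta_def)

lemma Xl_tendsto: "(t, \<tau>) \<in> Delta J \<Longrightarrow> (\<lambda>n. Xn n t \<tau> x) \<longlonglongrightarrow> Xl t \<tau> x"
  using tendsto_uniform_limitI[OF Xl_uniform Delta_exhausted] by simp

lemma Xl_strongly_cont: "strongly_cont (Delta J) (\<lambda>p. Xl (fst p) (snd p))"
  unfolding strongly_cont_def
proof (intro conjI ballI allI)
  fix p assume p: "p \<in> Delta J"
  show "bounded_linear (Xl (fst p) (snd p))"
    by (rule bounded_linear_lim[of "\<lambda>n. Xn n (fst p) (snd p)"]) (use p in \<open>auto intro!: Xn_linear Xl_tendsto\<close>)
next
  fix z show "continuous_on (Delta J) (\<lambda>p. Xl (fst p) (snd p) z)"
  proof (rule continuous_on_Delta_local)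
    fix m
    have "continuous_on (Delta (Jm m)) (\<lambda>p. Xn n (fst p) (snd p) z)" for n
      by (rule continuous_on_subset[OF Xn_continuous Delta_mono[OF Int_lower1]])
    then show "continuous_on (Delta (Jm m)) (\<lambda>p. Xl (fst p) (snd p) z)"
      by (intro uniform_limit_theorem[OF _ Xl_uniform] always_eventually allI) auto
  qed
qed

text \<open>Evolution formally generated by \<open>A P - K\<close>. Every other limit family is a
  Volterra perturbation of this one.\<close>

definition W :: "real \<Rightarrow> real \<Rightarrow> 'a \<Rightarrow> 'a" where
  "W t \<tau> z = Pinv t (Xl t \<tau> (P \<tau> z))"

lemma Y_nK_Xn: "(t, \<tau>) \<in> Delta J \<Longrightarrow> Y n nK t \<tau> z = Pinv t (Xn n t \<tau> (P \<tau> z))"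
  by (simp add: Xn_def Delta_def Pinv_P)

lemma W_tendsto: "(t, \<tau>) \<in> Delta J \<Longrightarrow> (\<lambda>n. Y n nK t \<tau> z) \<longlonglongrightarrow> W t \<tau> z"
  unfolding W_def
  by (simp add: Y_nK_Xn, rule bounded_linear.tendsto[OF bounded_linear_P(2) Xl_tendsto]) (auto simp: Delta_def)

lemma W_strongly_cont: "strongly_cont (Delta J) (\<lambda>p. W (fst p) (snd p))"
  unfolding strongly_cont_def
proof (intro conjI ballI allI)
  fix p assume p: "p \<in> Delta J"
  show "bounded_linear (W (fst p) (snd p))"
    by (rule bounded_linear_lim[of "\<lambda>n. Y n nK (fst p) (snd p)"]) (use p in \<open>auto intro!: Y_evol(2)[OF nK] W_tendsto\<close>)
next
  fix z
  have "continuous_on (Delta J) (\<lambda>p. P (snd p) z)"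
    by (rule strongly_cont_apply[OF P]) (auto intro!: continuous_intros simp: Delta_def)
  then have "continuous_on (Delta J) (\<lambda>p. Xl (fst p) (snd p) (P (snd p) z))"
    by (rule strongly_cont_apply'[OF Xl_strongly_cont _ order_refl])
  then show "continuous_on (Delta J) (\<lambda>p. W (fst p) (snd p) z)"
    unfolding W_def
    by (rule strongly_cont_apply[OF Pinv, rotated 2]) (auto intro!: continuous_intros simp: Delta_def)
qed

end

section \<open>Limits of the approximating evolution families\<close>

text \<open>A finite net of \<open>H\<close> reduces the claim to finitely many fixed vectors; the
  uniform operator bound covers the rest.\<close>

lemma uniform_limit_compact_vectors:
  fixes F :: "nat \<Rightarrow> 's \<Rightarrow> 'a::real_normed_vector \<Rightarrow> 'b::real_normed_vector"
  assumes lim: "\<And>z. uniform_limit S (\<lambda>n p. F n p z) (\<lambda>p. F0 p z) sequentially"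
    and lin: "\<And>n p. p \<in> S \<Longrightarrow> bounded_linear (F n p)" "\<And>p. p \<in> S \<Longrightarrow> bounded_linear (F0 p)"
    and bd: "\<And>n p z. p \<in> S \<Longrightarrow> norm (F n p z) \<le> C * norm z"
    and H: "compact H" and e: "e > 0"
  shows "\<exists>N. \<forall>n\<ge>N. \<forall>p\<in>S. \<forall>v\<in>H. norm (F n p v - F0 p v) < e"
proof -
  have bd0: "norm (F0 p z) \<le> C * norm z" if "p \<in> S" for p z
    using LIMSEQ_le_const2[OF tendsto_norm[OF tendsto_uniform_limitI[OF lim that]]] bd[OF that] by blast
  define c where "c = \<bar>C\<bar> + 1"
  have c: "c > 0" "C \<le> c" by (auto simp: c_def)
  let ?d = "e / (3 * c)"
  have d: "?d > 0" using e c by simp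
  obtain k where k: "finite k" "H \<subseteq> (\<Union>x\<in>k. ball x ?d)"
    using H d unfolding compact_eq_totally_bounded by blast
  have "\<exists>N. \<forall>n\<ge>N. \<forall>p\<in>S. dist (F n p x) (F0 p x) < e / 3" for x
    using uniform_limitD[OF lim[of x], of "e/3"] e by (simp add: eventually_sequentially)
  then obtain N where N: "\<And>x n p. n \<ge> N x \<Longrightarrow> p \<in> S \<Longrightarrow> dist (F n p x) (F0 p x) < e / 3" by metis
  obtain M where M: "\<And>x. x \<in> k \<Longrightarrow> N x \<le> M"
    using finite_nat_set_iff_bounded_le[of "N ` k"] k(1) by auto
  show ?thesis
  proof (intro exI[of _ M] allI impI ballI)
    fix n p v assume n: "n \<ge> M" and p: "p \<in> S" and v: "v \<in> H"
    obtain x where x: "x \<in> k" "dist x v < ?d" using v k(2) by auto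
    have "F n p v - F0 p v = (F n p x - F0 p x) + (F n p (v - x) - F0 p (v - x))"
      using lin[OF p] by (simp add: linear_simps)
    then have "norm (F n p v - F0 p v) \<le> norm (F n p x - F0 p x) + norm (F n p (v - x) - F0 p (v - x))"
      by (metis norm_triangle_ineq)
    also have "norm (F n p (v - x) - F0 p (v - x)) \<le> norm (F n p (v - x)) + norm (F0 p (v - x))"
      by (rule norm_triangle_ineq4)
    finally have *: "norm (F n p v - F0 p v) \<le> norm (F n p x - F0 p x) + (norm (F n p (v - x)) + norm (F0 p (v - x)))" by simp
    have "norm (F n p x - F0 p x) < e / 3"
      using N[OF order_trans[OF M[OF x(1)] n] p] by (simp add: dist_norm)
    moreover have "C * norm (v - x) \<le> c * ?d"
      using x(2) c by (intro mult_mono) (auto simp: dist_norm norm_minus_commute)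
    then have "C * norm (v - x) \<le> e / 3" using c by simp
    ultimately show "norm (F n p v - F0 p v) < e"
      using * bd[OF p, of n "v - x"] bd0[OF p, of "v - x"] by linarith
  qed
qed

lemma is_C1_on_Jge:
  fixes g :: "real \<Rightarrow> 'a::banach"
  assumes J: "is_interval J" and \<tau>: "\<tau> \<in> J" and \<phi>: "continuous_on (Jge J \<tau>) \<phi>"
    and int: "\<And>t. (t, \<tau>) \<in> Delta J \<Longrightarrow> (\<phi> has_integral (g t - g \<tau>)) {\<tau>..t}"
  shows "is_C1_on (Jge J \<tau>) g \<phi>"
  unfolding is_C1_on_def
proof (intro conjI ballI \<phi>)
  fix t assume t: "t \<in> Jge J \<tau>"
  \<comment> \<open>If \<open>t\<close> is not the right end of \<open>J\<close>, a point
    \<open>b\<close> beyond it is taken, so that \<open>{\<tau>..b}\<close> and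
    \<open>Jge J \<tau>\<close> agree near \<open>t\<close>; otherwise \<open>b = t\<close>.\<close>
  obtain b where b: "b \<in> J" "t \<le> b" "at t within Jge J \<tau> = at t within {\<tau>..b}"
  proof (cases "\<exists>b\<in>J. t < b")
    case True
    then obtain b where b: "b \<in> J" "t < b" by blast
    have "at t within Jge J \<tau> = at t within {\<tau>..b}"
    proof (rule at_within_nhd[of _ "{..<b}"])
      show "Jge J \<tau> \<inter> {..<b} - {t} = {\<tau>..b} \<inter> {..<b} - {t}"
        using mem_is_interval_1_I[OF J \<tau> b(1)] b(2) by (auto simp: Jge_def)
    qed (use b in auto)
    then show ?thesis using that[of b] b by simp
  next
    case False
    then have "Jge J \<tau> = {\<tau>..t}"
      using mem_is_interval_1_I[OF J \<tau>, of t] t by (auto simp: Jge_def not_less)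
    moreover have "t \<in> J" using t by (simp add: Jge_def)
    ultimately show ?thesis using that[of t] by simp
  qed
  have sub: "{\<tau>..b} \<subseteq> Jge J \<tau>" using mem_is_interval_1_I[OF J \<tau> b(1)] by (auto simp: Jge_def)
  have tb: "t \<in> {\<tau>..b}" using t b by (auto simp: Jge_def)
  have "((\<lambda>s. g \<tau> + integral {\<tau>..s} \<phi>) has_vector_derivative 0 + \<phi> t) (at t within {\<tau>..b})"
    by (intro has_vector_derivative_add has_vector_derivative_const integral_has_vector_derivative
        continuous_on_subset[OF \<phi> sub] tb)
  then have "(g has_vector_derivative \<phi> t) (at t within {\<tau>..b})"
    unfolding add_0
  proof (rule has_vector_derivative_transform[OF tb, rotated])
    fix s assume "s \<in> {\<tau>..b}"
    then have "(s, \<tau>) \<in> Delta J" using sub \<tau> by (auto simp: Delta_def Jge_def)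
    from integral_unique[OF int[OF this]] show "g s = g \<tau> + integral {\<tau>..s} \<phi>" by simp
  qed
  then show "(g has_vector_derivative \<phi> t) (at t within Jge J \<tau>)" using b(3) by simp
qed

context evolution_problem
begin

text \<open>Defined through the Volterra equation over \<open>W\<close> with perturbation
  \<open>Q + K\<close>, because the generator differs from that of \<open>W\<close> by this
  operator. Linearity and strong continuity are then inherited, and \<open>Y_tendsto\<close> shows
  that it is the limit of \<open>Y n Q\<close>.\<close>

definition Yl :: "(real \<Rightarrow> 'a \<Rightarrow> 'a) \<Rightarrow> real \<Rightarrow> real \<Rightarrow> 'a \<Rightarrow> 'a" where
  "Yl Q = volterra_sol W (\<lambda>t z. Q t z + K t z)"

text \<open>The vectors \<open>P r (h r)\<close> form a compact set, so convergence is uniform in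
  both times even along a moving vector.\<close>

lemma W_uniform:
  assumes t: "(t, \<tau>) \<in> Delta J" and h: "continuous_on {\<tau>..t} h" and e: "e > 0"
  shows "\<exists>N. \<forall>n\<ge>N. \<forall>s r. \<tau> \<le> r \<longrightarrow> r \<le> s \<longrightarrow> s \<le> t \<longrightarrow> norm (Y n nK s r (h r) - W s r (h r)) \<le> e"
proof -
  define m where "m = max \<bar>t\<bar> \<bar>\<tau>\<bar>"
  have tm: "(t, \<tau>) \<in> Delta (Jm m)" using Delta_exhausted[OF t] by (simp add: m_def)
  note t' = Jm_segment[OF tm]
  obtain k where k: "k > 0" "\<And>s z. s \<in> Jm m \<Longrightarrow> norm (Pinv s z) \<le> k * norm z"
    by (rule local_bounds[of m]) (rule that)
  obtain C where C: "C \<ge> 0" "\<And>n t \<tau> z. (t, \<tau>) \<in> Delta (Jm m) \<Longrightarrow> norm (Xn n t \<tau> z) \<le> C * norm z"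
    using Xn_bound[of m] by blast
  let ?H = "(\<lambda>r. P r (h r)) ` {\<tau>..t}"
  have "continuous_on {\<tau>..t} (\<lambda>r. P r (h r))"
    by (rule strongly_cont_apply'[OF P h]) (use t' in auto)
  then have H: "compact ?H" by (rule compact_continuous_image) simp
  have "\<exists>N. \<forall>n\<ge>N. \<forall>p\<in>Delta (Jm m). \<forall>v\<in>?H. norm (Xn n (fst p) (snd p) v - Xl (fst p) (snd p) v) < e / k"
  proof (rule uniform_limit_compact_vectors[where F = "\<lambda>n p. Xn n (fst p) (snd p)"])
    fix n p assume "p \<in> Delta (Jm m)"
    then have p: "(fst p, snd p) \<in> Delta (Jm m)" by simp
    show "bounded_linear (Xn n (fst p) (snd p))" by (rule Xn_linear[OF Jm_segment(2)[OF p]])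
    show "bounded_linear (Xl (fst p) (snd p))" using strongly_contD(1)[OF Xl_strongly_cont Jm_segment(2)[OF p]] by simp
    show "norm (Xn n (fst p) (snd p) z) \<le> C * norm z" for z by (rule C(2)[OF p])
  qed (use Xl_uniform H e k in auto)
  then obtain N where N: "\<And>n p v. n \<ge> N \<Longrightarrow> p \<in> Delta (Jm m) \<Longrightarrow> v \<in> ?H \<Longrightarrow> norm (Xn n (fst p) (snd p) v - Xl (fst p) (snd p) v) < e / k"
    by blast
  show ?thesis
  proof (intro exI[of _ N] allI impI)
    fix n s r assume n: "n \<ge> N" and sr: "\<tau> \<le> r" "r \<le> s" "s \<le> t"
    have sr': "(s, r) \<in> Delta (Jm m)" using sr t'(1) by (auto simp: Delta_def)
    have sJ: "s \<in> J" "r \<in> J" using sr' by (auto simp: Delta_def)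
    have "Y n nK s r (h r) - W s r (h r) = Pinv s (Xn n s r (P r (h r)) - Xl s r (P r (h r)))"
      using bounded_linear_P(2)[OF sJ(1)] by (simp add: Y_nK_Xn[OF Jm_segment(2)[OF sr']] W_def linear_simps)
    then have "norm (Y n nK s r (h r) - W s r (h r)) \<le> k * norm (Xn n s r (P r (h r)) - Xl s r (P r (h r)))"
      using sr' k(2)[of s] by (simp add: Delta_def)
    also have "\<dots> \<le> k * (e / k)"
    proof (rule mult_left_mono)
      have "P r (h r) \<in> ?H" by (rule imageI) (use sr in auto)
      from N[OF n sr' this] show "norm (Xn n s r (P r (h r)) - Xl s r (P r (h r))) \<le> e / k" by simp
    qed (use k(1) in simp)
    finally show "norm (Y n nK s r (h r) - W s r (h r)) \<le> e" using k(1) by simp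
  qed
qed

context
  fixes Q :: "real \<Rightarrow> 'a \<Rightarrow> 'a" assumes Q: "strongly_cont J Q"
begin

lemma QK: "strongly_cont J (\<lambda>t z. Q t z + K t z)"
  by (rule strongly_cont_add(1)[OF Q K_strongly_cont])

lemma Yl_strongly_cont: "strongly_cont (Delta J) (\<lambda>p. Yl Q (fst p) (snd p))"
  unfolding Yl_def by (rule volterra_sol_strongly_cont[OF J W_strongly_cont QK])

lemma Yl_section:
  assumes "(t, \<tau>) \<in> Delta J" shows "continuous_on {\<tau>..t} (\<lambda>s. Yl Q s \<tau> z)"
  by (rule strongly_cont_apply2[OF Yl_strongly_cont, where v = "\<lambda>_. z"])
    (simp_all add: Delta_subinterval(3)[OF J(1) assms] continuous_on_id continuous_on_const)

lemma Yl_linear: "(t, \<tau>) \<in> Delta J \<Longrightarrow> bounded_linear (Yl Q t \<tau>)"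
  using strongly_contD(1)[OF Yl_strongly_cont, of "(t, \<tau>)"] by simp

text \<open>\<open>Y n Q\<close> and \<open>Yl Q\<close> solve Volterra equations with the same
  perturbation \<open>Q + K\<close> and with kernels \<open>Y n nK\<close> and \<open>W\<close>.
  Their difference therefore solves a Volterra equation whose source is the error of the kernels
  along the limit orbit, which tends to 0 uniformly.\<close>

lemma Y_tendsto:
  assumes t: "(t, \<tau>) \<in> Delta J"
  shows "(\<lambda>n. Y n Q t \<tau> z) \<longlonglongrightarrow> Yl Q t \<tau> z"
proof -
  define m where "m = max \<bar>t\<bar> \<bar>\<tau>\<bar>"
  have tm: "(t, \<tau>) \<in> Delta (Jm m)" using Delta_exhausted[OF t] by (simp add: m_def)
  note t' = Jm_segment[OF tm]
  note S = Delta_subinterval[OF J(1) t]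
  have tau: "\<tau> \<le> t" using t'(3) by simp
  let ?B = "\<lambda>t z. Q t z + K t z"
  obtain C1 where C1: "C1 \<ge> 0" "\<And>n t \<tau> z. (t, \<tau>) \<in> Delta (Jm m) \<Longrightarrow> norm (Y n nK t \<tau> z) \<le> C1 * norm z"
    using Y_bound_fixed[OF nK, of m] by blast
  obtain C2 where C2: "C2 \<ge> 0" "\<And>s z. s \<in> Jm m \<Longrightarrow> norm (?B s z) \<le> C2 * norm z"
    using strongly_cont_bound[OF QK compact_exhaustion(1)[OF J]] by blast
  define e where "e n s = Y n Q s \<tau> z - Yl Q s \<tau> z" for n s
  define g where "g r = ?B r (Yl Q r \<tau> z)" for r
  have gc: "continuous_on {\<tau>..t} g"
    unfolding g_def by (rule strongly_cont_apply'[OF QK Yl_section[OF t]]) (use S(1) in auto)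
  define I where "I n s = integral {\<tau>..s} (\<lambda>r. Y n nK s r (g r) - W s r (g r))" for n s
  \<comment> \<open>Error of the kernels on the initial vector and, integrated, on the perturbed
    limit orbit \<open>g\<close>.\<close>
  define f where "f n s = (Y n nK s \<tau> z - W s \<tau> z) + I n s" for n s
  have Ic: "((\<lambda>r. Y n nK s r (g r) - W s r (g r)) has_integral I n s) {\<tau>..s}" if s: "s \<in> {\<tau>..t}" for n s
  proof -
    have gc': "continuous_on {\<tau>..s} (\<lambda>r. Yl Q r \<tau> z)" by (rule Yl_section[OF S(3)[OF s]])
    have "continuous_on {\<tau>..s} (\<lambda>r. Y n nK s r (g r))"
      unfolding g_def by (rule volterra_integrand_continuous[OF J(1) Y_evol(1)[OF nK] QK gc' S(3)[OF s]])
    moreover have "continuous_on {\<tau>..s} (\<lambda>r. W s r (g r))"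
      unfolding g_def by (rule volterra_integrand_continuous[OF J(1) W_strongly_cont QK gc' S(3)[OF s]])
    ultimately have "continuous_on {\<tau>..s} (\<lambda>r. Y n nK s r (g r) - W s r (g r))" by (rule continuous_on_diff)
    then show ?thesis
      unfolding I_def by (intro integrable_integral integrable_continuous_interval)
  qed
  have eq: "((\<lambda>r. Y n nK s r (?B r (e n r))) has_integral (e n s - f n s)) {\<tau>..s}" if s: "s \<in> {\<tau>..t}" for n s
  proof -
    have "((\<lambda>r. Y n nK s r (G_n n Q r (Y n Q r \<tau> z) - G_n n nK r (Y n Q r \<tau> z))) has_integral (Y n Q s \<tau> z - Y n nK s \<tau> z)) {\<tau>..s}"
      by (rule bounded_evolution_difference[OF J G_n_strongly_cont[OF nK] G_n_strongly_cont[OF Q] Y[OF nK] Y[OF Q] S(3)[OF s]])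
    then have a: "((\<lambda>r. Y n nK s r (?B r (Y n Q r \<tau> z))) has_integral (Y n Q s \<tau> z - Y n nK s \<tau> z)) {\<tau>..s}"
      by (simp add: G_n_def)
    have b: "((\<lambda>r. W s r (g r)) has_integral (Yl Q s \<tau> z - W s \<tau> z)) {\<tau>..s}"
      unfolding g_def Yl_def by (rule volterra_sol_eq[OF J W_strongly_cont QK S(3)[OF s]])
    have "((\<lambda>r. Y n nK s r (?B r (Y n Q r \<tau> z)) - W s r (g r) - (Y n nK s r (g r) - W s r (g r))) has_integral
      (Y n Q s \<tau> z - Y n nK s \<tau> z) - (Yl Q s \<tau> z - W s \<tau> z) - I n s) {\<tau>..s}"
      by (rule has_integral_diff[OF has_integral_diff[OF a b] Ic[OF s]])
    moreover have "(Y n Q s \<tau> z - Y n nK s \<tau> z) - (Yl Q s \<tau> z - W s \<tau> z) - I n s = e n s - f n s"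
      by (simp add: e_def f_def)
    ultimately have *: "((\<lambda>r. Y n nK s r (?B r (Y n Q r \<tau> z)) - W s r (g r) - (Y n nK s r (g r) - W s r (g r))) has_integral (e n s - f n s)) {\<tau>..s}"
      by (simp only:)
    show ?thesis
    proof (rule has_integral_eq[OF _ *])
      fix r assume r: "r \<in> {\<tau>..s}"
      have lin: "bounded_linear (Y n nK s r)" "bounded_linear (?B r)"
        using Y_evol(2)[OF nK Delta_subinterval(2)[OF J(1) S(3)[OF s] r]]
          strongly_contD(1)[OF QK Delta_subinterval(1)[OF J(1) S(3)[OF s] r]] by auto
      have "?B r (e n r) = ?B r (Y n Q r \<tau> z) - g r"
        unfolding e_def g_def using linear_diff[OF bounded_linear.linear[OF lin(2)]] .
      then show "Y n nK s r (?B r (Y n Q r \<tau> z)) - W s r (g r) - (Y n nK s r (g r) - W s r (g r)) = Y n nK s r (?B r (e n r))"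
        using lin(1) by (simp add: linear_simps)
    qed
  qed
  have f_small: "\<exists>N. \<forall>n\<ge>N. \<forall>s\<in>{\<tau>..t}. norm (f n s) \<le> \<delta>" if \<delta>: "\<delta> > 0" for \<delta>
  proof -
    \<comment> \<open>One share for the initial vector and \<open>t - \<tau>\<close> shares for the
      integral.\<close>
    let ?e = "\<delta> / (1 + (t - \<tau>))"
    have e: "?e > 0" using \<delta> tau by simp
    obtain N1 where N1: "\<And>n s r. n \<ge> N1 \<Longrightarrow> \<tau> \<le> r \<Longrightarrow> r \<le> s \<Longrightarrow> s \<le> t \<Longrightarrow> norm (Y n nK s r z - W s r z) \<le> ?e"
      using W_uniform[OF t continuous_on_const e, of z] by blast
    obtain N2 where N2: "\<And>n s r. n \<ge> N2 \<Longrightarrow> \<tau> \<le> r \<Longrightarrow> r \<le> s \<Longrightarrow> s \<le> t \<Longrightarrow> norm (Y n nK s r (g r) - W s r (g r)) \<le> ?e"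
      using W_uniform[OF t gc e] by blast
    have "norm (f n s) \<le> \<delta>" if n: "n \<ge> max N1 N2" and s: "s \<in> {\<tau>..t}" for n s
    proof -
      have "norm (I n s) \<le> integral {\<tau>..s} (\<lambda>_. ?e)"
        by (rule has_integral_norm_le[OF Ic[OF s]]) (use N2 n s in auto)
      also have "\<dots> = (s - \<tau>) * ?e" using s by simp
      also have "\<dots> \<le> (t - \<tau>) * ?e" using s e by (intro mult_right_mono) auto
      finally have "norm (f n s) \<le> ?e + (t - \<tau>) * ?e"
        unfolding f_def using N1[of n \<tau> s] n s norm_triangle_ineq[of "Y n nK s \<tau> z - W s \<tau> z" "I n s"] by auto
      also have "\<dots> = (1 + (t - \<tau>)) * ?e" by (simp only: distrib_right mult_1_left)
      also have "\<dots> = \<delta>" using tau by simp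
      finally show ?thesis .
    qed
    then show ?thesis by blast
  qed
  have e_small: "norm (e n t) \<le> \<delta> * exp (C1 * C2 * (t - \<tau>))" if \<delta>: "\<forall>s\<in>{\<tau>..t}. norm (f n s) \<le> \<delta>" for n \<delta>
  proof -
    have "continuous_on {\<tau>..t} (e n)"
      unfolding e_def by (intro continuous_on_diff Y_evol(5)[OF Q t] Yl_section[OF t])
    then have "bounded (e n ` {\<tau>..t})" using compact_continuous_image compact_imp_bounded compact_Icc by blast
    then obtain M where M: "\<And>s. s \<in> {\<tau>..t} \<Longrightarrow> norm (e n s) \<le> M" unfolding bounded_iff by blast
    show ?thesis
    proof (rule volterra_gronwall[where F = "\<lambda>s r. Y n nK s r (?B r (e n r))" and f = "f n" and b = t and M = M])
      show "norm (Y n nK s r (?B r (e n r))) \<le> C1 * C2 * norm (e n r)" if s: "s \<in> {\<tau>..t}" and r: "r \<in> {\<tau>..s}" for s r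
      proof -
        have sr: "(s, r) \<in> Delta (Jm m)" "r \<in> Jm m" using s r t'(1) by (auto simp: Delta_def)
        show ?thesis
          using order_trans[OF C1(2)[OF sr(1)] mult_left_mono[OF C2(2)[OF sr(2)] C1(1)]] by (simp add: mult.assoc)
      qed
    qed (use C1 C2 \<delta> M tau eq in auto)
  qed
  have "(\<lambda>n. e n t) \<longlonglongrightarrow> 0"
  proof (rule LIMSEQ_I)
    fix r :: real assume r: "r > 0"
    let ?x = "exp (C1 * C2 * (t - \<tau>))"
    obtain N where N: "\<forall>n\<ge>N. \<forall>s\<in>{\<tau>..t}. norm (f n s) \<le> r / 2 / ?x" using f_small[of "r / 2 / ?x"] r by auto
    have "norm (e n t - 0) < r" if "n \<ge> N" for n
      using e_small[of n "r / 2 / ?x"] N that r by auto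
    then show "\<exists>no. \<forall>n\<ge>no. norm (e n t - 0) < r" by blast
  qed
  then show ?thesis unfolding e_def by (rule LIM_zero_cancel)
qed

lemma Yl_refl:
  assumes "t \<in> J" shows "Yl Q t t z = z"
proof -
  have "(\<lambda>n. Y n Q t t z) \<longlonglongrightarrow> Yl Q t t z" using assms by (intro Y_tendsto) (simp add: Delta_def)
  then show ?thesis by (simp add: Y_evol(3)[OF Q assms] LIMSEQ_const_iff)
qed

lemma Yl_cocycle:
  assumes "(t, s) \<in> Delta J" "(s, \<tau>) \<in> Delta J"
  shows "Yl Q t s (Yl Q s \<tau> z) = Yl Q t \<tau> z"
proof -
  have t: "(t, \<tau>) \<in> Delta J" using assms by (auto simp: Delta_def)
  have "(\<lambda>n. Y n Q t s (Y n Q s \<tau> z)) \<longlonglongrightarrow> Yl Q t s (Yl Q s \<tau> z)"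
    by (rule strong_tendsto_seq[where F = "\<lambda>n. Y n Q t s" and ?F0.0 = "Yl Q t s"])
      (rule Y_evol(2)[OF Q assms(1)] Yl_linear[OF assms(1)] Y_tendsto[OF assms(1)] Y_tendsto[OF assms(2)])+
  then have "(\<lambda>n. Y n Q t \<tau> z) \<longlonglongrightarrow> Yl Q t s (Yl Q s \<tau> z)"
    by (simp only: Y_evol(4)[OF Q assms])
  then show ?thesis using Y_tendsto[OF t] LIMSEQ_unique by blast
qed

lemma Yl_bound_fixed: "\<exists>C\<ge>0. \<forall>t \<tau> z. (t, \<tau>) \<in> Delta (Jm m) \<longrightarrow> norm (Yl Q t \<tau> z) \<le> C * norm z"
proof -
  obtain C where C: "C \<ge> 0" "\<And>n t \<tau> z. (t, \<tau>) \<in> Delta (Jm m) \<Longrightarrow> norm (Y n Q t \<tau> z) \<le> C * norm z"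
    using Y_bound_fixed[OF Q, of m] by blast
  have "norm (Yl Q t \<tau> z) \<le> C * norm z" if "(t, \<tau>) \<in> Delta (Jm m)" for t \<tau> z
    using LIMSEQ_le_const2[OF tendsto_norm[OF Y_tendsto[OF Jm_segment(2)[OF that]]]] C(2)[OF that] by blast
  then show ?thesis using C(1) by blast
qed

text \<open>\<open>T\<close> maps solutions of the approximate equation to solutions, so uniqueness
  makes it commute with each \<open>Y n Q\<close>. Applied to the complex structure, this yields
  complex linearity.\<close>

lemma Yl_commute:
  assumes T: "bounded_linear T" "\<And>x. x \<in> D \<Longrightarrow> T x \<in> D \<and> A (T x) = T (A x)"
    and PQ: "\<And>t x. t \<in> J \<Longrightarrow> P t (T x) = T (P t x)" "\<And>t x. t \<in> J \<Longrightarrow> Q t (T x) = T (Q t x)"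
    and t: "(t, \<tau>) \<in> Delta J"
  shows "Yl Q t \<tau> (T z) = T (Yl Q t \<tau> z)"
proof -
  have "T (Y n Q t \<tau> z) = Y n Q t \<tau> (T z)" for n
  proof -
    have "T (Y n Q t \<tau> z) = Y n Q t \<tau> (T (Y n Q \<tau> \<tau> z))"
    proof (rule Y_unique[OF Q t, where x = "\<lambda>s. T (Y n Q s \<tau> z)"])
      fix s assume s: "s \<in> {\<tau>..t}"
      then have sJ: "s \<in> J" using Delta_subinterval(1)[OF J(1) t] by blast
      have "G_n n Q s (T v) = T (G_n n Q s v)" for v
        using T(1) yosida_commute[OF bounded_linear.linear[OF T(1)] T(2)] PQ[OF sJ] by (simp add: G_n_def linear_simps)
      then show "((\<lambda>s. T (Y n Q s \<tau> z)) has_vector_derivative G_n n Q s (T (Y n Q s \<tau> z))) (at s within {\<tau>..t})"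
        using bounded_linear.has_vector_derivative[OF T(1) Y_derivative[OF Q s t]] by simp
    qed
    moreover have "\<tau> \<in> J" using t by (auto simp: Delta_def)
    ultimately show ?thesis using Y_evol(3)[OF Q] by simp
  qed
  then have "(\<lambda>n. Y n Q t \<tau> (T z)) \<longlonglongrightarrow> T (Yl Q t \<tau> z)"
    using bounded_linear.tendsto[OF T(1) Y_tendsto[OF t, of z]] by simp
  then show ?thesis using Y_tendsto[OF t] LIMSEQ_unique by blast
qed

text \<open>The derivative is the image under the resolvent \<open>R\<close> of \<open>(A P + Q) y\<close>, because
  \<open>R A = R - I\<close>.\<close>
lemma Yl_extrapolated:
  assumes \<tau>: "\<tau> \<in> J"
  shows "is_C1_on (Jge J \<tau>) (\<lambda>t. R (Yl Q t \<tau> z))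
    (\<lambda>t. R (P t (Yl Q t \<tau> z)) - P t (Yl Q t \<tau> z) + R (Q t (Yl Q t \<tau> z)))"
proof (rule is_C1_on_Jge[OF J(1) \<tau>])
  let ?y = "\<lambda>t. Yl Q t \<tau> z"
  note Rc = bounded_linear.continuous_on[OF bounded_linear_resolvent]
  have phi: "continuous_on S (\<lambda>t. R (P t (y t)) - P t (y t) + R (Q t (y t)))"
    if y: "continuous_on S y" and S: "S \<subseteq> J" for S y
    by (intro continuous_on_add continuous_on_diff Rc strongly_cont_apply'[OF P y S] strongly_cont_apply'[OF Q y S])
  have "continuous_on (Jge J \<tau>) ?y"
    by (rule strongly_cont_apply2[OF Yl_strongly_cont, where v = "\<lambda>_. z"])
      (use \<tau> in \<open>simp_all add: continuous_on_id continuous_on_const Delta_def Jge_def\<close>)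
  then show "continuous_on (Jge J \<tau>) (\<lambda>t. R (P t (?y t)) - P t (?y t) + R (Q t (?y t)))"
    by (rule phi) (auto simp: Jge_def)
  fix t assume t: "(t, \<tau>) \<in> Delta J"
  define m where "m = max \<bar>t\<bar> \<bar>\<tau>\<bar>"
  have tm: "(t, \<tau>) \<in> Delta (Jm m)" using Delta_exhausted[OF t] by (simp add: m_def)
  note t' = Jm_segment[OF tm]
  note S = Delta_subinterval[OF J(1) t]
  have SJ: "{\<tau>..t} \<subseteq> J" using S(1) by auto
  obtain p where p: "p > 0" "\<And>s z. s \<in> Jm m \<Longrightarrow> norm (P s z) \<le> p * norm z"
    by (rule local_bounds[of m]) (rule that)
  obtain q where q: "q \<ge> 0" "\<And>s z. s \<in> Jm m \<Longrightarrow> norm (Q s z) \<le> q * norm z"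
    using strongly_cont_bound[OF Q compact_exhaustion(1)[OF J]] by blast
  obtain C where C: "C \<ge> 0" "\<And>n t \<tau> z. (t, \<tau>) \<in> Delta (Jm m) \<Longrightarrow> norm (Y n Q t \<tau> z) \<le> C * norm z"
    using Y_bound_fixed[OF Q, of m] by blast
  let ?f = "\<lambda>n s. R (yosida n (P s (Y n Q s \<tau> z))) + R (Q s (Y n Q s \<tau> z))"
  show "((\<lambda>t. R (P t (?y t)) - P t (?y t) + R (Q t (?y t))) has_integral (R (?y t) - R (?y \<tau>))) {\<tau>..t}"
  \<comment> \<open>By \<open>resolvent_yosida\<close>, \<open>R\<close> composed with
    \<open>yosida n\<close> has norm at most 2 for all \<open>n\<close>. This is the factor 2 in the
    dominating constant.\<close>
  proof (rule has_integral_dominated_continuous[where f = ?f and I = "\<lambda>n. R (Y n Q t \<tau> z - z)"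
        and M = "2 * (p * (C * norm z)) + q * (C * norm z)"])
    show "(?f n has_integral R (Y n Q t \<tau> z - z)) {\<tau>..t}" for n
    proof -
      have "((\<lambda>s. G_n n Q s (Y n Q s \<tau> z)) has_integral (Y n Q t \<tau> z - z)) {\<tau>..t}"
        by (rule Y_evol(6)[OF Q t])
      from has_integral_linear[OF this bounded_linear_resolvent]
      show ?thesis using bounded_linear_resolvent by (simp add: o_def G_n_def linear_simps)
    qed
    have "(\<lambda>n. R (Y n Q t \<tau> z - z)) \<longlonglongrightarrow> R (?y t - z)"
      by (intro bounded_linear.tendsto[OF bounded_linear_resolvent] tendsto_diff tendsto_const Y_tendsto t)
    then show "(\<lambda>n. R (Y n Q t \<tau> z - z)) \<longlonglongrightarrow> R (?y t) - R (?y \<tau>)"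
      using bounded_linear_resolvent by (simp add: Yl_refl[OF \<tau>] linear_simps)
    show "continuous_on {\<tau>..t} (?f n)" for n
      by (intro continuous_on_add Rc bounded_linear.continuous_on[OF bounded_linear_yosida]
          strongly_cont_apply'[OF P Y_evol(5)[OF Q t] SJ] strongly_cont_apply'[OF Q Y_evol(5)[OF Q t] SJ])
    show "continuous_on {\<tau>..t} (\<lambda>t. R (P t (?y t)) - P t (?y t) + R (Q t (?y t)))"
      by (rule phi[OF Yl_section[OF t] SJ])
    fix s assume s: "s \<in> {\<tau>..t}"
    then have sm: "s \<in> Jm m" "(s, \<tau>) \<in> Delta (Jm m)" and sJ: "s \<in> J" using t' by (auto simp: Delta_def)
    have R_y: "R (yosida n v) = R (yosida_res n v) - yosida_res n v" for n v by (rule resolvent_yosida)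
    show "norm (?f n s) \<le> 2 * (p * (C * norm z)) + q * (C * norm z)" for n
    proof -
      let ?v = "P s (Y n Q s \<tau> z)" and ?w = "Q s (Y n Q s \<tau> z)"
      have "norm ?v \<le> p * (C * norm z)"
        using p(2)[OF sm(1), of "Y n Q s \<tau> z"] mult_left_mono[OF C(2)[OF sm(2), of n z], of p] p(1) by linarith
      moreover have "norm ?w \<le> q * (C * norm z)"
        using q(2)[OF sm(1), of "Y n Q s \<tau> z"] mult_left_mono[OF C(2)[OF sm(2), of n z] q(1)] by linarith
      moreover have "norm (R (yosida n ?v)) \<le> norm ?v + norm ?v"
        using norm_triangle_ineq4[of "R (yosida_res n ?v)" "yosida_res n ?v"] norm_resolvent[of "yosida_res n ?v"]
          norm_yosida_res[of n ?v] unfolding R_y by linarith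
      ultimately show ?thesis
        using norm_triangle_ineq[of "R (yosida n ?v)" "R ?w"] norm_resolvent[of ?w] by linarith
    qed
    have lim: "(\<lambda>n. Y n Q s \<tau> z) \<longlonglongrightarrow> ?y s" by (rule Y_tendsto[OF S(3)[OF s]])
    have "(\<lambda>n. yosida_res n (P s (Y n Q s \<tau> z))) \<longlonglongrightarrow> P s (?y s)"
      by (rule strong_tendsto_seq[where F = yosida_res and ?F0.0 = "\<lambda>v. v"])
        (rule bounded_linear_yosida_res bounded_linear_ident yosida_res_tendsto
          bounded_linear.tendsto[OF bounded_linear_P(1)[OF sJ] lim])+
    then show "(\<lambda>n. ?f n s) \<longlonglongrightarrow> R (P s (?y s)) - P s (?y s) + R (Q s (?y s))"
      unfolding R_y
      by (intro tendsto_add tendsto_diff bounded_linear.tendsto[OF bounded_linear_resolvent]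
          bounded_linear.tendsto[OF strongly_contD(1)[OF Q sJ]] lim)
  qed
qed

end

text \<open>The constant precedes \<open>Q\<close>, as needed for a sequence of perturbations with a
  common bound.\<close>

lemma Yl_bound:
  assumes "\<beta> \<ge> 0"
  shows "\<exists>C\<ge>0. \<forall>Q t \<tau> z. strongly_cont J Q \<longrightarrow> (\<forall>s\<in>Jm m. \<forall>z. norm (Q s z) \<le> \<beta> * norm z)
     \<longrightarrow> (t, \<tau>) \<in> Delta (Jm m) \<longrightarrow> norm (Yl Q t \<tau> z) \<le> C * norm z"
proof -
  obtain C where C: "C \<ge> 0" "\<And>n Q t \<tau> z. strongly_cont J Q \<Longrightarrow> \<forall>s\<in>Jm m. \<forall>z. norm (Q s z) \<le> \<beta> * norm z \<Longrightarrow>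
     (t, \<tau>) \<in> Delta (Jm m) \<Longrightarrow> norm (Y n Q t \<tau> z) \<le> C * norm z"
    using Y_bound[OF assms, of m] by blast
  have "norm (Yl Q t \<tau> z) \<le> C * norm z" if Q: "strongly_cont J Q" "\<forall>s\<in>Jm m. \<forall>z. norm (Q s z) \<le> \<beta> * norm z"
    and t: "(t, \<tau>) \<in> Delta (Jm m)" for Q t \<tau> z
    using LIMSEQ_le_const2[OF tendsto_norm[OF Y_tendsto[OF Q(1) Jm_segment(2)[OF t]]]] C(2)[OF Q t] by blast
  then show ?thesis using C(1) by blast
qed

text \<open>Taking \<open>Q1\<close> as \<open>G - K\<close> and \<open>Q2\<close> as
  \<open>G\<close> gives the equation of part (i); exchanging the roles gives that of part
  (ii).\<close>

lemma Yl_difference: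
  assumes Q1: "strongly_cont J Q1" and Q2: "strongly_cont J Q2" and t: "(t, \<tau>) \<in> Delta J"
  shows "((\<lambda>s. Yl Q1 t s (Q2 s (Yl Q2 s \<tau> z) - Q1 s (Yl Q2 s \<tau> z))) has_integral (Yl Q2 t \<tau> z - Yl Q1 t \<tau> z)) {\<tau>..t}"
proof -
  define m where "m = max \<bar>t\<bar> \<bar>\<tau>\<bar>"
  have tm: "(t, \<tau>) \<in> Delta (Jm m)" using Delta_exhausted[OF t] by (simp add: m_def)
  note t' = Jm_segment[OF tm]
  note S = Delta_subinterval[OF J(1) t]
  let ?B = "\<lambda>s v. Q2 s v - Q1 s v"
  have B: "strongly_cont J ?B" by (rule strongly_cont_add(2)[OF Q2 Q1])
  obtain C1 where C1: "C1 \<ge> 0" "\<And>n t \<tau> z. (t, \<tau>) \<in> Delta (Jm m) \<Longrightarrow> norm (Y n Q1 t \<tau> z) \<le> C1 * norm z"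
    using Y_bound_fixed[OF Q1, of m] by blast
  obtain C2 where C2: "C2 \<ge> 0" "\<And>n t \<tau> z. (t, \<tau>) \<in> Delta (Jm m) \<Longrightarrow> norm (Y n Q2 t \<tau> z) \<le> C2 * norm z"
    using Y_bound_fixed[OF Q2, of m] by blast
  obtain q where q: "q \<ge> 0" "\<And>s z. s \<in> Jm m \<Longrightarrow> norm (?B s z) \<le> q * norm z"
    using strongly_cont_bound[OF B compact_exhaustion(1)[OF J]] by blast
  show ?thesis
  proof (rule has_integral_dominated_continuous[where f = "\<lambda>n s. Y n Q1 t s (?B s (Y n Q2 s \<tau> z))"
        and I = "\<lambda>n. Y n Q2 t \<tau> z - Y n Q1 t \<tau> z" and M = "C1 * (q * (C2 * norm z))"])
    show "((\<lambda>s. Y n Q1 t s (?B s (Y n Q2 s \<tau> z))) has_integral (Y n Q2 t \<tau> z - Y n Q1 t \<tau> z)) {\<tau>..t}" for n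
      using bounded_evolution_difference[OF J G_n_strongly_cont[OF Q1] G_n_strongly_cont[OF Q2] Y[OF Q1] Y[OF Q2] t, of n n z]
      by (simp add: G_n_def)
    show "(\<lambda>n. Y n Q2 t \<tau> z - Y n Q1 t \<tau> z) \<longlonglongrightarrow> Yl Q2 t \<tau> z - Yl Q1 t \<tau> z"
      by (intro tendsto_diff Y_tendsto Q1 Q2 t)
    show "continuous_on {\<tau>..t} (\<lambda>s. Y n Q1 t s (?B s (Y n Q2 s \<tau> z)))" for n
      by (rule volterra_integrand_continuous[OF J(1) Y_evol(1)[OF Q1] B Y_evol(5)[OF Q2 t] t])
    show "continuous_on {\<tau>..t} (\<lambda>s. Yl Q1 t s (?B s (Yl Q2 s \<tau> z)))"
      by (rule volterra_integrand_continuous[OF J(1) Yl_strongly_cont[OF Q1] B Yl_section[OF Q2 t] t])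
    fix s assume s: "s \<in> {\<tau>..t}"
    then have sm: "s \<in> Jm m" "(s, \<tau>) \<in> Delta (Jm m)" "(t, s) \<in> Delta (Jm m)" and sJ: "s \<in> J"
      using t' by (auto simp: Delta_def)
    show "norm (Y n Q1 t s (?B s (Y n Q2 s \<tau> z))) \<le> C1 * (q * (C2 * norm z))" for n
      by (rule order_trans[OF C1(2)[OF sm(3)]], rule mult_left_mono[OF _ C1(1)],
          rule order_trans[OF q(2)[OF sm(1)]], rule mult_left_mono[OF C2(2)[OF sm(2)] q(1)])
    show "(\<lambda>n. Y n Q1 t s (?B s (Y n Q2 s \<tau> z))) \<longlonglongrightarrow> Yl Q1 t s (?B s (Yl Q2 s \<tau> z))"
      by (rule strong_tendsto_seq[where F = "\<lambda>n. Y n Q1 t s" and ?F0.0 = "Yl Q1 t s"])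
        (rule Y_evol(2)[OF Q1 S(2)[OF s]] Yl_linear[OF Q1 S(2)[OF s]] Y_tendsto[OF Q1 S(2)[OF s]]
          bounded_linear.tendsto[OF strongly_contD(1)[OF B sJ] Y_tendsto[OF Q2 S(3)[OF s]]])+
  qed
qed

text \<open>Duhamel's formula is evaluated on the orbit of the limit \<open>Q\<close>, which does
  not depend on \<open>n\<close>. Pointwise convergence of \<open>Qn\<close> along it and a common
  bound for the families \<open>Yl (Qn n)\<close> are then enough.\<close>

lemma Yl_perturb_tendsto:
  assumes Q: "strongly_cont J Q" "\<And>n. strongly_cont J (Qn n)"
    and bd: "\<And>m. \<exists>\<beta>\<ge>0. \<forall>n. \<forall>s\<in>Jm m. \<forall>z. norm (Qn n s z) \<le> \<beta> * norm z"
    and lim: "\<And>s z. s \<in> J \<Longrightarrow> (\<lambda>n. Qn n s z) \<longlonglongrightarrow> Q s z"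
    and t: "(t, \<tau>) \<in> Delta J"
  shows "(\<lambda>n. Yl (Qn n) t \<tau> z) \<longlonglongrightarrow> Yl Q t \<tau> z"
proof -
  define m where "m = max \<bar>t\<bar> \<bar>\<tau>\<bar>"
  have tm: "(t, \<tau>) \<in> Delta (Jm m)" using Delta_exhausted[OF t] by (simp add: m_def)
  note t' = Jm_segment[OF tm]
  note S = Delta_subinterval[OF J(1) t]
  have SJ: "{\<tau>..t} \<subseteq> J" using S(1) by auto
  obtain \<beta> where \<beta>: "\<beta> \<ge> 0" "\<And>n s z. s \<in> Jm m \<Longrightarrow> norm (Qn n s z) \<le> \<beta> * norm z" using bd[of m] by blast
  obtain C where C: "C \<ge> 0" "\<And>n t \<tau> z. (t, \<tau>) \<in> Delta (Jm m) \<Longrightarrow> norm (Yl (Qn n) t \<tau> z) \<le> C * norm z"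
  proof -
    obtain C where C: "C \<ge> 0" "\<forall>Q t \<tau> z. strongly_cont J Q \<longrightarrow> (\<forall>s\<in>Jm m. \<forall>z. norm (Q s z) \<le> \<beta> * norm z)
      \<longrightarrow> (t, \<tau>) \<in> Delta (Jm m) \<longrightarrow> norm (Yl Q t \<tau> z) \<le> C * norm z"
      using Yl_bound[OF \<beta>(1), where m = m] by (elim exE conjE) (rule that)
    have "\<forall>s\<in>Jm m. \<forall>z. norm (Qn n s z) \<le> \<beta> * norm z" for n using \<beta>(2) by simp
    then show ?thesis using that[OF C(1)] C(2)[rule_format, OF Q(2)] by simp
  qed
  obtain C2 where C2: "C2 \<ge> 0" "\<And>t \<tau> z. (t, \<tau>) \<in> Delta (Jm m) \<Longrightarrow> norm (Yl Q t \<tau> z) \<le> C2 * norm z"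
    using Yl_bound_fixed[OF Q(1), of m] by blast
  obtain q where q: "q \<ge> 0" "\<And>s z. s \<in> Jm m \<Longrightarrow> norm (Q s z) \<le> q * norm z"
    using strongly_cont_bound[OF Q(1) compact_exhaustion(1)[OF J]] by blast
  let ?g = "\<lambda>n s. C * norm (Q s (Yl Q s \<tau> z) - Qn n s (Yl Q s \<tau> z))"
  have gc: "continuous_on {\<tau>..t} (?g n)" for n
    by (intro continuous_on_mult continuous_on_const continuous_on_norm continuous_on_diff
        strongly_cont_apply'[OF Q(1) Yl_section[OF Q(1) t] SJ] strongly_cont_apply'[OF Q(2) Yl_section[OF Q(1) t] SJ])
  have le: "norm (Yl Q t \<tau> z - Yl (Qn n) t \<tau> z) \<le> integral {\<tau>..t} (?g n)" for n
  proof (rule has_integral_norm_le[OF Yl_difference[OF Q(2) Q(1) t] gc])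
    fix s assume "s \<in> {\<tau>..t}"
    then have "(t, s) \<in> Delta (Jm m)" using t' by (auto simp: Delta_def)
    then show "norm (Yl (Qn n) t s (Q s (Yl Q s \<tau> z) - Qn n s (Yl Q s \<tau> z))) \<le> ?g n s" by (rule C(2))
  qed
  have "(\<lambda>n. integral {\<tau>..t} (?g n)) \<longlonglongrightarrow> integral {\<tau>..t} (\<lambda>s. 0)"
  proof (rule integral_dominated_continuous[OF gc continuous_on_const])
    fix s assume s: "s \<in> {\<tau>..t}"
    then have sm: "s \<in> Jm m" "(s, \<tau>) \<in> Delta (Jm m)" and sJ: "s \<in> J" using t' by (auto simp: Delta_def)
    show "norm (?g n s) \<le> C * (q * (C2 * norm z) + \<beta> * (C2 * norm z))" for n
    proof -
      have "norm (Q s (Yl Q s \<tau> z)) \<le> q * (C2 * norm z)" "norm (Qn n s (Yl Q s \<tau> z)) \<le> \<beta> * (C2 * norm z)"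
        using order_trans[OF q(2)[OF sm(1)] mult_left_mono[OF C2(2)[OF sm(2)] q(1)]]
          order_trans[OF \<beta>(2)[OF sm(1)] mult_left_mono[OF C2(2)[OF sm(2)] \<beta>(1)]] by auto
      then have "norm (Q s (Yl Q s \<tau> z) - Qn n s (Yl Q s \<tau> z)) \<le> q * (C2 * norm z) + \<beta> * (C2 * norm z)"
        by (rule order_trans[OF norm_triangle_ineq4 add_mono])
      from mult_left_mono[OF this C(1)] show ?thesis using C(1) by simp
    qed
    have "(\<lambda>n. ?g n s) \<longlonglongrightarrow> C * norm (Q s (Yl Q s \<tau> z) - Q s (Yl Q s \<tau> z))"
      by (intro tendsto_mult tendsto_const tendsto_norm tendsto_diff lim sJ)
    then show "(\<lambda>n. ?g n s) \<longlonglongrightarrow> 0" by simp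
  qed
  then have "(\<lambda>n. Yl Q t \<tau> z - Yl (Qn n) t \<tau> z) \<longlonglongrightarrow> 0"
    by (intro Lim_null_comparison[OF always_eventually[OF allI[OF le]]]) simp
  from tendsto_diff[OF tendsto_const[of "Yl Q t \<tau> z"] this] show ?thesis by simp
qed

end

section \<open>Classical solutions\<close>

context evolution_problem
begin

text \<open>With \<open>u = Pinv s v\<close>, the increment of the inverse is minus
  \<open>Pinv r\<close> applied to the increment of \<open>P\<close> on \<open>u\<close>.\<close>

lemma Pinv_deriv:
  assumes s: "s \<in> J"
  shows "((\<lambda>t. Pinv t v) has_vector_derivative - K s (Pinv s v)) (at s within J)"
  unfolding has_vector_derivative_quotient
proof -
  let ?u = "Pinv s v"
  have "((\<lambda>r. Pinv r ((P r ?u - P s ?u) /\<^sub>R (r - s))) \<longlongrightarrow> Pinv s (Pd s ?u)) (at s within J)"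
  proof (rule strong_tendsto_within[where F = Pinv and ?F0.0 = "Pinv s"])
    show "((\<lambda>t. Pinv t z) \<longlongrightarrow> Pinv s z) (at s within J)" for z
      using strongly_contD(2)[OF Pinv, of z] s unfolding continuous_on_def by (rule bspec)
    show "((\<lambda>r. (P r ?u - P s ?u) /\<^sub>R (r - s)) \<longlongrightarrow> Pd s ?u) (at s within J)"
      using P_deriv[OF s, of ?u] unfolding has_vector_derivative_quotient .
  qed (use bounded_linear_P(2) s in auto)
  then have "((\<lambda>r. - Pinv r ((P r ?u - P s ?u) /\<^sub>R (r - s))) \<longlongrightarrow> - K s ?u) (at s within J)"
    unfolding K_def by (rule tendsto_minus)
  then show "((\<lambda>r. (Pinv r v - Pinv s v) /\<^sub>R (r - s)) \<longlongrightarrow> - K s (Pinv s v)) (at s within J)"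
  proof (rule Lim_transform_within[OF _ zero_less_one])
    fix r assume r: "r \<in> J"
    have lin: "linear (Pinv r)" using bounded_linear.linear[OF bounded_linear_P(2)[OF r]] .
    have "Pinv r (P r ?u - P s ?u) = Pinv s v - Pinv r v"
      by (simp add: linear_diff[OF lin] Pinv_P[OF r] P_Pinv[OF s])
    then have "- Pinv r ((P r ?u - P s ?u) /\<^sub>R (r - s)) = - ((Pinv s v - Pinv r v) /\<^sub>R (r - s))"
      by (simp only: linear_scale[OF lin])
    also have "\<dots> = (Pinv r v - Pinv s v) /\<^sub>R (r - s)" by (simp only: scaleR_minus_right[symmetric] minus_diff_eq)
    finally show "- Pinv r ((P r ?u - P s ?u) /\<^sub>R (r - s)) = (Pinv r v - Pinv s v) /\<^sub>R (r - s)" .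
  qed
qed

text \<open>For a strongly \<open>C\<^sup>1\<close> perturbation \<open>Q\<close> the function \<open>w\<^sub>n = A\<^sub>n P y\<^sub>n + Q y\<^sub>n\<close> satisfies an
  inhomogeneous equation whose data converge; so \<open>A\<^sub>n P y\<^sub>n\<close> converges and closedness of \<open>A\<close> applies.\<close>
lemma classical_solution:
  assumes Q: "strongly_cont J Q" and Qd: "strongly_cont J Qd"
    and Q_deriv: "\<And>t z. t \<in> J \<Longrightarrow> ((\<lambda>t. Q t z) has_vector_derivative Qd t z) (at t within J)"
    and \<tau>: "\<tau> \<in> J" and z: "P \<tau> z \<in> D"
  defines "y \<equiv> \<lambda>t. Yl (\<lambda>t z. Q t z - K t z) t \<tau> z"
  shows "(t, \<tau>) \<in> Delta J \<Longrightarrow> P t (y t) \<in> D"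
    and "is_C1_on (Jge J \<tau>) (\<lambda>t. P t (y t)) (\<lambda>t. P t (A (P t (y t))) + P t (Q t (y t)))"
proof -
  define Q1 where "Q1 = (\<lambda>t z. Q t z - K t z)"
  have Q1: "strongly_cont J Q1" unfolding Q1_def by (rule strongly_cont_add(2)[OF Q K_strongly_cont])
  \<comment> \<open>Inhomogeneity left over when \<open>Q y\<close> is differentiated: y' is
    \<open>w - K y\<close>, and \<open>Q w\<close> is counted as part of the generator.\<close>
  define B where "B = (\<lambda>s v. Qd s v - Q s (K s v))"
  have B: "strongly_cont J B"
    unfolding B_def by (rule strongly_cont_add(2)[OF Qd strongly_cont_compose[OF Q K_strongly_cont]])
  define yn where "yn n s = Y n Q1 s \<tau> z" for n s
  define w where "w n s = yosida n (P s (yn n s)) + Q s (yn n s)" for n s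
  define w0 where "w0 = A (P \<tau> z) + Q \<tau> z"
  \<comment> \<open>Limit of \<open>w n\<close> predicted by Duhamel's formula. The relevant family
    belongs to \<open>Q\<close> and not to \<open>Q - K\<close>, because \<open>P y\<close> has the
    derivative \<open>P w\<close> without a \<open>K\<close> term.\<close>
  define wl where "wl s = Yl Q s \<tau> w0 + integral {\<tau>..s} (\<lambda>r. Yl Q s r (B r (Yl Q1 r \<tau> z)))" for s
  have y: "y = (\<lambda>t. Yl Q1 t \<tau> z)" by (simp add: y_def Q1_def)
  have yn_refl: "yn n \<tau> = z" for n unfolding yn_def by (rule Y_evol(3)[OF Q1 \<tau>])
  have w\<tau>: "(\<lambda>n. w n \<tau>) \<longlonglongrightarrow> w0"
    unfolding w_def w0_def yn_refl by (intro tendsto_add tendsto_const yosida_tendsto z)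
  have wl_cont: "continuous_on (Jge J \<tau>) wl"
  proof -
    have sec: "continuous_on (Jge J \<tau>) (\<lambda>s. (s, \<tau>))" "\<And>s. s \<in> Jge J \<tau> \<Longrightarrow> (s, \<tau>) \<in> Delta J"
      using \<tau> by (auto intro!: continuous_intros simp: Jge_def Delta_def)
    have "continuous_on (Delta J) (\<lambda>p. integral {snd p..fst p} (\<lambda>r. Yl Q (fst p) r (B r (Yl Q1 r (snd p) z))))"
      using continuous_on_triangle_integral[OF J(1) volterra_kernel_continuous[OF J(1) Yl_strongly_cont[OF Q] B
          strongly_contD(2)[OF Yl_strongly_cont[OF Q1]]], unfolded fst_conv snd_conv] .
    from continuous_on_compose2[OF this sec(1)] sec(2)
    have "continuous_on (Jge J \<tau>) (\<lambda>s. integral {\<tau>..s} (\<lambda>r. Yl Q s r (B r (Yl Q1 r \<tau> z))))" by auto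
    moreover from continuous_on_compose2[OF strongly_contD(2)[OF Yl_strongly_cont[OF Q]] sec(1)] sec(2)
    have "continuous_on (Jge J \<tau>) (\<lambda>s. Yl Q s \<tau> w0)" by auto
    ultimately show ?thesis unfolding wl_def by (intro continuous_on_add)
  qed
  have main: "P t (y t) \<in> D \<and> A (P t (y t)) + Q t (y t) = wl t \<and> ((\<lambda>s. P s (wl s)) has_integral (P t (y t) - P \<tau> (y \<tau>))) {\<tau>..t}"
    if t: "(t, \<tau>) \<in> Delta J" for t
  proof -
    define m where "m = max \<bar>t\<bar> \<bar>\<tau>\<bar>"
    have tm: "(t, \<tau>) \<in> Delta (Jm m)" using Delta_exhausted[OF t] by (simp add: m_def)
    note t' = Jm_segment[OF tm]
    note S = Delta_subinterval[OF J(1) t]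
    have SJ: "{\<tau>..t} \<subseteq> J" using S(1) by auto
    have SJge: "{\<tau>..t} \<subseteq> Jge J \<tau>" using SJ by (auto simp: Jge_def)
    have tt: "t \<in> {\<tau>..t}" using t' by simp
    obtain C where C: "C \<ge> 0" "\<And>n t \<tau> z. (t, \<tau>) \<in> Delta (Jm m) \<Longrightarrow> norm (Y n Q t \<tau> z) \<le> C * norm z"
      using Y_bound_fixed[OF Q, of m] by blast
    obtain C1 where C1: "C1 \<ge> 0" "\<And>n t \<tau> z. (t, \<tau>) \<in> Delta (Jm m) \<Longrightarrow> norm (Y n Q1 t \<tau> z) \<le> C1 * norm z"
      using Y_bound_fixed[OF Q1, of m] by blast
    obtain \<beta> where \<beta>: "\<beta> \<ge> 0" "\<And>s z. s \<in> Jm m \<Longrightarrow> norm (B s z) \<le> \<beta> * norm z"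
      using strongly_cont_bound[OF B compact_exhaustion(1)[OF J]] by blast
    obtain p where p: "p > 0" "\<And>s z. s \<in> Jm m \<Longrightarrow> norm (P s z) \<le> p * norm z"
      by (rule local_bounds[of m]) (rule that)
    have yn_der: "(yn n has_vector_derivative (w n s - K s (yn n s))) (at s within {\<tau>..t})" if s: "s \<in> {\<tau>..t}" for n s
      using Y_derivative[OF Q1 s t] unfolding yn_def w_def by (simp add: G_n_def Q1_def algebra_simps)
    have x_der: "((\<lambda>s. P s (yn n s)) has_vector_derivative P s (w n s)) (at s within {\<tau>..t})" if s: "s \<in> {\<tau>..t}" for n s
    proof -
      have sJ: "s \<in> J" using s SJ by auto
      have "((\<lambda>s. P s (yn n s)) has_vector_derivative P s (w n s - K s (yn n s)) + Pd s (yn n s)) (at s within {\<tau>..t})"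
        by (rule P_product[OF s SJ yn_der[OF s]])
      moreover have "P s (w n s - K s (yn n s)) + Pd s (yn n s) = P s (w n s)"
        using linear_diff[OF bounded_linear.linear[OF bounded_linear_P(1)[OF sJ]]] P_K[OF sJ] by simp
      ultimately show ?thesis by simp
    qed
    have w_der: "(w n has_vector_derivative (G_n n Q s (w n s) + B s (yn n s))) (at s within {\<tau>..t})" if s: "s \<in> {\<tau>..t}" for n s
    proof -
      have sJ: "s \<in> J" using s SJ by auto
      have "((\<lambda>s. Q s (yn n s)) has_vector_derivative Q s (w n s - K s (yn n s)) + Qd s (yn n s)) (at s within {\<tau>..t})"
        by (rule strong_product_derivative[OF Q strongly_contD(1)[OF Q sJ] sJ SJ Q_deriv[OF sJ] yn_der[OF s]])
      then have "((\<lambda>s. yosida n (P s (yn n s)) + Q s (yn n s)) has_vector_derivative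
        yosida n (P s (w n s)) + (Q s (w n s - K s (yn n s)) + Qd s (yn n s))) (at s within {\<tau>..t})"
        by (intro has_vector_derivative_add bounded_linear.has_vector_derivative[OF bounded_linear_yosida x_der[OF s]])
      moreover have "yosida n (P s (w n s)) + (Q s (w n s - K s (yn n s)) + Qd s (yn n s)) = G_n n Q s (w n s) + B s (yn n s)"
        using linear_diff[OF bounded_linear.linear[OF strongly_contD(1)[OF Q sJ]]] by (simp add: G_n_def B_def)
      ultimately show ?thesis unfolding w_def by simp
    qed
    have w_int: "((\<lambda>r. Y n Q s r (B r (yn n r))) has_integral (w n s - Y n Q s \<tau> (w n \<tau>))) {\<tau>..s}" if s: "s \<in> {\<tau>..t}" for n s
    proof -
      have "((\<lambda>r. Y n Q s r (G_n n Q r (w n r) + B r (yn n r) - G_n n Q r (w n r))) has_integral (w n s - Y n Q s \<tau> (w n \<tau>))) {\<tau>..s}"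
      proof (rule Y_compare[OF Q S(3)[OF s]])
        fix r assume "r \<in> {\<tau>..s}"
        then have "r \<in> {\<tau>..t}" "{\<tau>..s} \<subseteq> {\<tau>..t}" using s by auto
        then show "(w n has_vector_derivative (G_n n Q r (w n r) + B r (yn n r))) (at r within {\<tau>..s})"
          using w_der has_vector_derivative_within_subset by blast
      qed
      then show ?thesis by simp
    qed
    have w_lim: "(\<lambda>n. w n s) \<longlonglongrightarrow> wl s" if s: "s \<in> {\<tau>..t}" for s
    proof -
      have sJ: "(s, \<tau>) \<in> Delta J" by (rule S(3)[OF s])
      have 1: "(\<lambda>n. Y n Q s \<tau> (w n \<tau>)) \<longlonglongrightarrow> Yl Q s \<tau> w0"
        by (rule strong_tendsto_seq[where F = "\<lambda>n. Y n Q s \<tau>" and ?F0.0 = "Yl Q s \<tau>"])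
          (rule Y_evol(2)[OF Q sJ] Yl_linear[OF Q sJ] Y_tendsto[OF Q sJ] w\<tau>)+
      have "(\<lambda>n. integral {\<tau>..s} (\<lambda>r. Y n Q s r (B r (yn n r)))) \<longlonglongrightarrow> integral {\<tau>..s} (\<lambda>r. Yl Q s r (B r (Yl Q1 r \<tau> z)))"
      proof (rule integral_dominated_continuous[where M = "C * (\<beta> * (C1 * norm z))"])
        show "continuous_on {\<tau>..s} (\<lambda>r. Y n Q s r (B r (yn n r)))" for n
          unfolding yn_def by (rule volterra_integrand_continuous[OF J(1) Y_evol(1)[OF Q] B Y_evol(5)[OF Q1 sJ] sJ])
        show "continuous_on {\<tau>..s} (\<lambda>r. Yl Q s r (B r (Yl Q1 r \<tau> z)))"
          by (rule volterra_integrand_continuous[OF J(1) Yl_strongly_cont[OF Q] B Yl_section[OF Q1 sJ] sJ])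
        fix r assume r: "r \<in> {\<tau>..s}"
        then have rm: "r \<in> Jm m" "(r, \<tau>) \<in> Delta (Jm m)" "(s, r) \<in> Delta (Jm m)" using s t' by (auto simp: Delta_def)
        note rJ = Delta_subinterval[OF J(1) sJ r]
        show "norm (Y n Q s r (B r (yn n r))) \<le> C * (\<beta> * (C1 * norm z))" for n
          unfolding yn_def
          by (rule order_trans[OF C(2)[OF rm(3)]], rule mult_left_mono[OF _ C(1)],
              rule order_trans[OF \<beta>(2)[OF rm(1)]], rule mult_left_mono[OF C1(2)[OF rm(2)] \<beta>(1)])
        show "(\<lambda>n. Y n Q s r (B r (yn n r))) \<longlonglongrightarrow> Yl Q s r (B r (Yl Q1 r \<tau> z))"
          unfolding yn_def
          by (rule strong_tendsto_seq[where F = "\<lambda>n. Y n Q s r" and ?F0.0 = "Yl Q s r"])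
            (rule Y_evol(2)[OF Q rJ(2)] Yl_linear[OF Q rJ(2)] Y_tendsto[OF Q rJ(2)]
              bounded_linear.tendsto[OF strongly_contD(1)[OF B rJ(1)] Y_tendsto[OF Q1 rJ(3)]])+
      qed
      from tendsto_add[OF 1 this] show ?thesis
        unfolding wl_def using integral_unique[OF w_int[OF s]] by simp
    qed
    have "bounded (range (\<lambda>n. w n \<tau>))" using w\<tau> convergent_imp_bounded by blast
    then obtain M0 where M0: "\<And>n. norm (w n \<tau>) \<le> M0" unfolding bounded_iff by blast
    have w_bd: "norm (w n s) \<le> C * M0 + C * (\<beta> * (C1 * norm z)) * (t - \<tau>)" if s: "s \<in> {\<tau>..t}" for n s
    proof -
      have sm: "(s, \<tau>) \<in> Delta (Jm m)" using s t' by (auto simp: Delta_def)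
      have "norm (w n s - Y n Q s \<tau> (w n \<tau>)) \<le> integral {\<tau>..s} (\<lambda>_. C * (\<beta> * (C1 * norm z)))"
      proof (rule has_integral_norm_le[OF w_int[OF s] continuous_on_const])
        fix r assume r: "r \<in> {\<tau>..s}"
        then have rm: "r \<in> Jm m" "(r, \<tau>) \<in> Delta (Jm m)" "(s, r) \<in> Delta (Jm m)" using s t' by (auto simp: Delta_def)
        show "norm (Y n Q s r (B r (yn n r))) \<le> C * (\<beta> * (C1 * norm z))"
          unfolding yn_def
          by (rule order_trans[OF C(2)[OF rm(3)]], rule mult_left_mono[OF _ C(1)],
              rule order_trans[OF \<beta>(2)[OF rm(1)]], rule mult_left_mono[OF C1(2)[OF rm(2)] \<beta>(1)])
      qed
      also have "\<dots> = C * (\<beta> * (C1 * norm z)) * (s - \<tau>)" using s by simp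
      also have "\<dots> \<le> C * (\<beta> * (C1 * norm z)) * (t - \<tau>)"
        using s C(1) \<beta>(1) C1(1) by (intro mult_left_mono) auto
      finally have "norm (w n s - Y n Q s \<tau> (w n \<tau>)) \<le> C * (\<beta> * (C1 * norm z)) * (t - \<tau>)" .
      moreover have "norm (Y n Q s \<tau> (w n \<tau>)) \<le> C * M0"
        by (rule order_trans[OF C(2)[OF sm] mult_left_mono[OF M0 C(1)]])
      ultimately show ?thesis using norm_triangle_sub[of "w n s" "Y n Q s \<tau> (w n \<tau>)"] by linarith
    qed
    have tJ: "t \<in> J" using t by (auto simp: Delta_def)
    have x_lim: "(\<lambda>n. P t (yn n t)) \<longlonglongrightarrow> P t (y t)"
      unfolding y yn_def by (rule bounded_linear.tendsto[OF bounded_linear_P(1)[OF tJ] Y_tendsto[OF Q1 t]])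
    have Ax_lim: "(\<lambda>n. yosida n (P t (yn n t))) \<longlonglongrightarrow> wl t - Q t (y t)"
    proof -
      have "(\<lambda>n. w n t - Q t (yn n t)) \<longlonglongrightarrow> wl t - Q t (y t)"
        unfolding y yn_def
        by (rule tendsto_diff[OF w_lim[OF tt] bounded_linear.tendsto[OF strongly_contD(1)[OF Q tJ] Y_tendsto[OF Q1 t]]])
      then show ?thesis by (simp add: w_def)
    qed
    \<comment> \<open>Since \<open>yosida n (P t (yn n t))\<close> converges,
      \<open>yosida_res n\<close> moves \<open>P t (yn n t)\<close> by a vanishing amount. Its
      values thus lie in \<open>D\<close>, converge to \<open>P t (y t)\<close>, and have convergent
      images under \<open>A\<close>.\<close>
    have "(\<lambda>n. inverse (real (Suc n)) *\<^sub>R yosida n (P t (yn n t))) \<longlonglongrightarrow> 0 *\<^sub>R (wl t - Q t (y t))"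
      by (rule tendsto_scaleR[OF LIMSEQ_inverse_real_of_nat Ax_lim])
    then have "(\<lambda>n. yosida_res n (P t (yn n t)) - P t (yn n t)) \<longlonglongrightarrow> 0"
      by (simp only: yosida_res_eq scaleR_zero_left)
    from tendsto_add[OF this x_lim] have "(\<lambda>n. yosida_res n (P t (yn n t))) \<longlonglongrightarrow> P t (y t)" by simp
    then have A: "P t (y t) \<in> D" "A (P t (y t)) = wl t - Q t (y t)"
      using closed_operator[where x = "\<lambda>n. yosida_res n (P t (yn n t))"] yosida_res_in Ax_lim
      unfolding yosida_eq by blast+
    have "((\<lambda>s. P s (wl s)) has_integral (P t (y t) - P \<tau> (y \<tau>))) {\<tau>..t}"
    proof (rule has_integral_dominated_continuous[where f = "\<lambda>n s. P s (w n s)" and I = "\<lambda>n. P t (yn n t) - P \<tau> (yn n \<tau>)"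
          and M = "p * (C * M0 + C * (\<beta> * (C1 * norm z)) * (t - \<tau>))"])
      show "((\<lambda>s. P s (w n s)) has_integral (P t (yn n t) - P \<tau> (yn n \<tau>))) {\<tau>..t}" for n
        using t'(3) by (intro fundamental_theorem_of_calculus x_der) auto
      show "(\<lambda>n. P t (yn n t) - P \<tau> (yn n \<tau>)) \<longlonglongrightarrow> P t (y t) - P \<tau> (y \<tau>)"
        unfolding yn_refl using Yl_refl[OF Q1 \<tau>] by (intro tendsto_diff x_lim) (simp add: y)
      have yc: "continuous_on {\<tau>..t} (yn n)" for n unfolding yn_def by (rule Y_evol(5)[OF Q1 t])
      have "continuous_on {\<tau>..t} (w n)" for n
        unfolding w_def
        by (intro continuous_on_add bounded_linear.continuous_on[OF bounded_linear_yosida]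
            strongly_cont_apply'[OF P yc SJ] strongly_cont_apply'[OF Q yc SJ])
      then show "continuous_on {\<tau>..t} (\<lambda>s. P s (w n s))" for n by (rule strongly_cont_apply'[OF P _ SJ])
      show "continuous_on {\<tau>..t} (\<lambda>s. P s (wl s))"
        by (rule strongly_cont_apply'[OF P continuous_on_subset[OF wl_cont SJge] SJ])
      fix s assume s: "s \<in> {\<tau>..t}"
      then have sm: "s \<in> Jm m" and sJ: "s \<in> J" using t' by auto
      show "norm (P s (w n s)) \<le> p * (C * M0 + C * (\<beta> * (C1 * norm z)) * (t - \<tau>))" for n
        by (rule order_trans[OF p(2)[OF sm] mult_left_mono[OF w_bd[OF s] less_imp_le[OF p(1)]]])
      show "(\<lambda>n. P s (w n s)) \<longlonglongrightarrow> P s (wl s)"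
        by (rule bounded_linear.tendsto[OF bounded_linear_P(1)[OF sJ] w_lim[OF s]])
    qed
    then show ?thesis using A by simp
  qed
  show "P t (y t) \<in> D" if "(t, \<tau>) \<in> Delta J" using main[OF that] by blast
  have "is_C1_on (Jge J \<tau>) (\<lambda>t. P t (y t)) (\<lambda>t. P t (wl t))"
  proof (rule is_C1_on_Jge[OF J(1) \<tau>])
    show "continuous_on (Jge J \<tau>) (\<lambda>s. P s (wl s))"
      by (rule strongly_cont_apply'[OF P wl_cont]) (auto simp: Jge_def)
  qed (use main in blast)
  moreover have "P t (wl t) = P t (A (P t (y t))) + P t (Q t (y t))" if t: "t \<in> Jge J \<tau>" for t
  proof -
    have "(t, \<tau>) \<in> Delta J" and tJ: "t \<in> J" using t \<tau> by (auto simp: Jge_def Delta_def)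
    then have "wl t = A (P t (y t)) + Q t (y t)" using main[of t] by simp
    then show ?thesis by (simp only: linear_add[OF bounded_linear.linear[OF bounded_linear_P(1)[OF tJ]]])
  qed
  ultimately show "is_C1_on (Jge J \<tau>) (\<lambda>t. P t (y t)) (\<lambda>t. P t (A (P t (y t))) + P t (Q t (y t)))"
    unfolding is_C1_on_def by (simp cong: continuous_on_cong)
qed

text \<open>Compared with the approximate evolution, y = P^(-1) x has the defect
  \<open>A (x s) - yosida n (x s)\<close>. This tends to 0 pointwise and is at most twice
  \<open>norm (A (x s))\<close>, which is bounded because continuity of \<open>x'\<close> makes
  \<open>A (x s)\<close> continuous.\<close>

lemma classical_solution_unique:
  assumes Q: "strongly_cont J Q" and t: "(t, \<tau>) \<in> Delta J"
    and x: "\<And>s. s \<in> {\<tau>..t} \<Longrightarrow> x s \<in> D"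
      "\<And>s. s \<in> {\<tau>..t} \<Longrightarrow> (x has_vector_derivative x' s) (at s within {\<tau>..t})"
      "\<And>s. s \<in> {\<tau>..t} \<Longrightarrow> x' s = P s (A (x s)) + P s (Q s (Pinv s (x s)))"
      "continuous_on {\<tau>..t} x'"
  shows "x t = P t (Yl (\<lambda>t z. Q t z - K t z) t \<tau> (Pinv \<tau> (x \<tau>)))"
proof -
  define Q1 where "Q1 = (\<lambda>t z. Q t z - K t z)"
  have Q1: "strongly_cont J Q1" unfolding Q1_def by (rule strongly_cont_add(2)[OF Q K_strongly_cont])
  define m where "m = max \<bar>t\<bar> \<bar>\<tau>\<bar>"
  have tm: "(t, \<tau>) \<in> Delta (Jm m)" using Delta_exhausted[OF t] by (simp add: m_def)
  note t' = Jm_segment[OF tm]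
  note S = Delta_subinterval[OF J(1) t]
  have SJ: "{\<tau>..t} \<subseteq> J" using S(1) by auto
  have tJ: "t \<in> J" "\<tau> \<in> J" using t by (auto simp: Delta_def)
  obtain C where C: "C \<ge> 0" "\<And>n t \<tau> z. (t, \<tau>) \<in> Delta (Jm m) \<Longrightarrow> norm (Y n Q1 t \<tau> z) \<le> C * norm z"
    using Y_bound_fixed[OF Q1, of m] by blast
  define y where "y s = Pinv s (x s)" for s
  have xc: "continuous_on {\<tau>..t} x"
    using x(2) by (meson continuous_on_eq_continuous_within has_vector_derivative_continuous)
  have yc: "continuous_on {\<tau>..t} y" unfolding y_def by (rule strongly_cont_apply'[OF Pinv xc SJ])
  have Ax: "A (x s) = Pinv s (x' s) - Q s (y s)" if s: "s \<in> {\<tau>..t}" for s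
  proof -
    have sJ: "s \<in> J" using s SJ by auto
    show ?thesis
      using x(3)[OF s] linear_add[OF bounded_linear.linear[OF bounded_linear_P(2)[OF sJ]]] Pinv_P[OF sJ] by (simp add: y_def)
  qed
  have "continuous_on {\<tau>..t} (\<lambda>s. Pinv s (x' s) - Q s (y s))"
    by (intro continuous_on_diff strongly_cont_apply'[OF Pinv x(4) SJ] strongly_cont_apply'[OF Q yc SJ])
  then have Axc: "continuous_on {\<tau>..t} (\<lambda>s. A (x s))" by (rule continuous_on_eq) (simp add: Ax)
  have y_der: "(y has_vector_derivative (A (x s) + Q s (y s) - K s (y s))) (at s within {\<tau>..t})" if s: "s \<in> {\<tau>..t}" for s
  proof -
    have sJ: "s \<in> J" using s SJ by auto
    have "(y has_vector_derivative (Pinv s (x' s) + - K s (Pinv s (x s)))) (at s within {\<tau>..t})"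
      unfolding y_def
      by (rule strong_product_derivative[OF Pinv bounded_linear_P(2)[OF sJ] sJ SJ Pinv_deriv[OF sJ] x(2)[OF s]])
    then show ?thesis using Ax[OF s] by (simp add: y_def)
  qed
  have dif: "((\<lambda>s. Y n Q1 t s (A (x s) - yosida n (x s))) has_integral (y t - Y n Q1 t \<tau> (y \<tau>))) {\<tau>..t}" for n
  proof -
    have "((\<lambda>s. Y n Q1 t s (A (x s) + Q s (y s) - K s (y s) - G_n n Q1 s (y s))) has_integral (y t - Y n Q1 t \<tau> (y \<tau>))) {\<tau>..t}"
      by (rule Y_compare[OF Q1 t y_der])
    then show ?thesis
    proof (rule has_integral_eq[rotated])
      fix s assume "s \<in> {\<tau>..t}"
      then have "P s (y s) = x s" using SJ by (auto simp: y_def P_Pinv)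
      then have "A (x s) + Q s (y s) - K s (y s) - G_n n Q1 s (y s) = A (x s) - yosida n (x s)"
        by (simp add: G_n_def Q1_def algebra_simps)
      then show "Y n Q1 t s (A (x s) + Q s (y s) - K s (y s) - G_n n Q1 s (y s)) = Y n Q1 t s (A (x s) - yosida n (x s))"
        by (simp only:)
    qed
  qed
  have "bounded ((\<lambda>s. A (x s)) ` {\<tau>..t})" using Axc compact_continuous_image compact_imp_bounded compact_Icc by blast
  then obtain M where M: "\<And>s. s \<in> {\<tau>..t} \<Longrightarrow> norm (A (x s)) \<le> M" unfolding bounded_iff by blast
  let ?g = "\<lambda>n s. C * norm (A (x s) - yosida n (x s))"
  have gc: "continuous_on {\<tau>..t} (?g n)" for n
    by (intro continuous_on_mult continuous_on_const continuous_on_norm continuous_on_diff Axc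
        bounded_linear.continuous_on[OF bounded_linear_yosida xc])
  have le: "norm (y t - Y n Q1 t \<tau> (y \<tau>)) \<le> integral {\<tau>..t} (?g n)" for n
  proof (rule has_integral_norm_le[OF dif gc])
    fix s assume "s \<in> {\<tau>..t}"
    then have "(t, s) \<in> Delta (Jm m)" using t' by (auto simp: Delta_def)
    then show "norm (Y n Q1 t s (A (x s) - yosida n (x s))) \<le> ?g n s" by (rule C(2))
  qed
  have "(\<lambda>n. integral {\<tau>..t} (?g n)) \<longlonglongrightarrow> integral {\<tau>..t} (\<lambda>s. 0)"
  proof (rule integral_dominated_continuous[OF gc continuous_on_const])
    fix s assume s: "s \<in> {\<tau>..t}"
    show "norm (?g n s) \<le> C * (2 * M)" for n
    proof -
      have "norm (A (x s) - yosida n (x s)) \<le> 2 * M"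
        using norm_triangle_ineq4[of "A (x s)" "yosida n (x s)"] norm_yosida_dom[OF x(1)[OF s], of n] M[OF s] by linarith
      from mult_left_mono[OF this C(1)] show ?thesis using C(1) by simp
    qed
    have "(\<lambda>n. ?g n s) \<longlonglongrightarrow> C * norm (A (x s) - A (x s))"
      by (intro tendsto_mult tendsto_const tendsto_norm tendsto_diff yosida_tendsto x(1) s)
    then show "(\<lambda>n. ?g n s) \<longlonglongrightarrow> 0" by simp
  qed
  then have "(\<lambda>n. y t - Y n Q1 t \<tau> (y \<tau>)) \<longlonglongrightarrow> 0"
    by (intro Lim_null_comparison[OF always_eventually[OF allI[OF le]]]) simp
  from tendsto_diff[OF tendsto_const[of "y t"] this] have "(\<lambda>n. Y n Q1 t \<tau> (y \<tau>)) \<longlonglongrightarrow> y t" by simp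
  then have "y t = Yl Q1 t \<tau> (y \<tau>)" using Y_tendsto[OF Q1 t] LIMSEQ_unique by blast
  then show ?thesis using P_Pinv[OF tJ(1), of "x t"] by (simp add: y_def Q1_def)
qed

end

section \<open>Uniqueness among weakly continuous families\<close>

text \<open>The uniform boundedness principle is applied twice: to the functionals given by the
  inner product with \<open>S t \<tau> z\<close> for fixed \<open>z\<close>, and to the operators
  themselves.\<close>

lemma weakly_continuous_bound:
  fixes S :: "real \<Rightarrow> real \<Rightarrow> 'a::{real_inner, banach} \<Rightarrow> 'a"
  assumes lin: "\<And>t \<tau>. (t, \<tau>) \<in> Delta J \<Longrightarrow> bounded_linear (S t \<tau>)"
    and S: "weakly_continuous_family J S" and C: "compact C" "C \<subseteq> Delta J"
  shows "\<exists>M\<ge>0. \<forall>p\<in>C. \<forall>z. norm (S (fst p) (snd p) z) \<le> M * norm z"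
proof (rule banach_steinhaus)
  show "bounded_linear (S (fst p) (snd p))" if "p \<in> C" for p using that C lin by auto
  fix z
  have "\<exists>M\<ge>0. \<forall>p\<in>C. \<forall>y. norm (inner (S (fst p) (snd p) z) y) \<le> M * norm y"
  proof (rule banach_steinhaus)
    show "bounded_linear (inner (S (fst p) (snd p) z))" for p by (rule bounded_linear_inner_right)
    fix y
    have "continuous_on C (\<lambda>p. inner (S (fst p) (snd p) z) y)"
      using S C continuous_on_subset unfolding weakly_continuous_family_def by blast
    then have "bounded ((\<lambda>p. inner (S (fst p) (snd p) z) y) ` C)"
      using C compact_continuous_image compact_imp_bounded by blast
    then show "\<exists>M. \<forall>p\<in>C. norm (inner (S (fst p) (snd p) z) y) \<le> M" by (auto simp: bounded_iff)
  qed
  then obtain M where M: "M \<ge> 0" "\<And>p y. p \<in> C \<Longrightarrow> norm (inner (S (fst p) (snd p) z) y) \<le> M * norm y" by blast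
  have "norm (S (fst p) (snd p) z) \<le> M" if "p \<in> C" for p
  proof (cases "S (fst p) (snd p) z = 0")
    case False
    have "norm (S (fst p) (snd p) z) * norm (S (fst p) (snd p) z) \<le> M * norm (S (fst p) (snd p) z)"
      using M(2)[OF that, of "S (fst p) (snd p) z"] by (simp add: dot_square_norm power2_eq_square)
    then show ?thesis using False by simp
  qed (use M in simp)
  then show "\<exists>M. \<forall>p\<in>C. norm (S (fst p) (snd p) z) \<le> M" by blast
qed

text \<open>A weak integral is tested against its own value \<open>y\<close>, after which one factor
  \<open>norm y\<close> cancels.\<close>

lemma norm_le_integral_weak:
  fixes y :: "'a::real_inner" and f g :: "real \<Rightarrow> real"
  assumes int: "(f has_integral inner y y) {a..b}" and g: "continuous_on {a..b} g"
    and le: "\<And>s. s \<in> {a..b} \<Longrightarrow> norm (f s) \<le> g s * norm y"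
    and g0: "\<And>s. s \<in> {a..b} \<Longrightarrow> 0 \<le> g s"
  shows "norm y \<le> integral {a..b} g"
proof (cases "y = 0")
  case True
  have "0 \<le> integral {a..b} g" by (rule integral_nonneg[OF integrable_continuous_interval[OF g] g0])
  then show ?thesis using True by simp
next
  case False
  have "norm (inner y y) \<le> integral {a..b} (\<lambda>s. g s * norm y)"
    by (rule has_integral_norm_le[OF int _ le]) (intro continuous_intros g)
  also have "\<dots> = integral {a..b} g * norm y" by (rule integral_mult_left)
  finally have "norm y * norm y \<le> integral {a..b} g * norm y" by (simp add: dot_square_norm power2_eq_square)
  then show ?thesis using False by simp
qed

text \<open>Reverses time, because the equation of part (ii) is of Volterra type in the second
  argument.\<close>

lemma integral_reflect_shift:
  fixes g :: "real \<Rightarrow> real"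
  assumes g: "continuous_on {0..r} g" and r: "0 \<le> r"
  shows "integral {t - r..t} (\<lambda>s. g (t - s)) = integral {0..r} g"
proof -
  have "(g has_integral integral {0..r} g) (cbox 0 r)"
    using g by (simp add: integrable_integral integrable_continuous_interval)
  from has_integral_affinity[OF this, of "-1" t]
  have "((\<lambda>s. g (t - s)) has_integral integral {0..r} g) ((\<lambda>x. t - x) ` {0..r})" by simp
  moreover have "(\<lambda>x. t - x) ` {0..r} = {t - r..t}" by simp
  ultimately show ?thesis by (simp add: integral_unique)
qed

context
  fixes J :: "real set" and V Tr :: "real \<Rightarrow> real \<Rightarrow> 'a::{real_inner, banach} \<Rightarrow> 'a" and K :: "real \<Rightarrow> 'a \<Rightarrow> 'a"
  assumes J: "is_interval J" "closed J"
    and V: "strongly_cont (Delta J) (\<lambda>p. V (fst p) (snd p))" and K: "strongly_cont J K"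
    and Tr: "strongly_cont (Delta J) (\<lambda>p. Tr (fst p) (snd p))"
begin

lemma weak_equation_bounds:
  assumes lin: "\<And>t \<tau>. (t, \<tau>) \<in> Delta J \<Longrightarrow> bounded_linear (S t \<tau>)"
    and S: "weakly_continuous_family J S" and t: "(t, \<tau>) \<in> Delta J"
  obtains M CV CK where "M \<ge> 0" "CV \<ge> 0" "CK \<ge> 0"
    "\<And>s r z. \<tau> \<le> r \<Longrightarrow> r \<le> s \<Longrightarrow> s \<le> t \<Longrightarrow> norm (S s r z - Tr s r z) \<le> M * norm z"
    "\<And>s r z. \<tau> \<le> r \<Longrightarrow> r \<le> s \<Longrightarrow> s \<le> t \<Longrightarrow> norm (V s r z) \<le> CV * norm z"
    "\<And>r z. \<tau> \<le> r \<Longrightarrow> r \<le> t \<Longrightarrow> norm (K r z) \<le> CK * norm z"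
    "\<And>s r. \<tau> \<le> r \<Longrightarrow> r \<le> s \<Longrightarrow> s \<le> t \<Longrightarrow> (s, r) \<in> Delta J"
proof -
  have sub: "{\<tau>..t} \<subseteq> J" using Delta_subinterval(1)[OF J(1) t] by auto
  have subD: "Delta {\<tau>..t} \<subseteq> Delta J" by (rule Delta_mono[OF sub])
  have D: "(s, r) \<in> Delta {\<tau>..t}" if "\<tau> \<le> r" "r \<le> s" "s \<le> t" for s r using that by (auto simp: Delta_def)
  have comp: "compact (Delta {\<tau>..t})" by (rule compact_Delta) simp
  obtain M1 where M1: "M1 \<ge> 0" "\<forall>p\<in>Delta {\<tau>..t}. \<forall>z. norm (S (fst p) (snd p) z) \<le> M1 * norm z"
    using weakly_continuous_bound[OF lin S comp subD] by blast
  obtain M2 where M2: "M2 \<ge> 0" "\<forall>p\<in>Delta {\<tau>..t}. \<forall>z. norm (Tr (fst p) (snd p) z) \<le> M2 * norm z"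
    using strongly_cont_bound[OF Tr comp subD] by blast
  obtain CV where CV: "CV \<ge> 0" "\<forall>p\<in>Delta {\<tau>..t}. \<forall>z. norm (V (fst p) (snd p) z) \<le> CV * norm z"
    using strongly_cont_bound[OF V comp subD] by blast
  obtain CK where CK: "CK \<ge> 0" "\<forall>s\<in>{\<tau>..t}. \<forall>z. norm (K s z) \<le> CK * norm z"
    using strongly_cont_bound[OF K _ sub] by auto
  show ?thesis
  proof (rule that[of "M1 + M2" CV CK])
    fix s r z assume sr: "\<tau> \<le> r" "r \<le> s" "s \<le> t"
    have "norm (S s r z) \<le> M1 * norm z" "norm (Tr s r z) \<le> M2 * norm z"
      using M1(2)[rule_format, OF D[OF sr]] M2(2)[rule_format, OF D[OF sr]] by auto
    then show "norm (S s r z - Tr s r z) \<le> (M1 + M2) * norm z"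
      using norm_triangle_ineq4[of "S s r z" "Tr s r z"] by (simp add: distrib_right)
    show "norm (V s r z) \<le> CV * norm z" using CV(2)[rule_format, OF D[OF sr]] by auto
    show "(s, r) \<in> Delta J" using D[OF sr] subD by blast
  qed (use M1 M2 CV CK in auto)
qed

text \<open>The unknown is evaluated on a fixed vector \<open>x\<close> and a fixed initial time, so
  the norm of the difference along this orbit satisfies the Volterra inequality with source
  0.\<close>

lemma weak_right_unique:
  assumes lin: "\<And>t \<tau>. (t, \<tau>) \<in> Delta J \<Longrightarrow> bounded_linear (S t \<tau>)"
    and S: "weakly_continuous_family J S" and eqS: "weak_var_const_right J V K S"
    and eqT: "var_const_right J V K Tr" and t: "(t, \<tau>) \<in> Delta J"
  shows "S t \<tau> = Tr t \<tau>"
proof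
  fix x
  obtain M CV CK where b: "M \<ge> 0" "CV \<ge> 0" "CK \<ge> 0"
    "\<And>s r z. \<tau> \<le> r \<Longrightarrow> r \<le> s \<Longrightarrow> s \<le> t \<Longrightarrow> norm (S s r z - Tr s r z) \<le> M * norm z"
    "\<And>s r z. \<tau> \<le> r \<Longrightarrow> r \<le> s \<Longrightarrow> s \<le> t \<Longrightarrow> norm (V s r z) \<le> CV * norm z"
    "\<And>r z. \<tau> \<le> r \<Longrightarrow> r \<le> t \<Longrightarrow> norm (K r z) \<le> CK * norm z"
    "\<And>s r. \<tau> \<le> r \<Longrightarrow> r \<le> s \<Longrightarrow> s \<le> t \<Longrightarrow> (s, r) \<in> Delta J"
    by (rule weak_equation_bounds[OF lin S t]) (assumption | rule that)+
  let ?d = "\<lambda>s. S s \<tau> x - Tr s \<tau> x"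
  have tau: "\<tau> \<le> t" using t by (auto simp: Delta_def)
  have "norm (?d t) \<le> 0 * exp (CV * CK * (t - \<tau>))"
  proof (rule volterra_bound[where d = "\<lambda>s. norm (?d s)" and b = t and M = "M * norm x"])
    show "norm (?d s) \<le> M * norm x" if "s \<in> {\<tau>..t}" for s using that by (intro b(4)) auto
    fix s g assume s: "s \<in> {\<tau>..t}" and g: "continuous_on {\<tau>..s} g" "\<And>r. r \<in> {\<tau>..s} \<Longrightarrow> norm (?d r) \<le> g r"
    have sJ: "(s, \<tau>) \<in> Delta J" using s by (intro b(7)) auto
    have "((\<lambda>r. inner (V s r (K r (S r \<tau> x))) (?d s) - inner (V s r (K r (Tr r \<tau> x))) (?d s)) has_integral
       inner (S s \<tau> x - V s \<tau> x) (?d s) - inner (Tr s \<tau> x - V s \<tau> x) (?d s)) {\<tau>..s}"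
    proof (rule has_integral_diff)
      show "((\<lambda>r. inner (V s r (K r (S r \<tau> x))) (?d s)) has_integral inner (S s \<tau> x - V s \<tau> x) (?d s)) {\<tau>..s}"
        using eqS sJ unfolding weak_var_const_right_def by blast
      have "((\<lambda>r. V s r (K r (Tr r \<tau> x))) has_integral (Tr s \<tau> x - V s \<tau> x)) {\<tau>..s}"
        using eqT sJ unfolding var_const_right_def by blast
      from has_integral_linear[OF this bounded_linear_inner_left]
      show "((\<lambda>r. inner (V s r (K r (Tr r \<tau> x))) (?d s)) has_integral inner (Tr s \<tau> x - V s \<tau> x) (?d s)) {\<tau>..s}"
        by (simp add: o_def)
    qed
    moreover have "inner (S s \<tau> x - V s \<tau> x) (?d s) - inner (Tr s \<tau> x - V s \<tau> x) (?d s) = inner (?d s) (?d s)"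
      by (simp add: inner_diff_left)
    ultimately have int: "((\<lambda>r. inner (V s r (K r (S r \<tau> x))) (?d s) - inner (V s r (K r (Tr r \<tau> x))) (?d s)) has_integral
       inner (?d s) (?d s)) {\<tau>..s}" by (simp only:)
    have g0: "0 \<le> g r" if "r \<in> {\<tau>..s}" for r using norm_ge_zero g(2)[OF that] by (rule order_trans)
    have "norm (?d s) \<le> integral {\<tau>..s} (\<lambda>r. CV * CK * g r)"
    proof (rule norm_le_integral_weak[OF int])
      show "continuous_on {\<tau>..s} (\<lambda>r. CV * CK * g r)" by (intro continuous_intros g)
      fix r assume r: "r \<in> {\<tau>..s}"
      show "0 \<le> CV * CK * g r" using b g0[OF r] by simp
      have sr: "(s, r) \<in> Delta J" "(r, r) \<in> Delta J" using r s by (auto intro!: b(7))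
      have linV: "linear (V s r)" "linear (K r)"
        using strongly_contD(1)[OF V sr(1)] strongly_contD(1)[OF K, of r] sr(2) bounded_linear.linear by (auto simp: Delta_def)
      have "inner (V s r (K r (S r \<tau> x))) (?d s) - inner (V s r (K r (Tr r \<tau> x))) (?d s) = inner (V s r (K r (?d r))) (?d s)"
        by (simp add: linear_diff[OF linV(1)] linear_diff[OF linV(2)] inner_diff_left)
      also have "norm (inner (V s r (K r (?d r))) (?d s)) \<le> norm (V s r (K r (?d r))) * norm (?d s)"
        using Cauchy_Schwarz_ineq2 by simp
      finally have 1: "norm (inner (V s r (K r (S r \<tau> x))) (?d s) - inner (V s r (K r (Tr r \<tau> x))) (?d s))
        \<le> norm (V s r (K r (?d r))) * norm (?d s)" .
      have "norm (V s r (K r (?d r))) \<le> CV * norm (K r (?d r))" using r s by (intro b(5)) auto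
      also have "\<dots> \<le> CV * (CK * norm (?d r))" using r s by (intro mult_left_mono b) auto
      also have "\<dots> \<le> CV * (CK * g r)" using b by (intro mult_left_mono g(2)[OF r]) auto
      finally have "norm (V s r (K r (?d r))) * norm (?d s) \<le> CV * CK * g r * norm (?d s)"
        by (intro mult_right_mono) (auto simp: mult.assoc)
      with 1 show "norm (inner (V s r (K r (S r \<tau> x))) (?d s) - inner (V s r (K r (Tr r \<tau> x))) (?d s)) \<le> CV * CK * g r * norm (?d s)"
        by (rule order_trans)
    qed
    then show "norm (?d s) \<le> 0 + integral {\<tau>..s} (\<lambda>r. CV * CK * g r)" by simp
  qed (use b tau in auto)
  then show "S t \<tau> x = Tr t \<tau> x" by simp
qed

text \<open>Under the integral the unknown acts on the varying vectors
  \<open>K s (V s \<tau> x)\<close>, so an estimate for one vector does not close. The iteration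
  runs on operator norms, with the final time \<open>t\<close> fixed and the initial time moving
  backwards.\<close>

lemma weak_left_unique:
  assumes lin: "\<And>t \<tau>. (t, \<tau>) \<in> Delta J \<Longrightarrow> bounded_linear (S t \<tau>)"
    and S: "weakly_continuous_family J S" and eqS: "weak_var_const_left J V K S"
    and eqT: "var_const_left J V K Tr" and t: "(t, \<tau>) \<in> Delta J"
  shows "S t \<tau> = Tr t \<tau>"
proof -
  obtain M CV CK where b: "M \<ge> 0" "CV \<ge> 0" "CK \<ge> 0"
    "\<And>s r z. \<tau> \<le> r \<Longrightarrow> r \<le> s \<Longrightarrow> s \<le> t \<Longrightarrow> norm (S s r z - Tr s r z) \<le> M * norm z"
    "\<And>s r z. \<tau> \<le> r \<Longrightarrow> r \<le> s \<Longrightarrow> s \<le> t \<Longrightarrow> norm (V s r z) \<le> CV * norm z"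
    "\<And>r z. \<tau> \<le> r \<Longrightarrow> r \<le> t \<Longrightarrow> norm (K r z) \<le> CK * norm z"
    "\<And>s r. \<tau> \<le> r \<Longrightarrow> r \<le> s \<Longrightarrow> s \<le> t \<Longrightarrow> (s, r) \<in> Delta J"
    by (rule weak_equation_bounds[OF lin S t]) (assumption | rule that)+
  \<comment> \<open>\<open>q\<close> is the length of the interval ending at \<open>t\<close>; in
    this variable the equation is an ordinary forward Volterra equation.\<close>
  define E where "E q x = S t (t - q) x - Tr t (t - q) x" for q x
  have tau: "\<tau> \<le> t" using t by (auto simp: Delta_def)
  have tq: "(t, t - q) \<in> Delta J" if "q \<in> {0..t - \<tau>}" for q using that by (intro b(7)) auto
  have linE: "bounded_linear (E q)" if "q \<in> {0..t - \<tau>}" for q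
    unfolding E_def[abs_def] using lin[OF tq[OF that]] strongly_contD(1)[OF Tr tq[OF that]]
    by (auto intro: bounded_linear_sub)
  have EM: "norm (E q x) \<le> M * norm x" if "q \<in> {0..t - \<tau>}" for q x
    unfolding E_def using that by (intro b(4)) auto
  have "onorm (E (t - \<tau>)) \<le> 0 * exp (CK * CV * (t - \<tau> - 0))"
  proof (rule volterra_bound[where d = "\<lambda>q. onorm (E q)" and b = "t - \<tau>" and M = M])
    show "onorm (E q) \<le> M" if "q \<in> {0..t - \<tau>}" for q
      using EM[OF that] b(1) by (intro onorm_bound) auto
    fix q g assume q: "q \<in> {0..t - \<tau>}" and g: "continuous_on {0..q} g" "\<And>r. r \<in> {0..q} \<Longrightarrow> onorm (E r) \<le> g r"
    have g0: "0 \<le> g r" if "r \<in> {0..q}" for r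
      using onorm_pos_le[OF linE[of r]] g(2)[OF that] that q by auto
    let ?u = "t - q"
    have gt: "continuous_on {?u..t} (\<lambda>s. g (t - s))"
      by (rule continuous_on_compose2[OF g(1)]) (auto intro!: continuous_intros)
    have refl: "integral {?u..t} (\<lambda>s. CK * CV * g (t - s)) = integral {0..q} (\<lambda>r. CK * CV * g r)"
    proof (rule integral_reflect_shift)
      show "continuous_on {0..q} (\<lambda>r. CK * CV * g r)" by (intro continuous_intros g(1))
    qed (use q in simp)
    have "onorm (E q) \<le> integral {0..q} (\<lambda>r. CK * CV * g r)"
    proof (rule onorm_bound)
      show "0 \<le> integral {0..q} (\<lambda>r. CK * CV * g r)"
        using b g0 by (intro integral_nonneg integrable_continuous_interval continuous_intros g(1)) auto
      fix x
      let ?y = "E q x"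
      note uJ = tq[OF q]
      have "((\<lambda>s. inner (S t s (K s (V s ?u x))) ?y - inner (Tr t s (K s (V s ?u x))) ?y) has_integral
         inner (S t ?u x - V t ?u x) ?y - inner (Tr t ?u x - V t ?u x) ?y) {?u..t}"
      proof (rule has_integral_diff)
        show "((\<lambda>s. inner (S t s (K s (V s ?u x))) ?y) has_integral inner (S t ?u x - V t ?u x) ?y) {?u..t}"
          using eqS uJ unfolding weak_var_const_left_def by blast
        have "((\<lambda>s. Tr t s (K s (V s ?u x))) has_integral (Tr t ?u x - V t ?u x)) {?u..t}"
          using eqT uJ unfolding var_const_left_def by blast
        from has_integral_linear[OF this bounded_linear_inner_left]
        show "((\<lambda>s. inner (Tr t s (K s (V s ?u x))) ?y) has_integral inner (Tr t ?u x - V t ?u x) ?y) {?u..t}"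
          by (simp add: o_def)
      qed
      moreover have "inner (S t ?u x - V t ?u x) ?y - inner (Tr t ?u x - V t ?u x) ?y = inner ?y ?y"
        by (simp add: E_def inner_diff_left)
      ultimately have int: "((\<lambda>s. inner (S t s (K s (V s ?u x))) ?y - inner (Tr t s (K s (V s ?u x))) ?y) has_integral
         inner ?y ?y) {?u..t}" by (simp only:)
      have "norm ?y \<le> integral {?u..t} (\<lambda>s. CK * CV * g (t - s) * norm x)"
      proof (rule norm_le_integral_weak[OF int])
        show "continuous_on {?u..t} (\<lambda>s. CK * CV * g (t - s) * norm x)" by (intro continuous_intros gt)
        fix s assume s: "s \<in> {?u..t}"
        have ts: "t - s \<in> {0..q}" "t - s \<in> {0..t - \<tau>}" using s q by auto
        show "0 \<le> CK * CV * g (t - s) * norm x" using b g0[OF ts(1)] by simp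
        let ?v = "K s (V s ?u x)"
        have "inner (S t s ?v) ?y - inner (Tr t s ?v) ?y = inner (E (t - s) ?v) ?y"
          by (simp add: E_def inner_diff_left)
        also have "norm (inner (E (t - s) ?v) ?y) \<le> norm (E (t - s) ?v) * norm ?y"
          using Cauchy_Schwarz_ineq2 by simp
        finally have 1: "norm (inner (S t s ?v) ?y - inner (Tr t s ?v) ?y) \<le> norm (E (t - s) ?v) * norm ?y" .
        have "norm ?v \<le> CK * norm (V s ?u x)" using s q by (intro b(6)) auto
        also have "\<dots> \<le> CK * (CV * norm x)" using s q b by (intro mult_left_mono b(5)) auto
        finally have v: "norm ?v \<le> CK * (CV * norm x)" .
        have "norm (E (t - s) ?v) \<le> onorm (E (t - s)) * norm ?v" by (rule onorm[OF linE[OF ts(2)]])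
        also have "\<dots> \<le> g (t - s) * (CK * (CV * norm x))"
          by (rule mult_mono[OF g(2)[OF ts(1)] v g0[OF ts(1)] norm_ge_zero])
        finally have "norm (E (t - s) ?v) * norm ?y \<le> CK * CV * g (t - s) * norm x * norm ?y"
          by (intro mult_right_mono) (auto simp: mult_ac)
        with 1 show "norm (inner (S t s ?v) ?y - inner (Tr t s ?v) ?y) \<le> CK * CV * g (t - s) * norm x * norm ?y"
          by (rule order_trans)
      qed
      also have "\<dots> = integral {?u..t} (\<lambda>s. CK * CV * g (t - s)) * norm x" by (rule integral_mult_left)
      finally show "norm ?y \<le> integral {0..q} (\<lambda>r. CK * CV * g r) * norm x" unfolding refl .
    qed
    then show "onorm (E q) \<le> 0 + integral {0..q} (\<lambda>r. CK * CV * g r)" by simp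
  qed (use b tau in auto)
  then have "onorm (E (t - \<tau>)) \<le> 0" by simp
  moreover have "norm (E (t - \<tau>) x) \<le> onorm (E (t - \<tau>)) * norm x" for x
    using tau by (intro onorm linE) auto
  ultimately have "norm (E (t - \<tau>) x) \<le> 0" for x
    by (meson mult_nonpos_nonneg norm_ge_zero order_trans)
  then show ?thesis by (auto simp: E_def fun_eq_iff)
qed

end

section \<open>The averages \<open>G\<^sub>n\<close> and the limit theorem\<close>

context
  fixes J :: "real set" and G :: "real \<Rightarrow> 'a::banach \<Rightarrow> 'a"
  assumes J: "is_interval J" "closed J" "J \<noteq> {}" and G: "strongly_cont J G"
begin

text \<open>Extension of \<open>G\<close> that is constant on both sides of \<open>J\<close>, hence
  strongly continuous on the whole line. To the right of any point of \<open>J\<close> it agrees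
  with \<open>Gext\<close>.\<close>

definition Gx :: "real \<Rightarrow> 'a \<Rightarrow> 'a" where "Gx s = G (closest_point J s)"

lemma closest_in: "closest_point J s \<in> J"
  using closest_point_in_set[OF J(2,3)] .

lemma Gx_strongly_cont: "strongly_cont UNIV Gx"
  unfolding strongly_cont_def Gx_def
proof (intro conjI ballI allI)
  show "bounded_linear (G (closest_point J t))" for t by (rule strongly_contD(1)[OF G closest_in])
  have "convex J" using J(1) is_interval_convex by blast
  then have "continuous_on UNIV (closest_point J)" by (rule continuous_on_closest_point[OF _ J(2,3)])
  then show "continuous_on UNIV (\<lambda>t. G (closest_point J t) z)" for z
    using continuous_on_compose2[OF strongly_contD(2)[OF G, of z]] closest_in by blast
qed

lemma Gx_eq: "s \<in> J \<Longrightarrow> Gx s = G s"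
  by (simp add: Gx_def closest_point_self)

lemma Gext_eq_Gx:
  assumes t: "t \<in> J" "t \<le> s"
  shows "Gext J G s = Gx s"
proof (cases "s \<in> J")
  case True
  then have "\<not> (bdd_above J \<and> Sup J < s)" using cSup_upper not_less by blast
  then have "Gext J G s = G s" unfolding Gext_def by (simp only: if_False)
  then show ?thesis using Gx_eq[OF True] by simp
next
  case False
  have less: "x < s" if "x \<in> J" for x
    using that mem_is_interval_1_I[OF J(1) t(1) that t(2)] False by (meson not_less)
  then have bdd: "bdd_above J" by (meson bdd_aboveI less_imp_le)
  then have sup: "Sup J \<in> J" using closed_contains_Sup[OF J(3) _ J(2)] by blast
  have "closest_point J s = Sup J"
  proof (rule closest_point_unique[symmetric])
    show "convex J" using J(1) is_interval_convex by blast
    show "\<forall>z\<in>J. dist s (Sup J) \<le> dist s z"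
    proof
      fix z assume z: "z \<in> J"
      have "z \<le> Sup J" using cSup_upper[OF z bdd] .
      then show "dist s (Sup J) \<le> dist s z" using less[OF sup] by (simp add: dist_real_def)
    qed
  qed (use J(2) sup in auto)
  then show ?thesis using bdd less[OF sup] by (simp add: Gext_def Gx_def)
qed

lemma Gn_average:
  assumes t: "t \<in> J"
  shows "Gn J G (Suc n) t z = integral {0..1} (\<lambda>r. Gx (t + r / real (Suc n)) z)"
proof -
  let ?h = "1 / real (Suc n)"
  have "integral {t..t + ?h} (\<lambda>s. Gext J G s z) = integral {t..t + ?h} (\<lambda>s. Gx s z)"
    by (rule integral_cong) (simp add: Gext_eq_Gx[OF t])
  also have "\<dots> = (t + ?h - t) *\<^sub>R integral {0..1} (\<lambda>r. Gx (t + r * (t + ?h - t)) z)"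
    by (rule integral_unit_reparam[OF _ continuous_on_subset[OF strongly_contD(2)[OF Gx_strongly_cont]]]) auto
  also have "\<dots> = ?h *\<^sub>R integral {0..1} (\<lambda>r. Gx (t + r / real (Suc n)) z)" by simp
  finally have "Gn J G (Suc n) t z = real (Suc n) *\<^sub>R ?h *\<^sub>R integral {0..1} (\<lambda>r. Gx (t + r / real (Suc n)) z)"
    unfolding Gn_def by (simp only:)
  then show ?thesis by simp
qed

lemma Gx_average_continuous: "continuous_on S (\<lambda>r. Gx (t + r / c) z)"
  by (rule continuous_on_compose2[OF strongly_contD(2)[OF Gx_strongly_cont]]) (auto simp: divide_inverse intro!: continuous_intros)

text \<open>The index 0 is degenerate: the factor \<open>real n\<close> vanishes, so the average is
  the zero operator and still a legitimate perturbation.\<close>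

lemma Gn_0: "Gn J G 0 t z = 0"
  by (simp add: Gn_def)

lemma Gn_bound: "\<exists>C\<ge>0. \<forall>n. \<forall>t\<in>J \<inter> {-m..m}. \<forall>z. norm (Gn J G n t z) \<le> C * norm z"
proof -
  \<comment> \<open>The averages reach at most 1 beyond the right end of the window.\<close>
  obtain C where C: "C \<ge> 0" "\<And>s z. s \<in> {-m..m+1} \<Longrightarrow> norm (Gx s z) \<le> C * norm z"
    using strongly_cont_bound[OF Gx_strongly_cont, of "{-m..m+1}"] by auto
  have "norm (Gn J G n t z) \<le> C * norm z" if t: "t \<in> J \<inter> {-m..m}" for n t z
  proof (cases n)
    case 0
    then show ?thesis using C(1) by (simp add: Gn_0)
  next
    case (Suc k)
    have "norm (integral {0..1} (\<lambda>r. Gx (t + r / real (Suc k)) z)) \<le> integral {0..1::real} (\<lambda>r. C * norm z)"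
    proof (rule integral_norm_bound_integral)
      show "(\<lambda>r. Gx (t + r / real (Suc k)) z) integrable_on {0..1}"
        by (rule integrable_continuous_interval[OF Gx_average_continuous])
      fix r :: real assume r: "r \<in> {0..1}"
      then have "0 \<le> r / real (Suc k)" "r / real (Suc k) \<le> 1" by (simp_all add: divide_le_eq del: of_nat_Suc)
      then have "t + r / real (Suc k) \<in> {-m..m + 1}" using t unfolding Int_iff atLeastAtMost_iff by linarith
      then show "norm (Gx (t + r / real (Suc k)) z) \<le> C * norm z" by (rule C(2))
    qed auto
    then show ?thesis using Suc Gn_average[of t k z] t by simp
  qed
  then show ?thesis using C(1) by blast
qed

lemma Gn_linear:
  assumes t: "t \<in> J" shows "bounded_linear (Gn J G n t)"
proof -
  have "t \<in> J \<inter> {-\<bar>t\<bar>..\<bar>t\<bar>}" using t by auto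
  then obtain C where C: "\<And>z. norm (Gn J G n t z) \<le> C * norm z" using Gn_bound[of "\<bar>t\<bar>"] by blast
  have lin: "bounded_linear (Gx s)" for s using strongly_contD(1)[OF Gx_strongly_cont, of s] by simp
  have int: "(\<lambda>r. Gx (t + r / real (Suc k)) z) integrable_on {0..1}" for k z
    by (rule integrable_continuous_interval[OF Gx_average_continuous])
  show ?thesis
  proof (cases n)
    case 0
    then have "Gn J G n t = (\<lambda>z. 0)" using Gn_0 by (simp add: fun_eq_iff)
    then show ?thesis by simp
  next
    case (Suc k)
    show ?thesis
    proof (rule bounded_linear_intro[where K = C])
      show "Gn J G n t (x + y) = Gn J G n t x + Gn J G n t y" for x y
        unfolding Suc Gn_average[OF t] by (simp only: linear_simps(1)[OF lin] integral_add[OF int int])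
      show "Gn J G n t (c *\<^sub>R x) = c *\<^sub>R Gn J G n t x" for c x
        unfolding Suc Gn_average[OF t] by (simp only: linear_simps(5)[OF lin] integral_cmul)
      show "norm (Gn J G n t x) \<le> norm x * C" for x using C[of x] by (simp add: mult.commute)
    qed
  qed
qed

lemma Gn_tendsto:
  assumes t: "t \<in> J" shows "(\<lambda>n. Gn J G n t z) \<longlonglongrightarrow> G t z"
proof -
  obtain C where C: "\<And>s z. s \<in> {t..t+1} \<Longrightarrow> norm (Gx s z) \<le> C * norm z"
    using strongly_cont_bound[OF Gx_strongly_cont compact_Icc subset_UNIV, of t "t + 1"] by blast
  have "(\<lambda>n. integral {0..1} (\<lambda>r. Gx (t + r / real (Suc n)) z)) \<longlonglongrightarrow> integral {0..1::real} (\<lambda>r. G t z)"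
  proof (rule integral_dominated_continuous[OF Gx_average_continuous continuous_on_const])
    fix r :: real assume r: "r \<in> {0..1}"
    show "norm (Gx (t + r / real (Suc n)) z) \<le> C * norm z" for n
    proof -
      have "0 \<le> r / real (Suc n)" "r / real (Suc n) \<le> 1" using r by (simp_all add: divide_le_eq del: of_nat_Suc)
      then show ?thesis by (intro C) simp
    qed
    have "(\<lambda>n. t + r / real (Suc n)) \<longlonglongrightarrow> t + 0"
      using tendsto_mult_right[OF LIMSEQ_inverse_real_of_nat, of r]
      by (intro tendsto_add tendsto_const) (simp add: divide_inverse mult.commute)
    then have "(\<lambda>n. Gx (t + r / real (Suc n)) z) \<longlonglongrightarrow> Gx t z"
      using continuous_on_tendsto_compose[OF strongly_contD(2)[OF Gx_strongly_cont]] by simp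
    then show "(\<lambda>n. Gx (t + r / real (Suc n)) z) \<longlonglongrightarrow> G t z" by (simp add: Gx_eq[OF t])
  qed
  then have "(\<lambda>n. Gn J G (Suc n) t z) \<longlonglongrightarrow> G t z" by (simp add: Gn_average[OF t])
  then show ?thesis by (rule LIMSEQ_imp_Suc)
qed

text \<open>Averaging makes a strongly continuous \<open>G\<close> strongly C^1, with this forward
  difference as derivative; \<open>classical_solution\<close> asks for such a perturbation.\<close>

definition Gn_deriv :: "nat \<Rightarrow> real \<Rightarrow> 'a \<Rightarrow> 'a" where
  "Gn_deriv n t z = real n *\<^sub>R (Gx (t + 1 / real n) z - Gx t z)"

lemma Gn_deriv_strongly_cont: "strongly_cont J (Gn_deriv n)"
proof -
  have "strongly_cont J (\<lambda>t. Gx (t + 1 / real n))"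
    unfolding strongly_cont_def
    using strongly_contD(1)[OF Gx_strongly_cont]
    by (auto intro!: continuous_on_compose2[OF strongly_contD(2)[OF Gx_strongly_cont]] continuous_intros)
  then have "strongly_cont J (\<lambda>t z. Gx (t + 1 / real n) z - Gx t z)"
    by (rule strongly_cont_add(2)[OF _ strongly_cont_subset[OF Gx_strongly_cont subset_UNIV]])
  then show ?thesis
    unfolding Gn_deriv_def[abs_def] by (rule strongly_cont_compose[OF strongly_cont_const[OF bounded_linear_scaleR_right]])
qed

lemma Gn_has_deriv:
  assumes t: "t \<in> J"
  shows "((\<lambda>t. Gn J G n t z) has_vector_derivative Gn_deriv n t z) (at t within J)"
proof (cases "n = 0")
  case True
  then show ?thesis by (simp add: Gn_0 Gn_deriv_def)
next
  case False
  define h where "h = 1 / real n"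
  have h: "0 < h" "h \<le> 1" using False by (auto simp: h_def divide_le_eq)
  have gc: "continuous_on S (\<lambda>s. Gx s z)" for S
    using strongly_contD(2)[OF Gx_strongly_cont] continuous_on_subset by blast
  \<comment> \<open>The antiderivative starts at \<open>t - 1\<close>, so that both \<open>t\<close>
    and \<open>t + h\<close> are interior points and \<open>F\<close> has a two-sided derivative
    there.\<close>
  define F where "F u = integral {t - 1..u} (\<lambda>s. Gx s z)" for u
  have F: "(F has_vector_derivative Gx u z) (at u)" if "t - 1 < u" "u < t + 3" for u
    using integral_has_vector_derivative[OF gc, of u "t - 1" "t + 3"] that at_within_Icc_at[OF that]
    unfolding F_def by simp
  have "(F \<circ> (\<lambda>r. r + h) has_vector_derivative 1 *\<^sub>R Gx (t + h) z) (at t)"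
  proof (rule vector_diff_chain_at)
    show "((\<lambda>r. r + h) has_vector_derivative 1) (at t)"
      unfolding has_real_derivative_iff_has_vector_derivative[symmetric] by (auto intro!: derivative_eq_intros)
    show "(F has_vector_derivative Gx (t + h) z) (at (t + h))" using h by (intro F) auto
  qed
  then have 1: "((\<lambda>r. F (r + h)) has_vector_derivative Gx (t + h) z) (at t)" by (simp add: o_def)
  have "((\<lambda>r. real n *\<^sub>R (F (r + h) - F r)) has_vector_derivative real n *\<^sub>R (Gx (t + h) z - Gx t z)) (at t)"
    by (rule bounded_linear.has_vector_derivative[OF bounded_linear_scaleR_right has_vector_derivative_diff[OF 1 F]]) auto
  then have "((\<lambda>r. real n *\<^sub>R (F (r + h) - F r)) has_vector_derivative real n *\<^sub>R (Gx (t + h) z - Gx t z)) (at t within J)"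
    by (rule has_vector_derivative_at_within)
  then have "((\<lambda>r. Gn J G n r z) has_vector_derivative real n *\<^sub>R (Gx (t + h) z - Gx t z)) (at t within J)"
  proof (rule has_vector_derivative_transform_within[OF _ zero_less_one t])
    fix r assume r: "r \<in> J" "dist r t < 1"
    have "integral {r..r + h} (\<lambda>s. Gext J G s z) = integral {r..r + h} (\<lambda>s. Gx s z)"
      by (rule integral_cong) (simp add: Gext_eq_Gx[OF r(1)])
    moreover have "F r + integral {r..r + h} (\<lambda>s. Gx s z) = F (r + h)"
      unfolding F_def
      by (rule Henstock_Kurzweil_Integration.integral_combine)
        (use r h in \<open>auto simp: dist_real_def intro!: integrable_continuous_interval gc\<close>)
    ultimately show "real n *\<^sub>R (F (r + h) - F r) = Gn J G n r z"
      unfolding Gn_def h_def by (metis add_diff_cancel_left')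
  qed
  then show ?thesis by (simp add: Gn_deriv_def h_def)
qed

lemma Gn_strongly_cont: "strongly_cont J (Gn J G n)"
  unfolding strongly_cont_def
proof (intro conjI ballI allI Gn_linear)
  show "continuous_on J (\<lambda>t. Gn J G n t z)" for z
    using Gn_has_deriv by (meson continuous_on_eq_continuous_within has_vector_derivative_continuous)
qed

lemma Gn_commute:
  assumes T: "bounded_linear T" and GT: "\<And>t x. t \<in> J \<Longrightarrow> G t (T x) = T (G t x)" and t: "t \<in> J"
  shows "Gn J G n t (T x) = T (Gn J G n t x)"
proof (cases n)
  case 0
  then show ?thesis using T by (simp add: Gn_0 linear_simps)
next
  case (Suc k)
  have "Gx s (T x) = T (Gx s x)" for s unfolding Gx_def by (rule GT[OF closest_in])
  then have "integral {0..1} (\<lambda>r. Gx (t + r / real (Suc k)) (T x)) = integral {0..1} (T \<circ> (\<lambda>r. Gx (t + r / real (Suc k)) x))"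
    by (simp add: o_def)
  also have "\<dots> = T (integral {0..1} (\<lambda>r. Gx (t + r / real (Suc k)) x))"
    by (rule integral_linear[OF integrable_continuous_interval[OF Gx_average_continuous] T])
  finally show ?thesis unfolding Suc Gn_average[OF t] .
qed

end

text \<open>\<open>V\<close>, \<open>K\<close> and \<open>R\<close> are parameters here. Thus
  neither \<open>SOME\<close>, \<open>THE\<close> nor \<open>lim\<close> occurs, and the statement
  can be transferred to another type as a single constant.\<close>

definition abstract_conclusion where
  "abstract_conclusion ci J R P G V K Tr \<longleftrightarrow>
      evolution_family ci J Tr \<and> var_const_right J V K Tr
      \<and> (\<forall>T. evolution_family ci J T \<and> var_const_right J V K T
             \<longrightarrow> (\<forall>t \<tau>. (t, \<tau>) \<in> Delta J \<longrightarrow> T t \<tau> = Tr t \<tau>))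
      \<and> var_const_left J V K Tr
      \<and> (\<forall>T. evolution_family ci J T \<and> var_const_left J V K T
             \<longrightarrow> (\<forall>t \<tau>. (t, \<tau>) \<in> Delta J \<longrightarrow> T t \<tau> = Tr t \<tau>))
      \<and> (\<forall>S. (\<forall>t \<tau>. (t, \<tau>) \<in> Delta J \<longrightarrow> cblin ci (S t \<tau>))
             \<and> weakly_continuous_family J S \<and> weak_var_const_right J V K S
             \<longrightarrow> (\<forall>t \<tau>. (t, \<tau>) \<in> Delta J \<longrightarrow> S t \<tau> = Tr t \<tau>))
      \<and> (\<forall>S. (\<forall>t \<tau>. (t, \<tau>) \<in> Delta J \<longrightarrow> cblin ci (S t \<tau>))
             \<and> weakly_continuous_family J S \<and> weak_var_const_left J V K S
             \<longrightarrow> (\<forall>t \<tau>. (t, \<tau>) \<in> Delta J \<longrightarrow> S t \<tau> = Tr t \<tau>))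
      \<and> (\<forall>\<tau>\<in>J. (\<exists>t\<in>J. \<tau> < t) \<longrightarrow> (\<forall>x\<^sub>\<tau>.
            is_C1_on (Jge J \<tau>) (\<lambda>t. R (Tr t \<tau> x\<^sub>\<tau>))
              (\<lambda>t. (R (P t (Tr t \<tau> x\<^sub>\<tau>)) - P t (Tr t \<tau> x\<^sub>\<tau>)) + R (G t (Tr t \<tau> x\<^sub>\<tau>)))
            \<and> Tr \<tau> \<tau> x\<^sub>\<tau> = x\<^sub>\<tau>))"

lemma var_const_imp_weak:
  fixes V :: "real \<Rightarrow> real \<Rightarrow> 'a \<Rightarrow> 'a::real_inner"
  shows "var_const_right J V K T \<Longrightarrow> weak_var_const_right J V K T"
    "var_const_left J V K T \<Longrightarrow> weak_var_const_left J V K T"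
proof -
  have *: "((\<lambda>s. inner (f s) y) has_integral inner I y) {a..b}" if "(f has_integral I) {a..b}" for f :: "real \<Rightarrow> 'a" and I y a b
    using has_integral_linear[OF that bounded_linear_inner_left[of y]] by (simp add: o_def)
  show "var_const_right J V K T \<Longrightarrow> weak_var_const_right J V K T"
    unfolding var_const_right_def weak_var_const_right_def using * by blast
  show "var_const_left J V K T \<Longrightarrow> weak_var_const_left J V K T"
    unfolding var_const_left_def weak_var_const_left_def using * by blast
qed

lemma evolution_family_weakly_continuous:
  fixes T :: "real \<Rightarrow> real \<Rightarrow> 'a \<Rightarrow> 'a::real_inner"
  assumes "evolution_family ci J T"
  shows "weakly_continuous_family J T"
  using assms unfolding evolution_family_def weakly_continuous_family_def
  by (auto intro: continuous_on_inner continuous_on_const)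

text \<open>Choice-free form: it speaks of all sequences of generated families and of all maps
  \<open>R\<close> inverting I - \<open>A\<close>. The choice operators hidden in \<open>Tn\<close>
  and \<open>resolvent1\<close> are then discharged by the existence and uniqueness facts stated
  alongside.\<close>

theorem perturbed_evolution_banach:
  fixes ci :: "'a::{real_inner, banach} \<Rightarrow> 'a"
    and D :: "'a set" and A :: "'a \<Rightarrow> 'a"
    and J :: "real set"
    and P Pinv Pd G :: "real \<Rightarrow> 'a \<Rightarrow> 'a"
  assumes cs: "complex_structure ci"
    and gen: "generates_c0_contraction ci D A"
    and J: "time_interval J"
    and P_lin: "\<forall>t\<in>J. cblin ci (P t)"
    and P_sa: "\<forall>t\<in>J. \<forall>x y. inner (P t x) y = inner x (P t y)"
    and P_nonneg: "\<forall>t\<in>J. \<forall>x. 0 \<le> inner (P t x) x"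
    and Pinv_lin: "\<forall>t\<in>J. cblin ci (Pinv t)"
    and Pinv_inv: "\<forall>t\<in>J. \<forall>x. P t (Pinv t x) = x \<and> Pinv t (P t x) = x"
    and P_C1: "\<forall>z. is_C1_on J (\<lambda>t. P t z) (\<lambda>t. Pd t z)"
    and Pinv_C1: "\<forall>z. \<exists>d. is_C1_on J (\<lambda>t. Pinv t z) d"
    and G_lin: "\<forall>t\<in>J. cblin ci (G t)"
    and G_cont: "\<forall>z. continuous_on J (\<lambda>t. G t z)"
  defines "gen_n \<equiv> \<lambda>n U. evolution_family ci J U \<and>
      generates_evol J (\<lambda>_. D) (\<lambda>t x. P t (A x) + P t (Gn J G n t (Pinv t x))) U"
  shows "(\<forall>y. \<exists>x\<in>D. x - A x = y) \<and> (\<forall>x\<in>D. \<forall>y\<in>D. x - A x = y - A y \<longrightarrow> x = y) \<and> (\<exists>V Tr. (\<forall>n. \<exists>U. gen_n n U)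
    \<and> (\<forall>U. (\<forall>n. gen_n n (U n)) \<longrightarrow> (\<forall>t \<tau> z. (t, \<tau>) \<in> Delta J \<longrightarrow> (\<lambda>n. U n t \<tau> (P \<tau> z)) \<longlonglongrightarrow> P t (V t \<tau> z)))
    \<and> (\<forall>R. (\<forall>y. R y \<in> D \<and> R y - A (R y) = y) \<longrightarrow>
          abstract_conclusion ci J R P G V (\<lambda>s z. Pinv s (Pd s z)) Tr))"
proof -
  have ci: "bounded_linear ci" using cs by (simp add: complex_structure_def)
  have Jc: "is_interval J" "closed J" "J \<noteq> {}" using J by (auto simp: time_interval_def)
  obtain S where S: "c0_semigroup ci S" "\<And>t x. t \<ge> 0 \<Longrightarrow> norm (S t x) \<le> norm x" "sg_generator S D A"
    using gen unfolding generates_c0_contraction_def by blast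
  interpret dissipative_generator D A by (rule generator_dissipative[OF S])
  have A_ci: "ci x \<in> D \<and> A (ci x) = ci (A x)" if "x \<in> D" for x
    by (rule generator_commute[OF S that ci])
  have cont_of_C1: "continuous_on J f" if "is_C1_on J f f'" for f f' :: "real \<Rightarrow> 'a"
    using that unfolding is_C1_on_def by (meson continuous_on_eq_continuous_within has_vector_derivative_continuous)
  have Ps: "strongly_cont J P" using P_lin P_C1 cont_of_C1 unfolding strongly_cont_def cblin_def by blast
  have Pinvs: "strongly_cont J Pinv" using Pinv_lin Pinv_C1 cont_of_C1 unfolding strongly_cont_def cblin_def by blast
  have Gs: "strongly_cont J G" using G_lin G_cont unfolding strongly_cont_def cblin_def by blast
  have Pder: "((\<lambda>t. P t z) has_vector_derivative Pd t z) (at t within J)" if "t \<in> J" for t z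
    using P_C1 that unfolding is_C1_on_def by blast
  \<comment> \<open>No point of \<open>J\<close> is isolated, because \<open>J\<close> has positive
    length. Hence \<open>Pd t\<close> is a limit of difference quotients and inherits linearity and
    compatibility with \<open>ci\<close> from \<open>P\<close>.\<close>
  have approach: "\<exists>X. (\<forall>n. X n \<in> J - {t}) \<and> X \<longlonglongrightarrow> t" if t: "t \<in> J" for t
  proof -
    obtain b where b: "b \<in> J" "b \<noteq> t" using J unfolding time_interval_def by (metis less_irrefl)
    have cv: "convex J" using Jc(1) is_interval_convex by blast
    let ?X = "\<lambda>n. t + inverse (real (Suc n)) * (b - t)"
    have "?X n \<in> J" for n
    proof -
      have "(1 - inverse (real (Suc n))) *\<^sub>R t + inverse (real (Suc n)) *\<^sub>R b \<in> J"
        using cv t b(1) by (intro convexD_alt) (auto simp: inverse_le_1_iff)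
      then show ?thesis by (simp add: algebra_simps)
    qed
    moreover have "?X n \<noteq> t" for n using b(2) by simp
    moreover have "?X \<longlonglongrightarrow> t + 0 * (b - t)" by (intro tendsto_intros LIMSEQ_inverse_real_of_nat)
    ultimately show ?thesis by (intro exI[of _ ?X]) auto
  qed
  have Pd_lim: "\<exists>X. (\<forall>n. X n \<in> J) \<and> (\<forall>z. (\<lambda>n. (P (X n) z - P t z) /\<^sub>R (X n - t)) \<longlonglongrightarrow> Pd t z)" if t: "t \<in> J" for t
  proof -
    obtain X where X: "\<forall>n. X n \<in> J - {t}" "X \<longlonglongrightarrow> t" using approach[OF t] by blast
    have "(\<lambda>n. (P (X n) z - P t z) /\<^sub>R (X n - t)) \<longlonglongrightarrow> Pd t z" for z
      using Pder[OF t, of z] X unfolding has_vector_derivative_quotient tendsto_at_iff_sequentially comp_def by blast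
    then show ?thesis using X by blast
  qed
  have P_ci: "P t (ci x) = ci (P t x)" "Pinv t (ci x) = ci (Pinv t x)" "G t (ci x) = ci (G t x)" if "t \<in> J" for t x
    using P_lin Pinv_lin G_lin that by (auto simp: cblin_def)
  have Pd_ci: "Pd t (ci x) = ci (Pd t x)" if t: "t \<in> J" for t x
  proof -
    obtain X where X: "\<And>n. X n \<in> J" "\<And>z. (\<lambda>n. (P (X n) z - P t z) /\<^sub>R (X n - t)) \<longlonglongrightarrow> Pd t z"
      using Pd_lim[OF t] by blast
    have "(\<lambda>n. ci ((P (X n) x - P t x) /\<^sub>R (X n - t))) \<longlonglongrightarrow> ci (Pd t x)"
      by (rule bounded_linear.tendsto[OF ci X(2)])
    moreover have "ci ((P (X n) x - P t x) /\<^sub>R (X n - t)) = (P (X n) (ci x) - P t (ci x)) /\<^sub>R (X n - t)" for n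
      using ci P_ci(1)[OF X(1)] P_ci(1)[OF t] by (simp add: linear_simps)
    ultimately show ?thesis using X(2)[of "ci x"] LIMSEQ_unique by simp blast
  qed
  have Pds: "strongly_cont J Pd"
    unfolding strongly_cont_def
  proof (intro conjI ballI allI)
    fix t assume t: "t \<in> J"
    obtain X where X: "\<And>n. X n \<in> J" "\<And>z. (\<lambda>n. (P (X n) z - P t z) /\<^sub>R (X n - t)) \<longlonglongrightarrow> Pd t z"
      using Pd_lim[OF t] by blast
    show "bounded_linear (Pd t)"
    proof (rule bounded_linear_lim[of "\<lambda>n z. (P (X n) z - P t z) /\<^sub>R (X n - t)"])
      show "bounded_linear (\<lambda>z. (P (X n) z - P t z) /\<^sub>R (X n - t))" for n
        by (intro bounded_linear_compose[OF bounded_linear_scaleR_right] bounded_linear_sub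
            strongly_contD(1)[OF Ps] X(1) t)
    qed (rule X(2))
  qed (use P_C1 in \<open>auto simp: is_C1_on_def\<close>)
  interpret evolution_problem D A J P Pinv Pd
    by unfold_locales (use Jc Ps Pinvs Pds P_sa P_nonneg Pinv_inv Pder in auto)
  define V where "V = Yl (\<lambda>t z. G t z - K t z)"
  define Tr where "Tr = Yl G"
  have GK: "strongly_cont J (\<lambda>t z. G t z - K t z)" by (rule strongly_cont_add(2)[OF Gs K_strongly_cont])
  have K_ci: "K t (ci x) = ci (K t x)" if "t \<in> J" for t x
    using P_ci(2)[OF that] Pd_ci[OF that] by (simp add: K_def)
  have K_eq: "(\<lambda>s z. Pinv s (Pd s z)) = K" by (simp add: K_def fun_eq_iff)
  have Yl_cblin: "cblin ci (Yl Q t \<tau>)" if Q: "strongly_cont J Q" "\<And>t x. t \<in> J \<Longrightarrow> Q t (ci x) = ci (Q t x)" and t: "(t, \<tau>) \<in> Delta J" for Q t \<tau>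
    using Yl_linear[OF Q(1) t] Yl_commute[OF Q(1) ci A_ci P_ci(1) Q(2) t] by (simp add: cblin_def)
  have Tr_evol: "evolution_family ci J Tr"
    unfolding evolution_family_def Tr_def
    using Yl_cblin[OF Gs P_ci(3)] Yl_cocycle[OF Gs] Yl_refl[OF Gs] strongly_contD(2)[OF Yl_strongly_cont[OF Gs]]
    by (auto simp: fun_eq_iff Delta_def)
  define Gm where "Gm n = (\<lambda>t z. Gn J G n t z - K t z)" for n
  note Gnf = Gn_strongly_cont[OF Jc Gs] Gn_deriv_strongly_cont[OF Jc Gs] Gn_has_deriv[OF Jc Gs] Gn_tendsto[OF Jc Gs]
  have Gm: "strongly_cont J (Gm n)" for n unfolding Gm_def by (rule strongly_cont_add(2)[OF Gnf(1) K_strongly_cont])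
  have Gm_ci: "Gm n t (ci x) = ci (Gm n t x)" if t: "t \<in> J" for n t x
    using Gn_commute[OF Jc Gs ci P_ci(3) t] K_ci[OF t] ci by (simp add: Gm_def linear_simps)
  \<comment> \<open>The family is the conjugate by \<open>P\<close> of the limit family for
    \<open>Gm n\<close>; the \<open>- K\<close> in \<open>Gm\<close> accounts for the derivative of
    \<open>P\<close> in the substitution.\<close>
  have exist: "\<exists>U. gen_n n U" for n
  proof -
    let ?U = "\<lambda>t \<tau> x. P t (Yl (Gm n) t \<tau> (Pinv \<tau> x))"
    have "evolution_family ci J ?U"
      unfolding evolution_family_def
    proof (intro conjI allI impI ballI)
      fix t \<tau> assume t: "(t, \<tau>) \<in> Delta J"
      then have tJ: "t \<in> J" "\<tau> \<in> J" by (auto simp: Delta_def)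
      have "bounded_linear (?U t \<tau>)"
        by (rule bounded_linear_compose[OF bounded_linear_P(1)[OF tJ(1)]
              bounded_linear_compose[OF Yl_linear[OF Gm t] bounded_linear_P(2)[OF tJ(2)]]])
      then show "cblin ci (?U t \<tau>)"
        using Yl_cblin[OF Gm Gm_ci t] P_ci(1)[OF tJ(1)] P_ci(2)[OF tJ(2)] by (simp add: cblin_def)
    next
      fix t s \<tau> assume J': "t \<in> J" "s \<in> J" "\<tau> \<in> J" "\<tau> \<le> s" "s \<le> t"
      have D': "(t, s) \<in> Delta J" "(s, \<tau>) \<in> Delta J" using J' by (auto simp: Delta_def)
      show "?U t s \<circ> ?U s \<tau> = ?U t \<tau>"
        using Yl_cocycle[OF Gm D'] by (simp add: fun_eq_iff Pinv_P[OF J'(2)])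
    next
      fix t assume "t \<in> J" then show "?U t t = id" by (simp add: fun_eq_iff Yl_refl[OF Gm] P_Pinv)
    next
      fix z
      have "continuous_on (Delta J) (\<lambda>p. Pinv (snd p) z)"
        by (rule strongly_cont_apply[OF Pinv]) (auto intro!: continuous_intros simp: Delta_def)
      then have "continuous_on (Delta J) (\<lambda>p. Yl (Gm n) (fst p) (snd p) (Pinv (snd p) z))"
        by (rule strongly_cont_apply'[OF Yl_strongly_cont[OF Gm] _ order_refl])
      then show "continuous_on (Delta J) (\<lambda>p. ?U (fst p) (snd p) z)"
        by (rule strongly_cont_apply[OF P, rotated 2]) (auto intro!: continuous_intros simp: Delta_def)
    qed
    moreover have "generates_evol J (\<lambda>_. D) (\<lambda>t x. P t (A x) + P t (Gn J G n t (Pinv t x))) ?U"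
      unfolding generates_evol_def
    proof (intro conjI allI impI ballI)
      fix t \<tau> assume t: "(t, \<tau>) \<in> Delta J"
      then have tJ: "t \<in> J" "\<tau> \<in> J" by (auto simp: Delta_def)
      show "?U t \<tau> ` D \<subseteq> D"
      proof
        fix v assume "v \<in> ?U t \<tau> ` D"
        then obtain x where x: "x \<in> D" "v = ?U t \<tau> x" by blast
        have "P \<tau> (Pinv \<tau> x) \<in> D" using x(1) by (simp add: P_Pinv[OF tJ(2)])
        from classical_solution(1)[OF Gnf(1) Gnf(2) Gnf(3) tJ(2) this t] show "v \<in> D"
          using x(2) by (simp add: Gm_def)
      qed
    next
      fix \<tau> x assume \<tau>: "\<tau> \<in> J" and x: "x \<in> D"
      have "P \<tau> (Pinv \<tau> x) \<in> D" using x by (simp add: P_Pinv[OF \<tau>])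
      from classical_solution(2)[OF Gnf(1) Gnf(2) Gnf(3) \<tau> this]
      have c1: "is_C1_on (Jge J \<tau>) (\<lambda>t. ?U t \<tau> x) (\<lambda>t. P t (A (?U t \<tau> x)) + P t (Gn J G n t (Yl (Gm n) t \<tau> (Pinv \<tau> x))))"
        by (simp add: Gm_def)
      have "Pinv t (?U t \<tau> x) = Yl (Gm n) t \<tau> (Pinv \<tau> x)" if "t \<in> Jge J \<tau>" for t
        using that by (simp add: Jge_def Pinv_P)
      then show "is_C1_on (Jge J \<tau>) (\<lambda>t. ?U t \<tau> x) (\<lambda>t. P t (A (?U t \<tau> x)) + P t (Gn J G n t (Pinv t (?U t \<tau> x))))"
        using c1 unfolding is_C1_on_def by (simp cong: continuous_on_cong)
      show "?U \<tau> \<tau> x = x" by (simp add: Yl_refl[OF Gm \<tau>] P_Pinv[OF \<tau>])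
    qed
    ultimately show ?thesis unfolding gen_n_def by blast
  qed
  have unique: "U t \<tau> x = P t (Yl (Gm n) t \<tau> (Pinv \<tau> x))" if U: "gen_n n U" and t: "(t, \<tau>) \<in> Delta J" for n U t \<tau> x
  proof -
    have tJ: "t \<in> J" "\<tau> \<in> J" "\<tau> \<le> t" using t by (auto simp: Delta_def)
    have ev: "evolution_family ci J U" and ge: "generates_evol J (\<lambda>_. D) (\<lambda>t x. P t (A x) + P t (Gn J G n t (Pinv t x))) U"
      using U by (auto simp: gen_n_def)
    have Ulin: "bounded_linear (U t \<tau>)" using ev t unfolding evolution_family_def cblin_def by blast
    have Ylin: "bounded_linear (\<lambda>x. P t (Yl (Gm n) t \<tau> (Pinv \<tau> x)))"
      by (rule bounded_linear_compose[OF bounded_linear_P(1)[OF tJ(1)]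
            bounded_linear_compose[OF Yl_linear[OF Gm t] bounded_linear_P(2)[OF tJ(2)]]])
    have onD: "U t \<tau> x = P t (Yl (Gm n) t \<tau> (Pinv \<tau> x))" if x: "x \<in> D" for x
    \<comment> \<open>If \<open>\<tau>\<close> is the right end of \<open>J\<close>,
      \<open>generates_evol\<close> yields no differential equation, so the diagonal is settled by
      the evolution property.\<close>
    proof (cases "\<tau> = t")
      case True
      then show ?thesis using ev tJ(1) by (simp add: evolution_family_def Yl_refl[OF Gm] P_Pinv)
    next
      case False
      then have "\<exists>t\<in>J. \<tau> < t" using tJ by (intro bexI[of _ t]) auto
      with ge tJ(2) x have c1: "is_C1_on (Jge J \<tau>) (\<lambda>s. U s \<tau> x) (\<lambda>s. P s (A (U s \<tau> x)) + P s (Gn J G n s (Pinv s (U s \<tau> x))))" "U \<tau> \<tau> x = x"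
        unfolding generates_evol_def by blast+
      have sub: "{\<tau>..t} \<subseteq> Jge J \<tau>" using Delta_subinterval(1)[OF Jc(1) t] by (auto simp: Jge_def)
      have "U t \<tau> x = P t (Yl (\<lambda>t z. Gn J G n t z - K t z) t \<tau> (Pinv \<tau> (U \<tau> \<tau> x)))"
      proof (rule classical_solution_unique[OF Gnf(1) t, where x = "\<lambda>s. U s \<tau> x"])
        fix s assume s: "s \<in> {\<tau>..t}"
        show "U s \<tau> x \<in> D"
          using ge Delta_subinterval(3)[OF Jc(1) t s] x unfolding generates_evol_def by blast
        show "((\<lambda>s. U s \<tau> x) has_vector_derivative (P s (A (U s \<tau> x)) + P s (Gn J G n s (Pinv s (U s \<tau> x))))) (at s within {\<tau>..t})"
          using c1(1) s sub unfolding is_C1_on_def by (meson has_vector_derivative_within_subset subsetD)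
      next
        show "continuous_on {\<tau>..t} (\<lambda>s. P s (A (U s \<tau> x)) + P s (Gn J G n s (Pinv s (U s \<tau> x))))"
          using c1(1) sub unfolding is_C1_on_def by (meson continuous_on_subset)
      qed simp
      then show ?thesis using c1(2) by (simp add: Gm_def)
    qed
    \<comment> \<open>Agreement on \<open>D\<close> extends to X, as both sides are bounded
      operators and \<open>D\<close> is dense.\<close>
    have "closed {x. U t \<tau> x = P t (Yl (Gm n) t \<tau> (Pinv \<tau> x))}"
      by (intro closed_Collect_eq linear_continuous_on Ulin Ylin)
    moreover have "D \<subseteq> {x. U t \<tau> x = P t (Yl (Gm n) t \<tau> (Pinv \<tau> x))}" using onD by blast
    ultimately have "closure D \<subseteq> {x. U t \<tau> x = P t (Yl (Gm n) t \<tau> (Pinv \<tau> x))}" by (rule closure_minimal[rotated])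
    then show ?thesis using dense by blast
  qed
  have conv: "(\<lambda>n. U n t \<tau> (P \<tau> z)) \<longlonglongrightarrow> P t (V t \<tau> z)" if U: "\<forall>n. gen_n n (U n)" and t: "(t, \<tau>) \<in> Delta J" for U t \<tau> z
  proof -
    have tJ: "t \<in> J" "\<tau> \<in> J" using t by (auto simp: Delta_def)
    have "(\<lambda>n. Yl (Gm n) t \<tau> z) \<longlonglongrightarrow> V t \<tau> z"
      unfolding V_def
    proof (rule Yl_perturb_tendsto[OF GK Gm _ _ t])
      fix m
      obtain C where C: "C \<ge> 0" "\<And>n t z. t \<in> Jm m \<Longrightarrow> norm (Gn J G n t z) \<le> C * norm z"
        using Gn_bound[OF Jc Gs, of m] by blast
      obtain k where k: "k \<ge> 0" "\<And>t z. t \<in> Jm m \<Longrightarrow> norm (K t z) \<le> k * norm z"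
        using strongly_cont_bound[OF K_strongly_cont compact_exhaustion(1)[OF Jc(1,2)]] by blast
      have "norm (Gm n s z) \<le> (C + k) * norm z" if "s \<in> Jm m" for n s z
        using norm_triangle_ineq4[of "Gn J G n s z" "K s z"] C(2)[OF that, of n z] k(2)[OF that, of z]
        unfolding Gm_def distrib_right by linarith
      then show "\<exists>\<beta>\<ge>0. \<forall>n. \<forall>s\<in>Jm m. \<forall>z. norm (Gm n s z) \<le> \<beta> * norm z"
        using C(1) k(1) by (intro exI[of _ "C + k"]) auto
    next
      fix s z assume "s \<in> J"
      then show "(\<lambda>n. Gm n s z) \<longlonglongrightarrow> G s z - K s z"
        unfolding Gm_def by (intro tendsto_diff tendsto_const Gnf(4))
    qed
    then have "(\<lambda>n. P t (Yl (Gm n) t \<tau> z)) \<longlonglongrightarrow> P t (V t \<tau> z)"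
      by (rule bounded_linear.tendsto[OF bounded_linear_P(1)[OF tJ(1)]])
    moreover have "U n t \<tau> (P \<tau> z) = P t (Yl (Gm n) t \<tau> z)" for n
      using unique[OF spec[OF U] t] by (simp add: Pinv_P[OF tJ(2)])
    ultimately show ?thesis by simp
  qed
  have Vs: "strongly_cont (Delta J) (\<lambda>p. V (fst p) (snd p))" unfolding V_def by (rule Yl_strongly_cont[OF GK])
  have Ts: "strongly_cont (Delta J) (\<lambda>p. Tr (fst p) (snd p))" unfolding Tr_def by (rule Yl_strongly_cont[OF Gs])
  have right: "var_const_right J V K Tr"
    unfolding var_const_right_def V_def Tr_def
    using Yl_difference[OF GK Gs] by (simp add: algebra_simps)
  have left: "var_const_left J V K Tr"
    unfolding var_const_left_def
  proof (intro allI impI)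
    fix x t \<tau> assume t: "(t, \<tau>) \<in> Delta J"
    \<comment> \<open>Duhamel's formula with the roles exchanged gives \<open>V - Tr\<close>; the
      sign is turned afterwards.\<close>
    have "((\<lambda>s. - Tr t s (G s (V s \<tau> x) - K s (V s \<tau> x) - G s (V s \<tau> x))) has_integral - (V t \<tau> x - Tr t \<tau> x)) {\<tau>..t}"
      using has_integral_neg[OF Yl_difference[OF Gs GK t, of x]] unfolding V_def Tr_def .
    then have "((\<lambda>s. - Tr t s (G s (V s \<tau> x) - K s (V s \<tau> x) - G s (V s \<tau> x))) has_integral (Tr t \<tau> x - V t \<tau> x)) {\<tau>..t}"
      by (simp only: minus_diff_eq)
    then show "((\<lambda>s. Tr t s (K s (V s \<tau> x))) has_integral (Tr t \<tau> x - V t \<tau> x)) {\<tau>..t}"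
    proof (rule has_integral_eq[rotated])
      fix s assume "s \<in> {\<tau>..t}"
      then have "linear (Tr t s)"
        unfolding Tr_def using bounded_linear.linear[OF Yl_linear[OF Gs Delta_subinterval(2)[OF Jc(1) t]]] by blast
      then show "- Tr t s (G s (V s \<tau> x) - K s (V s \<tau> x) - G s (V s \<tau> x)) = Tr t s (K s (V s \<tau> x))"
        by (simp add: linear_neg)
    qed
  qed
  have wr: "S t \<tau> = Tr t \<tau>" if "\<forall>t \<tau>. (t, \<tau>) \<in> Delta J \<longrightarrow> cblin ci (S t \<tau>)" "weakly_continuous_family J S" "weak_var_const_right J V K S"
    "(t, \<tau>) \<in> Delta J" for S t \<tau>
    by (rule weak_right_unique[OF Jc(1,2) Vs K_strongly_cont Ts _ that(2,3) right that(4)]) (use that(1) in \<open>simp add: cblin_def\<close>)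
  have wl: "S t \<tau> = Tr t \<tau>" if "\<forall>t \<tau>. (t, \<tau>) \<in> Delta J \<longrightarrow> cblin ci (S t \<tau>)" "weakly_continuous_family J S" "weak_var_const_left J V K S"
    "(t, \<tau>) \<in> Delta J" for S t \<tau>
    by (rule weak_left_unique[OF Jc(1,2) Vs K_strongly_cont Ts _ that(2,3) left that(4)]) (use that(1) in \<open>simp add: cblin_def\<close>)
  have ev_cblin: "\<forall>t \<tau>. (t, \<tau>) \<in> Delta J \<longrightarrow> cblin ci (T t \<tau>)" if "evolution_family ci J T" for T
    using that by (simp add: evolution_family_def)
  have ur: "T t \<tau> = Tr t \<tau>" if "evolution_family ci J T \<and> var_const_right J V K T" "(t, \<tau>) \<in> Delta J" for T t \<tau>
    using that by (intro wr ev_cblin evolution_family_weakly_continuous[of ci] var_const_imp_weak) auto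
  have ul: "T t \<tau> = Tr t \<tau>" if "evolution_family ci J T \<and> var_const_left J V K T" "(t, \<tau>) \<in> Delta J" for T t \<tau>
    using that by (intro wl ev_cblin evolution_family_weakly_continuous[of ci] var_const_imp_weak) auto
  have "abstract_conclusion ci J R' P G V K Tr" if R': "\<forall>y. R' y \<in> D \<and> R' y - A (R' y) = y" for R'
    unfolding abstract_conclusion_def
  proof (intro conjI allI impI ballI)
    fix \<tau> x assume \<tau>: "\<tau> \<in> J"
    \<comment> \<open>I - \<open>A\<close> is injective on \<open>D\<close>, so \<open>R'\<close> is
      forced to be the resolvent.\<close>
    have "R' = R" using R' resolvent resolvent_unique by (metis ext)
    then show "is_C1_on (Jge J \<tau>) (\<lambda>t. R' (Tr t \<tau> x)) (\<lambda>t. (R' (P t (Tr t \<tau> x)) - P t (Tr t \<tau> x)) + R' (G t (Tr t \<tau> x)))"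
      using Yl_extrapolated[OF Gs \<tau>, of x] by (simp add: Tr_def)
    show "Tr \<tau> \<tau> x = x" unfolding Tr_def by (rule Yl_refl[OF Gs \<tau>])
  qed (use Tr_evol right left wr wl ur ul in blast)+
  then have "(\<forall>n. \<exists>U. gen_n n U)
    \<and> (\<forall>U. (\<forall>n. gen_n n (U n)) \<longrightarrow> (\<forall>t \<tau> z. (t, \<tau>) \<in> Delta J \<longrightarrow> (\<lambda>n. U n t \<tau> (P \<tau> z)) \<longlonglongrightarrow> P t (V t \<tau> z)))
    \<and> (\<forall>R. (\<forall>y. R y \<in> D \<and> R y - A (R y) = y) \<longrightarrow> abstract_conclusion ci J R P G V K Tr)"
    using exist conv by blast
  then show ?thesis unfolding K_eq using range resolvent_unique by blast
qed

section \<open>From Banach to complete inner product spaces\<close>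

text \<open>The sort \<open>{real_inner, complete_space}\<close> is not below the class \<open>banach\<close>, so results about integrals do
  not apply to it. A type copy is an instance of \<open>banach\<close>, and the theorem is transferred along it.\<close>
typedef 'a hilbert_copy = "UNIV :: 'a set" morphisms of_copy to_copy ..

instantiation hilbert_copy :: (real_inner) real_inner
begin

definition "0 = to_copy 0"
definition "x + y = to_copy (of_copy x + of_copy y)"
definition "x - y = to_copy (of_copy x - of_copy y)"
definition "- x = to_copy (- of_copy x)"
definition "r *\<^sub>R x = to_copy (r *\<^sub>R of_copy x)"
definition "inner x y = inner (of_copy x) (of_copy y)"
definition "norm x = norm (of_copy x)"
definition "dist x y = norm (of_copy x - of_copy y)"
definition "sgn x = to_copy (sgn (of_copy x))"
definition [code del]: "(uniformity :: ('a hilbert_copy \<times> 'a hilbert_copy) filter) = (INF e\<in>{0<..}. principal {(x, y). dist x y < e})"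
definition [code del]: "open (U :: 'a hilbert_copy set) \<longleftrightarrow> (\<forall>x\<in>U. \<forall>\<^sub>F (x', y) in uniformity. x' = x \<longrightarrow> y \<in> U)"

lemma of_copy_simps:
  "of_copy 0 = 0" "of_copy (x + y) = of_copy x + of_copy y" "of_copy (x - y) = of_copy x - of_copy y"
  "of_copy (- x) = - of_copy x" "of_copy (r *\<^sub>R x) = r *\<^sub>R of_copy x" "of_copy (sgn x) = sgn (of_copy x)"
  by (simp_all add: zero_hilbert_copy_def plus_hilbert_copy_def minus_hilbert_copy_def uminus_hilbert_copy_def
      scaleR_hilbert_copy_def sgn_hilbert_copy_def to_copy_inverse)

instance
  by standard
    (simp_all add: of_copy_inject[symmetric] of_copy_simps inner_hilbert_copy_def norm_hilbert_copy_def
      dist_hilbert_copy_def uniformity_hilbert_copy_def open_hilbert_copy_def algebra_simps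
      inner_add_left inner_commute norm_eq_sqrt_inner sgn_div_norm)

end

lemma bounded_linear_of_copy: "bounded_linear of_copy"
  by (rule bounded_linear_intro[where K = 1]) (simp_all add: of_copy_simps norm_hilbert_copy_def)

lemma bounded_linear_to_copy: "bounded_linear to_copy"
  by (rule bounded_linear_intro[where K = 1])
    (simp_all add: of_copy_inject[symmetric] of_copy_simps norm_hilbert_copy_def to_copy_inverse)

instance hilbert_copy :: ("{real_inner, complete_space}") banach
proof
  fix X :: "nat \<Rightarrow> 'a hilbert_copy" assume "Cauchy X"
  then have "Cauchy (\<lambda>n. of_copy (X n))" by (rule bounded_linear.Cauchy[OF bounded_linear_of_copy])
  then obtain l where "(\<lambda>n. of_copy (X n)) \<longlonglongrightarrow> l" using Cauchy_convergent convergent_def by blast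
  from bounded_linear.tendsto[OF bounded_linear_to_copy this] show "convergent X"
    by (auto simp: of_copy_inverse convergent_def)
qed

section \<open>Transfer rules between a space and its copy\<close>

context includes lifting_syntax begin

definition cr_copy :: "'a hilbert_copy \<Rightarrow> 'a \<Rightarrow> bool" where
  "cr_copy c x \<longleftrightarrow> of_copy c = x"

lemma cr_copy_bi [transfer_rule]: "bi_unique cr_copy" "bi_total cr_copy"
  by (auto simp: cr_copy_def bi_unique_def bi_total_def of_copy_inject) (metis to_copy_inverse UNIV_I)

lemma cr_copy_eq_fun: "((=) ===> cr_copy) f g \<longleftrightarrow> g = (\<lambda>x. of_copy (f x))"
  by (auto simp: rel_fun_def cr_copy_def fun_eq_iff)

lemma cr_copy_fun_copy: "(cr_copy ===> cr_copy) f g \<longleftrightarrow> g = (\<lambda>x. of_copy (f (to_copy x)))"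
  by (auto simp: rel_fun_def cr_copy_def fun_eq_iff of_copy_inverse) (metis to_copy_inverse UNIV_I)

lemma copy_algebra_transfer [transfer_rule]:
  "cr_copy (0 :: 'a::real_inner hilbert_copy) 0"
  "(cr_copy ===> cr_copy ===> cr_copy) (+) ((+) :: 'a::real_inner \<Rightarrow> _)"
  "(cr_copy ===> cr_copy ===> cr_copy) (-) ((-) :: 'a::real_inner \<Rightarrow> _)"
  "(cr_copy ===> cr_copy) uminus (uminus :: 'a::real_inner \<Rightarrow> _)"
  "((=) ===> cr_copy ===> cr_copy) scaleR (scaleR :: real \<Rightarrow> 'a::real_inner \<Rightarrow> _)"
  "(cr_copy ===> cr_copy ===> (=)) inner (inner :: 'a::real_inner \<Rightarrow> _)"
  "(cr_copy ===> (=)) norm (norm :: 'a::real_inner \<Rightarrow> _)"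
  by (auto simp: rel_fun_def cr_copy_def of_copy_simps inner_hilbert_copy_def norm_hilbert_copy_def)

lemma bounded_linear_copy_transfer [transfer_rule]:
  "((cr_copy ===> cr_copy) ===> (=)) bounded_linear (bounded_linear :: ('a::real_inner \<Rightarrow> 'a) \<Rightarrow> _)"
proof (rule rel_funI)
  fix f and g :: "'a \<Rightarrow> 'a" assume "(cr_copy ===> cr_copy) f g"
  then have g: "g = (\<lambda>x. of_copy (f (to_copy x)))" by (simp add: cr_copy_fun_copy)
  then have f: "f = (\<lambda>x. to_copy (g (of_copy x)))" by (simp add: of_copy_inverse)
  show "bounded_linear f = bounded_linear g"
  proof
    assume "bounded_linear f" then show "bounded_linear g" unfolding g
      by (intro bounded_linear_compose[OF bounded_linear_of_copy] bounded_linear_compose[OF _ bounded_linear_to_copy])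
  next
    assume "bounded_linear g" then show "bounded_linear f" unfolding f
      by (intro bounded_linear_compose[OF bounded_linear_to_copy] bounded_linear_compose[OF _ bounded_linear_of_copy])
  qed
qed

lemma tendsto_copy_iff: "((\<lambda>x. of_copy (f x)) \<longlongrightarrow> of_copy l) F \<longleftrightarrow> (f \<longlongrightarrow> l) F"
  using bounded_linear.tendsto[OF bounded_linear_of_copy, of f l F]
    bounded_linear.tendsto[OF bounded_linear_to_copy, of "\<lambda>x. of_copy (f x)" "of_copy l" F]
  by (auto simp: of_copy_inverse)

text \<open>Transfer rules attach to constants, and \<open>tendsto\<close> is an abbreviation.\<close>
definition converges_to :: "('b \<Rightarrow> 'a::topological_space) \<Rightarrow> 'a \<Rightarrow> 'b filter \<Rightarrow> bool" where
  "converges_to f l F \<longleftrightarrow> (f \<longlongrightarrow> l) F"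

lemma converges_to_copy_transfer [transfer_rule]:
  "(((=) ===> cr_copy) ===> cr_copy ===> (=) ===> (=)) converges_to (converges_to :: ('b \<Rightarrow> 'a::real_inner) \<Rightarrow> _)"
  by (rule rel_funI)+ (auto simp: cr_copy_eq_fun cr_copy_def converges_to_def tendsto_copy_iff)

lemma continuous_on_copy_transfer [transfer_rule]:
  "((=) ===> ((=) ===> cr_copy) ===> (=)) continuous_on (continuous_on :: 'b::topological_space set \<Rightarrow> ('b \<Rightarrow> 'a::real_inner) \<Rightarrow> _)"
  by (rule rel_funI)+ (auto simp: cr_copy_eq_fun continuous_on_def tendsto_copy_iff)

lemma has_vector_derivative_copy_transfer [transfer_rule]:
  "(((=) ===> cr_copy) ===> cr_copy ===> (=) ===> (=)) (has_vector_derivative)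
    ((has_vector_derivative) :: (real \<Rightarrow> 'a::real_inner) \<Rightarrow> _)"
proof (rule rel_funI)+
  fix f and g :: "real \<Rightarrow> 'a" and c and d :: 'a and F F' :: "real filter"
  assume "((=) ===> cr_copy) f g" "cr_copy c d" "F = F'"
  then have *: "g = (\<lambda>x. of_copy (f x))" "d = of_copy c" "F' = F" by (auto simp: cr_copy_eq_fun cr_copy_def)
  show "(f has_vector_derivative c) F = (g has_vector_derivative d) F'"
    unfolding *
    using bounded_linear.has_vector_derivative[OF bounded_linear_of_copy, of f c F]
      bounded_linear.has_vector_derivative[OF bounded_linear_to_copy, of "\<lambda>x. of_copy (f x)" "of_copy c" F]
    by (auto simp: of_copy_inverse)
qed

lemma has_integral_copy_iff: "((\<lambda>x. of_copy (f x)) has_integral of_copy i) S \<longleftrightarrow> (f has_integral i) S"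
  using has_integral_linear[OF _ bounded_linear_of_copy, of f i S]
    has_integral_linear[OF _ bounded_linear_to_copy, of "\<lambda>x. of_copy (f x)" "of_copy i" S]
  by (auto simp: of_copy_inverse o_def)

lemma has_integral_copy_transfer [transfer_rule]:
  "(((=) ===> cr_copy) ===> cr_copy ===> (=) ===> (=)) (has_integral)
    ((has_integral) :: ('n::euclidean_space \<Rightarrow> 'a::real_inner) \<Rightarrow> _)"
  by (rule rel_funI)+ (auto simp: cr_copy_eq_fun cr_copy_def has_integral_copy_iff)

lemma integral_copy_transfer [transfer_rule]:
  "((=) ===> ((=) ===> cr_copy) ===> cr_copy) integral
    (integral :: 'n::euclidean_space set \<Rightarrow> ('n \<Rightarrow> 'a::real_inner) \<Rightarrow> _)"
proof (rule rel_funI)+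
  fix S S' :: "'n set" and f and g :: "'n \<Rightarrow> 'a"
  assume "S = S'" "((=) ===> cr_copy) f g"
  then have *: "S' = S" "g = (\<lambda>x. of_copy (f x))" by (auto simp: cr_copy_eq_fun)
  show "cr_copy (integral S f) (integral S' g)"
  proof (cases "f integrable_on S")
    case True
    then have "((\<lambda>x. of_copy (f x)) has_integral of_copy (integral S f)) S"
      by (simp add: has_integral_copy_iff integrable_integral)
    then show ?thesis by (simp add: * cr_copy_def integral_unique)
  next
    \<comment> \<open>Integrability transfers in both directions, so both integrals take the default
      value 0.\<close>
    case False
    then have "\<not> (\<lambda>x. of_copy (f x)) integrable_on S"
      using has_integral_copy_iff[of f "to_copy _" S] by (auto simp: integrable_on_def to_copy_inverse)
    then show ?thesis using False by (simp add: * cr_copy_def not_integrable_integral of_copy_simps)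
  qed
qed

lemma complex_structure_transfer [transfer_rule]:
  "((cr_copy ===> cr_copy) ===> (=)) complex_structure (complex_structure :: ('a::real_inner \<Rightarrow> 'a) \<Rightarrow> _)"
  unfolding complex_structure_def by transfer_prover

lemma cblin_transfer [transfer_rule]:
  "((cr_copy ===> cr_copy) ===> (cr_copy ===> cr_copy) ===> (=)) cblin (cblin :: ('a::real_inner \<Rightarrow> 'a) \<Rightarrow> _)"
  unfolding cblin_def by transfer_prover

lemma is_C1_on_transfer [transfer_rule]:
  "((=) ===> ((=) ===> cr_copy) ===> ((=) ===> cr_copy) ===> (=)) is_C1_on
    (is_C1_on :: real set \<Rightarrow> (real \<Rightarrow> 'a::real_inner) \<Rightarrow> _)"
  unfolding is_C1_on_def by transfer_prover

lemma c0_semigroup_transfer [transfer_rule]: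
  "((cr_copy ===> cr_copy) ===> ((=) ===> cr_copy ===> cr_copy) ===> (=)) c0_semigroup
    (c0_semigroup :: ('a::real_inner \<Rightarrow> 'a) \<Rightarrow> _)"
  unfolding c0_semigroup_def by transfer_prover

text \<open>The set equation becomes pointwise membership and the limits become
  \<open>converges_to\<close>, for which transfer rules are at hand.\<close>

lemma sg_generator_alt:
  "sg_generator S D A \<longleftrightarrow> (\<forall>x. x \<in> D \<longleftrightarrow> (\<exists>y. converges_to (\<lambda>h. (S h x - x) /\<^sub>R h) y (at_right 0)))
     \<and> (\<forall>x\<in>D. converges_to (\<lambda>h. (S h x - x) /\<^sub>R h) (A x) (at_right 0))"
  unfolding sg_generator_def set_eq_iff mem_Collect_eq converges_to_def ..

lemma sg_generator_transfer [transfer_rule]: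
  "(((=) ===> cr_copy ===> cr_copy) ===> rel_set cr_copy ===> (cr_copy ===> cr_copy) ===> (=)) sg_generator
    (sg_generator :: (real \<Rightarrow> 'a::real_inner \<Rightarrow> 'a) \<Rightarrow> _)"
  unfolding sg_generator_alt by transfer_prover

lemma generates_c0_contraction_transfer [transfer_rule]:
  "((cr_copy ===> cr_copy) ===> rel_set cr_copy ===> (cr_copy ===> cr_copy) ===> (=)) generates_c0_contraction
    (generates_c0_contraction :: ('a::real_inner \<Rightarrow> 'a) \<Rightarrow> _)"
  unfolding generates_c0_contraction_def by transfer_prover

lemma evolution_family_transfer [transfer_rule]:
  "((cr_copy ===> cr_copy) ===> (=) ===> ((=) ===> (=) ===> cr_copy ===> cr_copy) ===> (=)) evolution_family
    (evolution_family :: ('a::real_inner \<Rightarrow> 'a) \<Rightarrow> _)"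
  unfolding evolution_family_def by transfer_prover

lemma generates_evol_transfer [transfer_rule]:
  "((=) ===> ((=) ===> rel_set cr_copy) ===> ((=) ===> cr_copy ===> cr_copy) ===>
     ((=) ===> (=) ===> cr_copy ===> cr_copy) ===> (=)) generates_evol
    (generates_evol :: real set \<Rightarrow> (real \<Rightarrow> 'a::real_inner set) \<Rightarrow> _)"
  unfolding generates_evol_def by transfer_prover

lemma Gext_transfer [transfer_rule]:
  "((=) ===> ((=) ===> cr_copy ===> cr_copy) ===> (=) ===> cr_copy ===> cr_copy) Gext
    (Gext :: real set \<Rightarrow> (real \<Rightarrow> 'a::real_inner \<Rightarrow> 'a) \<Rightarrow> _)"
  unfolding Gext_def by transfer_prover

lemma Gn_transfer [transfer_rule]:
  "((=) ===> ((=) ===> cr_copy ===> cr_copy) ===> (=) ===> (=) ===> cr_copy ===> cr_copy) Gn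
    (Gn :: real set \<Rightarrow> (real \<Rightarrow> 'a::real_inner \<Rightarrow> 'a) \<Rightarrow> _)"
  unfolding Gn_def by transfer_prover

lemma var_const_transfer [transfer_rule]:
  "((=) ===> ((=) ===> (=) ===> cr_copy ===> cr_copy) ===> ((=) ===> cr_copy ===> cr_copy) ===>
     ((=) ===> (=) ===> cr_copy ===> cr_copy) ===> (=)) var_const_right
    (var_const_right :: real set \<Rightarrow> (real \<Rightarrow> real \<Rightarrow> 'a::real_inner \<Rightarrow> 'a) \<Rightarrow> _)"
  "((=) ===> ((=) ===> (=) ===> cr_copy ===> cr_copy) ===> ((=) ===> cr_copy ===> cr_copy) ===>
     ((=) ===> (=) ===> cr_copy ===> cr_copy) ===> (=)) var_const_left
    (var_const_left :: real set \<Rightarrow> (real \<Rightarrow> real \<Rightarrow> 'a::real_inner \<Rightarrow> 'a) \<Rightarrow> _)"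
  "((=) ===> ((=) ===> (=) ===> cr_copy ===> cr_copy) ===> ((=) ===> cr_copy ===> cr_copy) ===>
     ((=) ===> (=) ===> cr_copy ===> cr_copy) ===> (=)) weak_var_const_right
    (weak_var_const_right :: real set \<Rightarrow> (real \<Rightarrow> real \<Rightarrow> 'a::real_inner \<Rightarrow> 'a) \<Rightarrow> _)"
  "((=) ===> ((=) ===> (=) ===> cr_copy ===> cr_copy) ===> ((=) ===> cr_copy ===> cr_copy) ===>
     ((=) ===> (=) ===> cr_copy ===> cr_copy) ===> (=)) weak_var_const_left
    (weak_var_const_left :: real set \<Rightarrow> (real \<Rightarrow> real \<Rightarrow> 'a::real_inner \<Rightarrow> 'a) \<Rightarrow> _)"
  unfolding var_const_right_def var_const_left_def weak_var_const_right_def weak_var_const_left_def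
  by transfer_prover+

lemma weakly_continuous_family_transfer [transfer_rule]:
  "((=) ===> ((=) ===> (=) ===> cr_copy ===> cr_copy) ===> (=)) weakly_continuous_family
    (weakly_continuous_family :: real set \<Rightarrow> (real \<Rightarrow> real \<Rightarrow> 'a::real_inner \<Rightarrow> 'a) \<Rightarrow> _)"
  unfolding weakly_continuous_family_def by transfer_prover

lemma abstract_conclusion_transfer [transfer_rule]:
  "((cr_copy ===> cr_copy) ===> (=) ===> (cr_copy ===> cr_copy) ===> ((=) ===> cr_copy ===> cr_copy) ===>
     ((=) ===> cr_copy ===> cr_copy) ===> ((=) ===> (=) ===> cr_copy ===> cr_copy) ===>
     ((=) ===> cr_copy ===> cr_copy) ===> ((=) ===> (=) ===> cr_copy ===> cr_copy) ===> (=)) abstract_conclusion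
    (abstract_conclusion :: ('a::real_inner \<Rightarrow> 'a) \<Rightarrow> _)"
  unfolding abstract_conclusion_def by transfer_prover

end

text \<open>Hypotheses and conclusion are packed into one predicate of the data, so that a single
  transfer relation moves the whole theorem.\<close>

definition perturbed_evolution_statement where
  "perturbed_evolution_statement ci D A J P Pinv Pd G \<longleftrightarrow>
    (complex_structure ci \<longrightarrow> generates_c0_contraction ci D A \<longrightarrow> time_interval J \<longrightarrow>
    (\<forall>t\<in>J. cblin ci (P t)) \<longrightarrow> (\<forall>t\<in>J. \<forall>x y. inner (P t x) y = inner x (P t y)) \<longrightarrow>
    (\<forall>t\<in>J. \<forall>x. 0 \<le> inner (P t x) x) \<longrightarrow> (\<forall>t\<in>J. cblin ci (Pinv t)) \<longrightarrow>
    (\<forall>t\<in>J. \<forall>x. P t (Pinv t x) = x \<and> Pinv t (P t x) = x) \<longrightarrow>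
    (\<forall>z. is_C1_on J (\<lambda>t. P t z) (\<lambda>t. Pd t z)) \<longrightarrow> (\<forall>z. \<exists>d. is_C1_on J (\<lambda>t. Pinv t z) d) \<longrightarrow>
    (\<forall>t\<in>J. cblin ci (G t)) \<longrightarrow> (\<forall>z. continuous_on J (\<lambda>t. G t z)) \<longrightarrow>
    (\<forall>y. \<exists>x\<in>D. x - A x = y) \<and> (\<forall>x\<in>D. \<forall>y\<in>D. x - A x = y - A y \<longrightarrow> x = y) \<and> (\<exists>V Tr.
      (\<forall>n. \<exists>U. evolution_family ci J U \<and>
        generates_evol J (\<lambda>_. D) (\<lambda>t x. P t (A x) + P t (Gn J G n t (Pinv t x))) U)
      \<and> (\<forall>U. (\<forall>n. evolution_family ci J (U n) \<and>
          generates_evol J (\<lambda>_. D) (\<lambda>t x. P t (A x) + P t (Gn J G n t (Pinv t x))) (U n)) \<longrightarrow>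
        (\<forall>t \<tau> z. (t, \<tau>) \<in> Delta J \<longrightarrow> converges_to (\<lambda>n. U n t \<tau> (P \<tau> z)) (P t (V t \<tau> z)) sequentially))
      \<and> (\<forall>R. (\<forall>y. R y \<in> D \<and> R y - A (R y) = y) \<longrightarrow>
          abstract_conclusion ci J R P G V (\<lambda>s z. Pinv s (Pd s z)) Tr)))"

lemma perturbed_evolution_statement_banach:
  "perturbed_evolution_statement (ci :: 'a::{real_inner, banach} \<Rightarrow> 'a) D A J P Pinv Pd G"
  unfolding perturbed_evolution_statement_def converges_to_def
  by (rule impI)+ (rule perturbed_evolution_banach; assumption)

lemma perturbed_evolution_statement_transfer [transfer_rule]:
  includes lifting_syntax
  shows "((cr_copy ===> cr_copy) ===> rel_set cr_copy ===> (cr_copy ===> cr_copy) ===> (=) ===>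
     ((=) ===> cr_copy ===> cr_copy) ===> ((=) ===> cr_copy ===> cr_copy) ===> ((=) ===> cr_copy ===> cr_copy) ===>
     ((=) ===> cr_copy ===> cr_copy) ===> (=)) perturbed_evolution_statement
    (perturbed_evolution_statement :: ('a::real_inner \<Rightarrow> 'a) \<Rightarrow> _)"
  unfolding perturbed_evolution_statement_def by transfer_prover

text \<open>All data are conjugated to the copy, which is of class \<open>banach\<close>; the
  transfer rule identifies the two statements.\<close>

lemma perturbed_evolution_complete:
  "perturbed_evolution_statement (ci :: 'a::{real_inner, complete_space} \<Rightarrow> 'a) D A J P Pinv Pd G"
proof -
  let ?c = "\<lambda>T x. to_copy (T (of_copy x))"
  have "perturbed_evolution_statement (?c ci) (to_copy ` D) (?c A) J (\<lambda>t. ?c (P t)) (\<lambda>t. ?c (Pinv t)) (\<lambda>t. ?c (Pd t)) (\<lambda>t. ?c (G t))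
    = perturbed_evolution_statement ci D A J P Pinv Pd G"
    by (intro perturbed_evolution_statement_transfer[THEN rel_funD, THEN rel_funD, THEN rel_funD, THEN rel_funD,
          THEN rel_funD, THEN rel_funD, THEN rel_funD, THEN rel_funD])
      (auto simp: rel_fun_def rel_set_def cr_copy_def to_copy_inverse)
  then show ?thesis using perturbed_evolution_statement_banach by blast
qed

text \<open>Needed because \<open>Vfam\<close> and the constructed family agree on
  \<open>Delta J\<close> only; the integral equations never look outside it.\<close>

lemma var_const_cong:
  fixes V1 V2 :: "real \<Rightarrow> real \<Rightarrow> 'a \<Rightarrow> 'a::real_inner"
  assumes J: "is_interval J" and eq: "\<And>t \<tau>. (t, \<tau>) \<in> Delta J \<Longrightarrow> V1 t \<tau> = V2 t \<tau>"
  shows "var_const_right J V1 K T = var_const_right J V2 K T" "var_const_left J V1 K T = var_const_left J V2 K T"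
    "weak_var_const_right J V1 K T = weak_var_const_right J V2 K T"
    "weak_var_const_left J V1 K T = weak_var_const_left J V2 K T"
proof -
  have "((\<lambda>s. V1 t s (K s (T s \<tau> x))) has_integral i) {\<tau>..t} = ((\<lambda>s. V2 t s (K s (T s \<tau> x))) has_integral i) {\<tau>..t}"
    "((\<lambda>s. T t s (K s (V1 s \<tau> x))) has_integral i) {\<tau>..t} = ((\<lambda>s. T t s (K s (V2 s \<tau> x))) has_integral i) {\<tau>..t}"
    "((\<lambda>s. inner (V1 t s (K s (T s \<tau> x))) y) has_integral j) {\<tau>..t} = ((\<lambda>s. inner (V2 t s (K s (T s \<tau> x))) y) has_integral j) {\<tau>..t}"
    "((\<lambda>s. inner (T t s (K s (V1 s \<tau> x))) y) has_integral j) {\<tau>..t} = ((\<lambda>s. inner (T t s (K s (V2 s \<tau> x))) y) has_integral j) {\<tau>..t}"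
    if "(t, \<tau>) \<in> Delta J" for t \<tau> x y i j
    using Delta_subinterval(2,3)[OF J that] by (auto intro!: has_integral_cong simp: eq)
  note * = this
  show "var_const_right J V1 K T = var_const_right J V2 K T" unfolding var_const_right_def
    by (intro all_cong1 imp_cong refl) (simp only: eq *)
  show "var_const_left J V1 K T = var_const_left J V2 K T" unfolding var_const_left_def
    by (intro all_cong1 imp_cong refl) (simp only: eq *)
  show "weak_var_const_right J V1 K T = weak_var_const_right J V2 K T" unfolding weak_var_const_right_def
    by (intro all_cong1 imp_cong refl) (simp only: eq *)
  show "weak_var_const_left J V1 K T = weak_var_const_left J V2 K T" unfolding weak_var_const_left_def
    by (intro all_cong1 imp_cong refl) (simp only: eq *)
qed

theorem theorem4:
  fixes ci :: "'a::{real_inner, complete_space} \<Rightarrow> 'a"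
    and D :: "'a set" and A :: "'a \<Rightarrow> 'a"
    and J :: "real set"
    and P Pinv Pd G :: "real \<Rightarrow> 'a \<Rightarrow> 'a"
  assumes cs: "complex_structure ci"
    and gen: "generates_c0_contraction ci D A"
    and J: "time_interval J"
    and P_lin: "\<forall>t\<in>J. cblin ci (P t)"
    and P_sa: "\<forall>t\<in>J. \<forall>x y. inner (P t x) y = inner x (P t y)"
    and P_nonneg: "\<forall>t\<in>J. \<forall>x. 0 \<le> inner (P t x) x"
    and Pinv_lin: "\<forall>t\<in>J. cblin ci (Pinv t)"
    and Pinv_inv: "\<forall>t\<in>J. \<forall>x. P t (Pinv t x) = x \<and> Pinv t (P t x) = x"
    and P_C1: "\<forall>z. is_C1_on J (\<lambda>t. P t z) (\<lambda>t. Pd t z)"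
    and Pinv_C1: "\<forall>z. \<exists>d. is_C1_on J (\<lambda>t. Pinv t z) d"
    and G_lin: "\<forall>t\<in>J. cblin ci (G t)"
    and G_cont: "\<forall>z. continuous_on J (\<lambda>t. G t z)"
  shows "let V = Vfam ci J D A P Pinv G; K = (\<lambda>s z. Pinv s (Pd s z)) in
    \<exists>Tr.
      \<comment> \<open>(i)\<close>
      evolution_family ci J Tr \<and> var_const_right J V K Tr
      \<and> (\<forall>T. evolution_family ci J T \<and> var_const_right J V K T
             \<longrightarrow> (\<forall>t \<tau>. (t, \<tau>) \<in> Delta J \<longrightarrow> T t \<tau> = Tr t \<tau>))
      \<comment> \<open>(ii)\<close>
      \<and> var_const_left J V K Tr
      \<and> (\<forall>T. evolution_family ci J T \<and> var_const_left J V K T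
             \<longrightarrow> (\<forall>t \<tau>. (t, \<tau>) \<in> Delta J \<longrightarrow> T t \<tau> = Tr t \<tau>))
      \<comment> \<open>(iii)\<close>
      \<and> (\<forall>S. (\<forall>t \<tau>. (t, \<tau>) \<in> Delta J \<longrightarrow> cblin ci (S t \<tau>))
             \<and> weakly_continuous_family J S \<and> weak_var_const_right J V K S
             \<longrightarrow> (\<forall>t \<tau>. (t, \<tau>) \<in> Delta J \<longrightarrow> S t \<tau> = Tr t \<tau>))
      \<and> (\<forall>S. (\<forall>t \<tau>. (t, \<tau>) \<in> Delta J \<longrightarrow> cblin ci (S t \<tau>))
             \<and> weakly_continuous_family J S \<and> weak_var_const_left J V K S
             \<longrightarrow> (\<forall>t \<tau>. (t, \<tau>) \<in> Delta J \<longrightarrow> S t \<tau> = Tr t \<tau>))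
      \<comment> \<open>(iv)\<close>
      \<and> (\<forall>\<tau>\<in>J. (\<exists>t\<in>J. \<tau> < t) \<longrightarrow> (\<forall>x\<^sub>\<tau>.
            is_C1_on (Jge J \<tau>) (\<lambda>t. emb_m1 D A (Tr t \<tau> x\<^sub>\<tau>))
              (\<lambda>t. A_m1 D A (P t (Tr t \<tau> x\<^sub>\<tau>)) + emb_m1 D A (G t (Tr t \<tau> x\<^sub>\<tau>)))
            \<and> Tr \<tau> \<tau> x\<^sub>\<tau> = x\<^sub>\<tau>))"
proof -
  define gen_n where "gen_n n U \<longleftrightarrow> evolution_family ci J U \<and>
      generates_evol J (\<lambda>_. D) (\<lambda>t x. P t (A x) + P t (Gn J G n t (Pinv t x))) U" for n U
  let ?K = "\<lambda>s z. Pinv s (Pd s z)" and ?V = "Vfam ci J D A P Pinv G"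
  have res: "\<forall>y. \<exists>x\<in>D. x - A x = y" "\<forall>x\<in>D. \<forall>y\<in>D. x - A x = y - A y \<longrightarrow> x = y" and
    ex: "\<exists>V Tr. (\<forall>n. \<exists>U. gen_n n U)
      \<and> (\<forall>U. (\<forall>n. gen_n n (U n)) \<longrightarrow> (\<forall>t \<tau> z. (t, \<tau>) \<in> Delta J \<longrightarrow> (\<lambda>n. U n t \<tau> (P \<tau> z)) \<longlonglongrightarrow> P t (V t \<tau> z)))
      \<and> (\<forall>R. (\<forall>y. R y \<in> D \<and> R y - A (R y) = y) \<longrightarrow> abstract_conclusion ci J R P G V ?K Tr)"
    using perturbed_evolution_complete[of ci D A J P Pinv Pd G, unfolded perturbed_evolution_statement_def converges_to_def] assms
    unfolding gen_n_def by blast+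
  from ex obtain V Tr where VT: "\<forall>n. \<exists>U. gen_n n U"
    "\<forall>U. (\<forall>n. gen_n n (U n)) \<longrightarrow> (\<forall>t \<tau> z. (t, \<tau>) \<in> Delta J \<longrightarrow> (\<lambda>n. U n t \<tau> (P \<tau> z)) \<longlonglongrightarrow> P t (V t \<tau> z))"
    "\<forall>R. (\<forall>y. R y \<in> D \<and> R y - A (R y) = y) \<longrightarrow> abstract_conclusion ci J R P G V ?K Tr"
    by blast
  have R: "\<forall>y. emb_m1 D A y \<in> D \<and> emb_m1 D A y - A (emb_m1 D A y) = y"
  proof
    fix y
    have "\<exists>!x. x \<in> D \<and> x - A x = y" using res by metis
    from theI'[OF this] show "emb_m1 D A y \<in> D \<and> emb_m1 D A y - A (emb_m1 D A y) = y"
      unfolding emb_m1_def resolvent1_def .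
  qed
  have concl: "abstract_conclusion ci J (emb_m1 D A) P G V ?K Tr"
    using VT(3) R by blast
  \<comment> \<open>Existence of a generated family makes the choice in \<open>Tn\<close> a genuine
    one, and the convergence statement holds for whichever family is chosen.\<close>
  have "gen_n n (Tn ci J D A P Pinv G n)" for n
    unfolding Tn_def gen_n_def using VT(1)[rule_format, of n] unfolding gen_n_def by (rule someI_ex)
  then have lim: "(\<lambda>n. Tn ci J D A P Pinv G n t \<tau> (P \<tau> z)) \<longlonglongrightarrow> P t (V t \<tau> z)" if "(t, \<tau>) \<in> Delta J" for t \<tau> z
    using VT(2) that by blast
  \<comment> \<open>As the limit exists, \<open>lim\<close> returns
    \<open>P t (V t \<tau> z)\<close>, and the outer \<open>Pinv t\<close> in \<open>Vfam\<close>
    removes \<open>P t\<close>.\<close>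
  have V: "?V t \<tau> = V t \<tau>" if "(t, \<tau>) \<in> Delta J" for t \<tau>
  proof
    fix z
    have "t \<in> J" using that by (simp add: Delta_def)
    then show "?V t \<tau> z = V t \<tau> z"
      using limI[OF lim[OF that, of z]] Pinv_inv by (simp add: Vfam_def Tl_def)
  qed
  have int: "is_interval J" using J by (simp add: time_interval_def)
  have cong: "var_const_right J ?V ?K T = var_const_right J V ?K T" "var_const_left J ?V ?K T = var_const_left J V ?K T"
    "weak_var_const_right J ?V ?K T = weak_var_const_right J V ?K T"
    "weak_var_const_left J ?V ?K T = weak_var_const_left J V ?K T" for T
    by (rule var_const_cong[OF int]; rule V; assumption)+
  have A: "A_m1 D A x = emb_m1 D A x - x" for x by (simp add: A_m1_def emb_m1_def)
  show ?thesis
    unfolding Let_def cong A by (rule exI[where x = Tr], rule concl[unfolded abstract_conclusion_def])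
qed

end
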